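(* Let $n\ge 3$, $0<p<n$ and $2<q<\infty$. The function $x\mapsto\|x\|_q^{-p}$ on $\mathbb{R}^n$ is a positive definite distribution if $p\in[n-3,n)$, and it is not positive definite if $p\in(0,n-3)$. Therefore, the space $\ell_q^n$ embeds in $L_{-p}$ if and only if $p\in[n-3,n)$.
   Context: $\|x\|_q=\big(\sum_{k=1}^n|x_k|^q\big)^{1/q}$, and $\ell_q^n=(\mathbb{R}^n,\|\cdot\|_q)$. For $0<p<n$ the function $\|x\|_q^{-p}$ is locally integrable and is regarded as a tempered distribution. $\mathcal{S}(\mathbb{R}^n)$ is the (complex-valued) Schwartz space; its elements are called test functions, and $\mathcal{S}'(\mathbb{R}^n)$ is the space of distributions over it. The Fourier transform of a test function is $\hat\phi(\xi)=\int_{\mathbb{R}^n}\phi(x)e^{-i(x,\xi)}\,dx$. A distribution $f\in\mathcal{S}'(\mathbb{R}^n)$ is called positive definite if $\langle f,\ \phi*\overline{\phi(-x)}\rangle\ge 0$ for every test function $\phi$. Embedding in $L_{-p}$: let $\Omega$ be the Euclidean unit sphere in $\mathbb{R}^n$. For $p\in(0,n)$, a space $(\mathbb{R}^n,\|\cdot\|)$ embeds in $L_{-p}$ if there exists a finite (non-negative) symmetric Borel measure $\gamma$ on $\Omega$ such that for every test function $\phi$ $$\int_{\mathbb{R}^n}\|x\|^{-p}\phi(x)\,dx=\int_\Omega d\gamma(\xi)\int_{\mathbb{R}}|t|^{p-1}\hat\phi(t\xi)\,dt .$$ *)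

theory Defs
  imports "HOL-Analysis.Analysis"
begin

definition partial_derivative ::
    "'n \<Rightarrow> (real ^ 'n::finite \<Rightarrow> complex) \<Rightarrow> real ^ 'n \<Rightarrow> complex" where
  "partial_derivative k f x = frechet_derivative f (at x) (axis k 1)"

(* A list of coordinates stands for the corresponding iterated partial derivative;
   on smooth functions only the multi-index of the list matters. *)
primrec iterated_partial ::
    "'n list \<Rightarrow> (real ^ 'n::finite \<Rightarrow> complex) \<Rightarrow> real ^ 'n \<Rightarrow> complex" where
  "iterated_partial [] f = f"
| "iterated_partial (k # ks) f = partial_derivative k (iterated_partial ks f)"

(* Requiring every iterated partial derivative to be totally differentiable is the same as
   C^infinity, and makes all the derivatives in the decay condition genuine ones. *)
definition schwartz :: "(real ^ 'n::finite \<Rightarrow> complex) set" where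
  "schwartz = {\<phi>.
     (\<forall>ks x. iterated_partial ks \<phi> differentiable (at x)) \<and>
     (\<forall>m ks. \<exists>C. \<forall>x. norm x ^ m * norm (iterated_partial ks \<phi> x) \<le> C)}"

definition schwartz_seminorm ::
    "nat \<Rightarrow> 'n list \<Rightarrow> (real ^ 'n::finite \<Rightarrow> complex) \<Rightarrow> real" where
  "schwartz_seminorm m ks \<phi> = (SUP x. norm x ^ m * norm (iterated_partial ks \<phi> x))"

definition schwartz_tendsto ::
    "(nat \<Rightarrow> real ^ 'n::finite \<Rightarrow> complex) \<Rightarrow> (real ^ 'n \<Rightarrow> complex) \<Rightarrow> bool" where
  "schwartz_tendsto \<phi>s \<phi> \<longleftrightarrow>
     (\<forall>m ks. (\<lambda>j. schwartz_seminorm m ks (\<lambda>x. \<phi>s j x - \<phi> x)) \<longlonglongrightarrow> 0)"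

(* Continuity is sequential, which suffices because the countable family of seminorms makes
   the Schwartz space metrizable.  Values outside the Schwartz space are irrelevant. *)
definition tempered_distribution :: "((real ^ 'n::finite \<Rightarrow> complex) \<Rightarrow> complex) \<Rightarrow> bool" where
  "tempered_distribution T \<longleftrightarrow>
     (\<forall>\<phi>\<in>schwartz. \<forall>\<psi>\<in>schwartz. \<forall>a b.
        T (\<lambda>x. a * \<phi> x + b * \<psi> x) = a * T \<phi> + b * T \<psi>) \<and>
     (\<forall>\<phi>s. \<forall>\<phi>\<in>schwartz. (\<forall>j. \<phi>s j \<in> schwartz) \<longrightarrow> schwartz_tendsto \<phi>s \<phi> \<longrightarrow>
        (\<lambda>j. T (\<phi>s j)) \<longlonglongrightarrow> T \<phi>)"

definition function_distribution ::
    "(real ^ 'n::finite \<Rightarrow> real) \<Rightarrow> (real ^ 'n \<Rightarrow> complex) \<Rightarrow> complex" where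
  "function_distribution f \<phi> = (\<integral>x. complex_of_real (f x) * \<phi> x \<partial>lborel)"

definition convolution ::
    "(real ^ 'n::finite \<Rightarrow> complex) \<Rightarrow> (real ^ 'n \<Rightarrow> complex) \<Rightarrow> real ^ 'n \<Rightarrow> complex" where
  "convolution \<phi> \<psi> x = (\<integral>y. \<phi> y * \<psi> (x - y) \<partial>lborel)"

(* Meant for tempered distributions T. *)
definition positive_definite :: "((real ^ 'n::finite \<Rightarrow> complex) \<Rightarrow> complex) \<Rightarrow> bool" where
  "positive_definite T \<longleftrightarrow>
     (\<forall>\<phi>\<in>schwartz. T (convolution \<phi> (\<lambda>x. cnj (\<phi> (- x)))) \<in> \<real>\<^sub>\<ge>\<^sub>0)"

definition fourier :: "(real ^ 'n::finite \<Rightarrow> complex) \<Rightarrow> real ^ 'n \<Rightarrow> complex" where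
  "fourier \<phi> \<xi> = (\<integral>x. \<phi> x * exp (- (\<i> * complex_of_real (x \<bullet> \<xi>))) \<partial>lborel)"

definition lq_norm :: "real \<Rightarrow> real ^ 'n::finite \<Rightarrow> real" where
  "lq_norm q x = (\<Sum>k\<in>UNIV. \<bar>x $ k\<bar> powr q) powr (1 / q)"

(* Embedding into L_{-p} of the space R^n with norm N, for 0 < p < n.
   In both powers the convention 0 powr a = 0 affects only a null set. *)
definition embeds_in_L_neg :: "real \<Rightarrow> (real ^ 'n::finite \<Rightarrow> real) \<Rightarrow> bool" where
  "embeds_in_L_neg p N \<longleftrightarrow>
     (\<exists>\<gamma>. sets \<gamma> = sets (restrict_space borel (sphere (0 :: real ^ 'n) 1)) \<and>
          finite_measure \<gamma> \<and>
          (\<forall>A\<in>sets \<gamma>. emeasure \<gamma> (uminus ` A) = emeasure \<gamma> A) \<and>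
          (\<forall>\<phi>\<in>schwartz.
             (\<integral>x. complex_of_real (N x powr (- p)) * \<phi> x \<partial>lborel) =
             (\<integral>\<xi>. (\<integral>t. complex_of_real (\<bar>t\<bar> powr (p - 1)) * fourier \<phi> (t *\<^sub>R \<xi>) \<partial>lborel) \<partial>\<gamma>)))"

end

theory Submission
  imports Defs "HOL-Probability.Probability"
begin

text \<open>Write $n$ for the dimension and $\gamma_q$ for the Fourier transform of $e^{-|x|^q}$.

  If \<open>p \<ge> n - 3\<close>: integrating \<open>\<bar>t\<bar> powr (p - 1) * exp (- (\<bar>t\<bar> * lq_norm q x) powr q)\<close> over \<open>t\<close> yields a
  multiple of \<open>lq_norm q x powr (- p)\<close>, so the transform of the latter is given, up to a positive constant, by the
  integral of $|t|^{n-p-1} \prod_k \gamma_q(t \xi_k)$ over $t$.  The product is the transform of a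
  convolution of symmetric unimodal functions, which is again symmetric and unimodal.  For a
  unimodal function the moments of its transform of every order at most \<open>2\<close> are nonnegative,
  and here the order is \<open>n - p - 1 \<le> 2\<close>.

  If \<open>p < n - 3\<close>: smoothing the distribution by a Gaussian in all variables but one and restricting it to the
  remaining axis gives a function $M$ with $M(0) - M(u) = o(u^2)$, because \<open>q > 2\<close> and the majorant
  \<open>\<bar>x\<bar> powr (- p - 2)\<close> is locally integrable in dimension \<open>n - 1\<close>.  Positive definiteness would imply
  $M(0) - M(2u) \le 4 (M(0) - M(u))$ and force $M$ to be constant, but $M$ is not.\<close>

text \<open>Positive definiteness pairs the distribution with autocorrelations, while the embedding
  formula speaks of Schwartz functions. For large \<open>p\<close> the formula is therefore proved
  on the wider class \<open>admissible\<close>. For small \<open>p\<close> the test functions are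
  second differences of Gaussians, whose autocorrelations are again combinations of Gaussians; so
  one contradiction refutes both positive definiteness and embeddability. Order 2 is the limit for
  moments because, formally, the second moment of the transform of f is a positive multiple of
  -f''(0), and f is largest at 0. The factor 4 comes from 4 (1 - cos x) - (1 - cos 2x) = 2 (1 - cos
  x)^2: on the Fourier side the defect in the doubling inequality is a square, so it is one
  autocorrelation. Restriction to an axis is not pairing with a test function. The Gaussian
  therefore has a positive width along the axis too, and this width tends to 0 together with the
  step of the difference.\<close>

abbreviation echar :: "real \<Rightarrow> complex" where
  "echar r \<equiv> exp (- (\<i> * complex_of_real r))"

section \<open>Integrals of products over coordinates\<close>

lemma measurable_vec_lambda [measurable]:
  "(\<lambda>f. \<chi> k. f k) \<in> (\<Pi>\<^sub>M k\<in>(UNIV::'n::finite set). (borel::real measure)) \<rightarrow>\<^sub>M borel"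
  by (subst borel_measurable_euclidean_space)
     (auto simp: Basis_vec_def inner_axis intro!: measurable_component_singleton)

text \<open>Agreement on boxes suffices. The product measure on the right brings Fubini for
  functions that factor over the coordinates.\<close>

lemma lborel_vec:
  "(lborel :: (real ^ 'n::finite) measure) =
     distr (\<Pi>\<^sub>M k\<in>(UNIV::'n set). lborel) borel (\<lambda>f. \<chi> k. f k)"
proof (rule lborel_eqI)
  interpret product_sigma_finite "\<lambda>k::'n. lborel :: real measure" ..
  fix l u :: "real ^ 'n"
  assume le: "\<And>b. b \<in> Basis \<Longrightarrow> l \<bullet> b \<le> u \<bullet> b"
  have le': "l $ k \<le> u $ k" for k
    using le[of "axis k 1"] by (simp add: inner_axis axis_in_Basis_iff)
  have m: "(\<lambda>f. \<chi> k. f k) \<in> (\<Pi>\<^sub>M k\<in>(UNIV::'n set). (lborel::real measure)) \<rightarrow>\<^sub>M borel"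
    by (subst measurable_cong_sets[OF sets_PiM_cong[OF refl] refl]) (auto intro: measurable_vec_lambda)
  have pre: "(\<lambda>f. \<chi> k. f k) -` box l u \<inter> space (\<Pi>\<^sub>M k\<in>(UNIV::'n set). (lborel::real measure))
      = Pi\<^sub>E UNIV (\<lambda>k. {l $ k <..< u $ k})"
    by (auto simp: space_PiM mem_box_cart PiE_def Pi_iff)
  have "emeasure (distr (\<Pi>\<^sub>M k\<in>(UNIV::'n set). lborel) borel (\<lambda>f. \<chi> k. f k)) (box l u)
      = (\<Prod>k\<in>(UNIV::'n set). ennreal (u $ k - l $ k))"
    by (subst emeasure_distr[OF m]) (auto simp: pre emeasure_PiM le')
  also have "\<dots> = ennreal (\<Prod>k\<in>(UNIV::'n set). u $ k - l $ k)"
    using le' by (intro prod_ennreal) auto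
  also have "(\<Prod>k\<in>(UNIV::'n set). u $ k - l $ k) = (\<Prod>b\<in>Basis. (u - l) \<bullet> b)"
  proof -
    have B: "(Basis :: (real^'n) set) = range (\<lambda>k. axis k 1)"
      by (auto simp: Basis_vec_def)
    show ?thesis unfolding B
      by (subst prod.reindex) (auto simp: inj_on_def axis_eq_axis inner_axis)
  qed
  finally show "emeasure (distr (\<Pi>\<^sub>M k\<in>(UNIV::'n set). lborel) borel (\<lambda>f. \<chi> k. f k)) (box l u)
      = (\<Prod>b\<in>Basis. (u - l) \<bullet> b)" .
qed simp

lemma
  fixes f :: "'n::finite \<Rightarrow> real \<Rightarrow> 'a::{real_normed_field,banach,second_countable_topology}"
  assumes f: "\<And>k. integrable lborel (f k)"
  shows integrable_vec_prod: "integrable lborel (\<lambda>x::real^'n. \<Prod>k\<in>UNIV. f k (x $ k))"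
    and integral_vec_prod:
      "(\<integral>x. (\<Prod>k\<in>UNIV. f k (x $ k)) \<partial>(lborel :: (real^'n) measure)) = (\<Prod>k\<in>UNIV. (LBINT t. f k t))"
proof -
  interpret product_sigma_finite "\<lambda>k::'n. lborel :: real measure" ..
  have m: "(\<lambda>f. \<chi> k. f k) \<in> (\<Pi>\<^sub>M k\<in>(UNIV::'n set). (lborel::real measure)) \<rightarrow>\<^sub>M borel"
    by (subst measurable_cong_sets[OF sets_PiM_cong[OF refl] refl]) (auto intro: measurable_vec_lambda)
  have [measurable]: "f k \<in> borel_measurable borel" for k
    using borel_measurable_integrable[OF f[of k]] by simp
  have [measurable]: "(\<lambda>x::real^'n. \<Prod>k\<in>UNIV. f k (x $ k)) \<in> borel_measurable borel"
    by measurable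
  show "integrable lborel (\<lambda>x::real^'n. \<Prod>k\<in>UNIV. f k (x $ k))"
    unfolding lborel_vec by (subst integrable_distr_eq[OF m]) (auto intro!: product_integrable_prod f)
  show "(\<integral>x. (\<Prod>k\<in>UNIV. f k (x $ k)) \<partial>(lborel :: (real^'n) measure)) = (\<Prod>k\<in>UNIV. (LBINT t. f k t))"
    unfolding lborel_vec by (subst integral_distr[OF m]) (auto intro!: product_integral_prod f)
qed

lemma AE_vec_nonzero: "AE x in (lborel :: (real^'n::finite) measure). \<forall>k. x $ k \<noteq> 0"
proof -
  have "AE x in (lborel :: (real^'n) measure). x $ k \<noteq> 0" for k
  proof -
    have n: "negligible {x::real^'n. x \<bullet> axis k 1 = 0}"
      by (rule negligible_standard_hyperplane) (simp add: axis_in_Basis_iff)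
    have c: "closed {x::real^'n. x \<bullet> axis k 1 = 0}"
      using closed_hyperplane[of "axis k 1" 0] by (simp add: inner_commute)
    have "{x::real^'n. x \<bullet> axis k 1 = 0} \<in> null_sets lebesgue"
      using n by (simp add: negligible_iff_null_sets)
    then have "{x::real^'n. x \<bullet> axis k 1 = 0} \<in> null_sets lborel"
      using c by (simp add: null_sets_completion_iff)
    then show ?thesis by (auto simp: inner_axis dest!: AE_not_in)
  qed
  then show ?thesis by (simp add: AE_all_countable)
qed

text \<open>Bounding a norm below by a geometric mean of coordinates reduces local integrability of its
  negative powers to dimension one.\<close>

lemma powr_neg_le_prod:
  fixes a r :: real
  assumes "finite A" "A \<noteq> {}" "0 \<le> r" "\<And>k. k \<in> A \<Longrightarrow> 0 < b k \<and> b k \<le> a"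
  shows "a powr (- r) \<le> (\<Prod>k\<in>A. b k powr (- (r / card A)))"
proof -
  have c: "card A > 0" using assms by (simp add: card_gt_0_iff)
  obtain k where "k \<in> A" using assms by auto
  then have a: "a > 0" using assms(4)[of k] by linarith
  have "a powr (- r) = (\<Prod>k\<in>A. a powr (- (r / card A)))"
    using a c by (simp add: powr_power mult.commute)
  also have "\<dots> \<le> (\<Prod>k\<in>A. b k powr (- (r / card A)))"
    using assms a by (intro prod_mono conjI powr_mono2') auto
  finally show ?thesis .
qed

section \<open>Integrability on the line\<close>

lemma set_integrable_powr_01:
  fixes a :: real assumes "a > -1"
  shows "set_integrable lborel {0<..1} (\<lambda>x. x powr a)"
proof -
  have "((\<lambda>x. x powr a) has_integral (1 powr (a + 1) / (a + 1))) {0..1}"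
    by (rule has_integral_powr_from_0) (use assms in auto)
  then have "(\<lambda>x. x powr a) absolutely_integrable_on {0..1}"
    by (intro nonnegative_absolutely_integrable_1) (auto simp: has_integral_integrable_integral)
  then have "set_integrable lebesgue {0<..1} (\<lambda>x. x powr a)"
    by (rule set_integrable_subset) auto
  then show ?thesis
    unfolding set_integrable_def by (subst (asm) integrable_completion) auto
qed

lemma integrable_comp_abs:
  fixes f :: "real \<Rightarrow> 'a::{banach,second_countable_topology}"
  assumes "set_integrable lborel {0<..} f"
  shows "integrable lborel (\<lambda>x. f \<bar>x\<bar>)"
proof -
  let ?g = "\<lambda>x. indicator {0<..} x *\<^sub>R f x"
  have g: "integrable lborel ?g" using assms by (simp add: set_integrable_def)
  have gm: "integrable lborel (\<lambda>x. ?g (- x))"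
    using lborel_integrable_real_affine[OF g, of "-1" 0] by simp
  \<comment> \<open>The third summand restores the value at 0, which makes the final identity hold
    everywhere and not only almost everywhere.\<close>
  have s: "integrable lborel (\<lambda>x. ?g x + ?g (- x) + indicator {0} x *\<^sub>R f 0)"
    using g gm by (intro Bochner_Integration.integrable_add) auto
  show ?thesis
    by (rule iffD1[OF Bochner_Integration.integrable_cong[OF refl] s]) (auto simp: indicator_def)
qed

lemma integrable_powr_near_0:
  fixes a :: real assumes "a > -1"
  shows "integrable lborel (\<lambda>x::real. indicator {0<..1} \<bar>x\<bar> *\<^sub>R \<bar>x\<bar> powr a)"
proof -
  have "(\<lambda>x. indicator {0<..} x *\<^sub>R (indicator {0<..1} x *\<^sub>R x powr a)) =
      (\<lambda>x::real. indicator {0<..1} x *\<^sub>R x powr a)"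
    by (auto simp: indicator_def)
  then have "set_integrable lborel {0<..} (\<lambda>x. indicator {0<..1} x *\<^sub>R x powr a)"
    using set_integrable_powr_01[of a] assms by (simp add: set_integrable_def)
  then show ?thesis by (rule integrable_comp_abs)
qed

text \<open>A single term of the exponential series; it turns exponential decay into polynomial
  decay of any order, for \<open>gexp\<close> and for Gaussians.\<close>

lemma power_le_fact_exp:
  fixes x :: real assumes "0 \<le> x"
  shows "x ^ m \<le> fact m * exp x"
proof -
  have "(\<Sum>n\<in>{m}. x ^ n /\<^sub>R fact n) \<le> exp x"
    unfolding exp_def using assms by (intro sum_le_suminf summable_exp_generic) auto
  then show ?thesis by (simp add: field_simps)
qed

lemma integral_pos_AE:
  fixes f :: "'a \<Rightarrow> real"
  assumes "integrable M f" "AE x in M. 0 < f x" "emeasure M (space M) \<noteq> 0"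
  shows "0 < integral\<^sup>L M f"
proof -
  have nn: "AE x in M. 0 \<le> f x" using assms(2) by eventually_elim simp
  have "integral\<^sup>L M f \<noteq> 0"
  proof
    assume "integral\<^sup>L M f = 0"
    then have "AE x in M. f x = 0"
      using integral_nonneg_eq_0_iff_AE[OF assms(1) nn] by simp
    with assms(2) have "AE x in M. False" by eventually_elim simp
    with assms(3) show False by (simp add: AE_iff_null null_sets_def)
  qed
  with integral_nonneg_AE[OF nn] show ?thesis by simp
qed

lemma integrable_inverse_1_plus_sq: "integrable lborel (\<lambda>x::real. 1 / (1 + x\<^sup>2))"
  using integrable_inverse_1_plus_square by (simp add: set_integrable_def divide_inverse)

lemma integrable_powr_weight:
  fixes a :: real assumes "0 \<le> a" "a < 1"
  shows "integrable lborel (\<lambda>x. \<bar>x\<bar> powr (- a) * (1 / (1 + x\<^sup>2)))"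
proof -
  have "integrable lborel (\<lambda>x::real. indicator {0<..1} \<bar>x\<bar> *\<^sub>R \<bar>x\<bar> powr (- a))"
    using assms by (intro integrable_powr_near_0) auto
  then have "integrable lborel (\<lambda>x::real. indicator {0<..1} \<bar>x\<bar> *\<^sub>R \<bar>x\<bar> powr (- a) + 1 / (1 + x\<^sup>2))"
    by (intro Bochner_Integration.integrable_add integrable_inverse_1_plus_sq)
  then show ?thesis
  proof (rule Bochner_Integration.integrable_bound)
    show "AE x in lborel. norm (\<bar>x\<bar> powr (- a) * (1 / (1 + x\<^sup>2)))
        \<le> norm (indicator {0<..1} \<bar>x\<bar> *\<^sub>R \<bar>x\<bar> powr (- a) + 1 / (1 + x\<^sup>2))"
    proof (rule AE_I2)
      fix x :: real
      show "norm (\<bar>x\<bar> powr (- a) * (1 / (1 + x\<^sup>2)))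
        \<le> norm (indicator {0<..1} \<bar>x\<bar> *\<^sub>R \<bar>x\<bar> powr (- a) + 1 / (1 + x\<^sup>2))"
      proof (cases "\<bar>x\<bar> \<le> 1")
        case True
        have "\<bar>x\<bar> powr (- a) * (1 / (1 + x\<^sup>2)) \<le> \<bar>x\<bar> powr (- a) * 1"
          by (intro mult_left_mono) (auto simp: field_simps add_pos_nonneg)
        with True show ?thesis
          by (cases "x = 0") (auto simp: abs_mult intro!: add_increasing2)
      next
        case False
        have "\<bar>x\<bar> powr (- a) \<le> 1"
          using False assms by (simp add: powr_le_one_le powr_minus inverse_le_1_iff ge_one_powr_ge_zero)
        then have "\<bar>x\<bar> powr (- a) * (1 / (1 + x\<^sup>2)) \<le> 1 * (1 / (1 + x\<^sup>2))"
          by (intro mult_right_mono) (auto simp: field_simps add_pos_nonneg)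
        with False show ?thesis by (auto simp: abs_mult)
      qed
    qed
  qed auto
qed

section \<open>The norm and a weight that factors over the coordinates\<close>

lemma
  assumes "0 < q"
  shows lq_norm_nonneg: "0 \<le> lq_norm q x"
    and lq_norm_ge_component: "\<bar>x $ k\<bar> \<le> lq_norm q x"
    and lq_norm_powr: "lq_norm q x powr q = (\<Sum>k\<in>UNIV. \<bar>x $ k\<bar> powr q)"
proof -
  show "0 \<le> lq_norm q x" by (simp add: lq_norm_def)
  have "\<bar>x $ k\<bar> = (\<bar>x $ k\<bar> powr q) powr (1/q)" using assms by (simp add: powr_powr)
  also have "\<dots> \<le> lq_norm q x" unfolding lq_norm_def
    by (intro powr_mono2 member_le_sum) (use assms in auto)
  finally show "\<bar>x $ k\<bar> \<le> lq_norm q x" .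
  show "lq_norm q x powr q = (\<Sum>k\<in>UNIV. \<bar>x $ k\<bar> powr q)"
    using assms by (simp add: lq_norm_def powr_powr sum_nonneg)
qed

lemma borel_measurable_lq_norm [measurable]: "lq_norm q \<in> borel_measurable borel"
  unfolding lq_norm_def[abs_def] by measurable

text \<open>A common majorant for test functions. As a product it stays integrable against singular
  powers by one-dimensional estimates alone.\<close>

definition weight :: "real ^ 'n::finite \<Rightarrow> real" where
  "weight x = (\<Prod>k\<in>UNIV. 1 / (1 + (x $ k)\<^sup>2))"

lemma weight_pos: "0 < weight x"
  unfolding weight_def by (intro prod_pos) (auto simp: add_pos_nonneg)

lemma weight_nonneg [simp]: "0 \<le> weight x"
  using weight_pos[of x] by simp

lemma weight_le_1: "weight x \<le> 1"
  unfolding weight_def by (intro prod_le_1) (auto simp: field_simps add_pos_nonneg)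

lemma borel_measurable_weight [measurable]: "weight \<in> borel_measurable borel"
  unfolding weight_def[abs_def] by measurable

lemma integrable_weight: "integrable lborel weight"
  unfolding weight_def by (intro integrable_vec_prod integrable_inverse_1_plus_sq)

text \<open>The singularity is shared equally among the coordinates in \<open>A\<close>, each of
  which receives the exponent \<open>r / card A\<close> below 1; the others receive exponent 0.
  \<open>A\<close> is the whole index set for the norm and omits one index for the sections of the
  ball structure along an axis.\<close>

lemma integrable_powr_neg_weight:
  fixes N :: "real ^ 'n::finite \<Rightarrow> real"
  assumes "A \<noteq> {}" "0 \<le> r" "r < real (card A)" "\<And>x k. k \<in> A \<Longrightarrow> \<bar>x $ k\<bar> \<le> N x"
    and [measurable]: "N \<in> borel_measurable borel"
  shows "integrable lborel (\<lambda>x. N x powr (- r) * weight x)"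
proof -
  let ?a = "r / card A"
  have c: "card A > 0" using assms by (simp add: card_gt_0_iff)
  have a: "0 \<le> ?a" "?a < 1" using assms c by (auto simp: field_simps)
  let ?g = "\<lambda>x::real^'n. \<Prod>k\<in>UNIV. \<bar>x $ k\<bar> powr (- (if k \<in> A then ?a else 0)) * (1 / (1 + (x $ k)\<^sup>2))"
  have "integrable lborel ?g"
    by (intro integrable_vec_prod[where f="\<lambda>k t. \<bar>t\<bar> powr (- (if k \<in> A then ?a else 0)) * (1 / (1 + t\<^sup>2))"]
         integrable_powr_weight) (use a in auto)
  then show ?thesis
  proof (rule Bochner_Integration.integrable_bound)
    show "AE x in lborel. norm (N x powr (- r) * weight x) \<le> norm (?g x)"
      using AE_vec_nonzero
    proof eventually_elim
      case (elim x)
      have "N x powr (- r) \<le> (\<Prod>k\<in>A. \<bar>x $ k\<bar> powr (- ?a))"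
        by (intro powr_neg_le_prod) (use elim assms in auto)
      also have "\<dots> = (\<Prod>k\<in>UNIV. \<bar>x $ k\<bar> powr (- (if k \<in> A then ?a else 0)))"
        using elim by (intro prod.mono_neutral_cong_left) auto
      finally have "N x powr (- r) * weight x \<le> \<dots> * weight x"
        by (intro mult_right_mono) auto
      also have "\<dots> = ?g x" by (simp add: weight_def prod.distrib[symmetric])
      finally show ?case by (simp add: abs_mult)
    qed
  qed auto
qed

text \<open>In each coordinate, a^2 <= 2 b^2 + 2 (a - b)^2 gives 1 + a^2 <= 2 (1 + b^2) (1 + (a -
  b)^2). This lets the weight survive convolution.\<close>

lemma weight_mult_le: "weight y * weight (x - y) \<le> 2 ^ CARD('n) * weight (x :: real ^ 'n::finite)"
proof -
  have *: "1 / (1 + b\<^sup>2) * (1 / (1 + (a - b)\<^sup>2)) \<le> 2 * (1 / (1 + a\<^sup>2))" for a b :: real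
  proof -
    have "a\<^sup>2 \<le> 2 * b\<^sup>2 + 2 * (a - b)\<^sup>2"
      using zero_le_power2[of "2 * b - a"] by (simp add: power2_eq_square algebra_simps)
    moreover have "0 \<le> b\<^sup>2 * (a - b)\<^sup>2" by simp
    moreover have "(1 + b\<^sup>2) * (1 + (a - b)\<^sup>2) = 1 + b\<^sup>2 + (a - b)\<^sup>2 + b\<^sup>2 * (a - b)\<^sup>2"
      by (simp add: algebra_simps)
    ultimately have "1 + a\<^sup>2 \<le> 2 * ((1 + b\<^sup>2) * (1 + (a - b)\<^sup>2))" using zero_le_power2[of b] zero_le_power2[of "a - b"] by linarith
    moreover have "0 < 1 + a\<^sup>2" "0 < (1 + b\<^sup>2) * (1 + (a - b)\<^sup>2)" by (auto simp: add_pos_nonneg)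
    ultimately show ?thesis by (simp add: field_simps)
  qed
  have "weight y * weight (x - y) = (\<Prod>k\<in>UNIV. 1 / (1 + (y $ k)\<^sup>2) * (1 / (1 + (x $ k - y $ k)\<^sup>2)))"
    unfolding weight_def vector_minus_component by (rule prod.distrib[symmetric])
  also have "\<dots> \<le> (\<Prod>k\<in>(UNIV::'n set). 2 * (1 / (1 + (x $ k)\<^sup>2)))"
    by (intro prod_mono conjI *) (auto simp: add_pos_nonneg)
  also have "\<dots> = 2 ^ CARD('n) * weight x" by (simp only: weight_def prod.distrib prod_constant)
  finally show ?thesis .
qed

section \<open>Affine changes of variables\<close>

lemma
  fixes f :: "'a::euclidean_space \<Rightarrow> 'b::{banach,second_countable_topology}"
  assumes [measurable]: "f \<in> borel_measurable borel" and c: "c \<noteq> 0"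
  shows integral_lborel_affine:
      "(LBINT x. f x) = \<bar>c\<bar> ^ DIM('a) *\<^sub>R (LBINT x. f (t + c *\<^sub>R x))"
    and integrable_lborel_affine:
      "integrable lborel (\<lambda>x. f (t + c *\<^sub>R x)) \<longleftrightarrow> integrable lborel f"
proof -
  let ?D = "density (distr lborel borel (\<lambda>x::'a. t + c *\<^sub>R x)) (\<lambda>_. ennreal (\<bar>c\<bar> ^ DIM('a)))"
  have eq: "lborel = ?D"
    using lborel_affine[OF c, of t] by (simp add: ennreal_power)
  have "(LBINT x. f x) = (\<integral>x. f x \<partial>?D)" using eq by simp
  also have "\<dots> = \<bar>c\<bar> ^ DIM('a) *\<^sub>R (LBINT x. f (t + c *\<^sub>R x))"
    by (subst integral_density) (auto simp: integral_distr)
  finally show "(LBINT x. f x) = \<bar>c\<bar> ^ DIM('a) *\<^sub>R (LBINT x. f (t + c *\<^sub>R x))" .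
  have "integrable lborel f \<longleftrightarrow> integrable ?D f" using eq by simp
  also have "\<dots> \<longleftrightarrow> integrable lborel (\<lambda>x. f (t + c *\<^sub>R x))"
  proof -
    have "integrable lborel (\<lambda>x. f (t + c *\<^sub>R x))"
      if "integrable lborel (\<lambda>x. \<bar>c\<bar> ^ DIM('a) *\<^sub>R f (t + c *\<^sub>R x))"
      using integrable_scaleR_right[OF that, of "inverse (\<bar>c\<bar> ^ DIM('a))"] c by simp
    then show ?thesis by (subst integrable_density) (auto simp: integrable_distr_eq)
  qed
  finally show "integrable lborel (\<lambda>x. f (t + c *\<^sub>R x)) \<longleftrightarrow> integrable lborel f" by simp
qed

lemma
  fixes f :: "'a::euclidean_space \<Rightarrow> 'b::{banach,second_countable_topology}"
  assumes f: "f \<in> borel_measurable borel"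
  shows integral_lborel_shift: "(LBINT x. f (x + t)) = (LBINT x. f x)"
    and integrable_lborel_shift: "integrable lborel (\<lambda>x. f (x + t)) \<longleftrightarrow> integrable lborel f"
    and integral_lborel_uminus: "(LBINT x. f (- x)) = (LBINT x. f x)"
    and integrable_lborel_uminus: "integrable lborel (\<lambda>x. f (- x)) \<longleftrightarrow> integrable lborel f"
    and integral_lborel_reflect: "(LBINT x. f (t - x)) = (LBINT x. f x)"
    and integrable_lborel_reflect: "integrable lborel (\<lambda>x. f (t - x)) \<longleftrightarrow> integrable lborel f"
  using integral_lborel_affine[OF f, of 1 t] integrable_lborel_affine[OF f, of 1 t]
    integral_lborel_affine[OF f, of "-1" 0] integrable_lborel_affine[OF f, of "-1" 0]
    integral_lborel_affine[OF f, of "-1" t] integrable_lborel_affine[OF f, of "-1" t]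
  by (simp_all add: add.commute)

lemma has_vector_derivative_exp_line:
  fixes a b :: complex
  shows "((\<lambda>t. exp (a + t *\<^sub>R b)) has_vector_derivative b * exp (a + t *\<^sub>R b)) (at t)"
proof -
  have "((\<lambda>t. a + t *\<^sub>R b) has_vector_derivative b) (at t)"
    by (auto intro!: derivative_eq_intros)
  from field_vector_diff_chain_at[OF this DERIV_exp] show ?thesis by (simp add: o_def)
qed

text \<open>Integrate f' along the segment from x to x + e and then over x. By translation
  invariance one order of integration gives the integral of f', the other the integral of f (x + e)
  - f x, which is 0. This yields integration by parts from integrability alone, without boundary
  terms.\<close>

lemma integral_directional_derivative_eq_0:
  fixes f f' :: "'a::euclidean_space \<Rightarrow> 'b::euclidean_space"
  assumes f: "integrable lborel f" and f': "integrable lborel f'"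
    and cont: "continuous_on UNIV f'"
    and deriv: "\<And>x t. ((\<lambda>t. f (x + t *\<^sub>R e)) has_vector_derivative f' (x + t *\<^sub>R e)) (at t)"
  shows "(LBINT x. f' x) = 0"
proof -
  have [measurable]: "f \<in> borel_measurable borel" "f' \<in> borel_measurable borel"
    using f f' by (auto dest: borel_measurable_integrable)
  let ?g = "\<lambda>(t::real, x). indicator {0..1} t *\<^sub>R f' (x + t *\<^sub>R e)"
  have shift: "integrable lborel (\<lambda>x. f' (x + s))" "integrable lborel (\<lambda>x. f (x + s))" for s
    using f f' by (simp_all add: integrable_lborel_shift)
  have g: "integrable (lborel \<Otimes>\<^sub>M lborel) ?g"
  proof (rule lborel_pair.Fubini_integrable)
    have "(\<lambda>t. LBINT x. norm (?g (t, x))) = (\<lambda>t. indicator {0..1} t *\<^sub>R (LBINT x. norm (f' x)))"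
      by (rule ext) (simp add: integral_lborel_shift[of "\<lambda>x. norm (f' x)"])
    then show "integrable lborel (\<lambda>t. LBINT x. norm (?g (t, x)))" by simp
  qed (auto intro!: shift)
  have ftc: "(LBINT t. ?g (t, x)) = f (x + e) - f x" for x
  proof -
    have "continuous_on {0..1} (\<lambda>t. f' (x + t *\<^sub>R e))"
      by (intro continuous_on_compose2[OF cont]) (auto intro!: continuous_intros)
    then have "(LBINT t. indicator {0..1} t *\<^sub>R f' (x + t *\<^sub>R e)) = f (x + 1 *\<^sub>R e) - f (x + 0 *\<^sub>R e)"
      by (intro integral_FTC_atLeastAtMost)
         (auto intro: has_vector_derivative_at_within[OF deriv])
    then show ?thesis by simp
  qed
  have "(LBINT x. f' x) = (\<integral>t. indicator {0..1} t *\<^sub>R (LBINT x. f' x) \<partial>(lborel::real measure))"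
    by simp
  also have "\<dots> = (LBINT t. (LBINT x. ?g (t, x)))"
    by (simp add: integral_lborel_shift)
  also have "\<dots> = (LBINT x. (LBINT t. ?g (t, x)))"
    using lborel_pair.Fubini_integral[of "\<lambda>t x. ?g (t, x)"] g by simp
  also have "\<dots> = (LBINT x. f (x + e)) - (LBINT x. f x)"
    unfolding ftc by (intro Bochner_Integration.integral_diff shift f)
  also have "\<dots> = 0" by (simp add: integral_lborel_shift)
  finally show ?thesis .
qed

section \<open>Schwartz functions\<close>

lemma iterated_partial_append:
  "iterated_partial (ks @ ls) f = iterated_partial ks (iterated_partial ls f)"
  by (induction ks) auto

lemma schwartz_differentiable: "\<phi> \<in> schwartz \<Longrightarrow> iterated_partial ks \<phi> differentiable (at x)"
  by (simp add: schwartz_def)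

lemma schwartz_decay:
  assumes "\<phi> \<in> schwartz"
  obtains C where "\<And>x. norm x ^ m * norm (iterated_partial ks \<phi> x) \<le> C"
  using assms unfolding schwartz_def by blast

lemma schwartz_continuous:
  assumes "\<phi> \<in> schwartz" shows "continuous_on S \<phi>"
  using schwartz_differentiable[OF assms, of "[]"]
  by (auto intro!: continuous_at_imp_continuous_on differentiable_imp_continuous_within)

lemma schwartz_borel_measurable:
  "\<phi> \<in> schwartz \<Longrightarrow> \<phi> \<in> borel_measurable borel"
  by (intro borel_measurable_continuous_onI schwartz_continuous)

lemma schwartz_iterated_partial:
  assumes "\<phi> \<in> schwartz" shows "iterated_partial ls \<phi> \<in> schwartz"
  using assms unfolding schwartz_def by (simp flip: iterated_partial_append)

lemma schwartz_partial_derivative: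
  "\<phi> \<in> schwartz \<Longrightarrow> partial_derivative k \<phi> \<in> schwartz"
  using schwartz_iterated_partial[of \<phi> "[k]"] by simp

lemma partial_derivative_eq:
  "(f has_derivative f') (at x) \<Longrightarrow> partial_derivative k f x = f' (axis k 1)"
  by (simp add: partial_derivative_def frechet_derivative_at[symmetric])

lemma iterated_partial_linear:
  assumes "\<And>ks x. iterated_partial ks f differentiable (at x)"
    and "\<And>ks x. iterated_partial ks g differentiable (at x)"
  shows "iterated_partial ks (\<lambda>x. a * f x + b * g x) =
    (\<lambda>x. a * iterated_partial ks f x + b * iterated_partial ks g x)"
proof (induction ks)
  case (Cons k ks)
  show ?case
  proof
    fix x
    let ?f = "iterated_partial ks f" and ?g = "iterated_partial ks g"
    have "((\<lambda>x. a * ?f x + b * ?g x) has_derivative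
        (\<lambda>h. a * frechet_derivative ?f (at x) h + b * frechet_derivative ?g (at x) h)) (at x)"
      by (intro has_derivative_add has_derivative_mult_right)
         (auto intro: assms simp flip: frechet_derivative_works)
    from partial_derivative_eq[OF this, of k]
    show "iterated_partial (k # ks) (\<lambda>x. a * f x + b * g x) x =
      a * iterated_partial (k # ks) f x + b * iterated_partial (k # ks) g x"
      by (simp add: Cons.IH) (simp add: partial_derivative_def)
  qed
qed simp

lemma schwartz_linear:
  assumes f: "f \<in> schwartz" and g: "g \<in> schwartz"
  shows "(\<lambda>x. a * f x + b * g x) \<in> schwartz"
proof -
  note eq = iterated_partial_linear[OF schwartz_differentiable[OF f] schwartz_differentiable[OF g]]
  have "\<exists>C. \<forall>x. norm x ^ m * norm (iterated_partial ks (\<lambda>x. a * f x + b * g x) x) \<le> C" for m ks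
  proof -
    obtain C D where C: "\<And>x. norm x ^ m * norm (iterated_partial ks f x) \<le> C"
      and D: "\<And>x. norm x ^ m * norm (iterated_partial ks g x) \<le> D"
      using schwartz_decay[OF f] schwartz_decay[OF g] by metis
    have "norm x ^ m * norm (a * iterated_partial ks f x + b * iterated_partial ks g x)
        \<le> norm a * C + norm b * D" for x
    proof -
      have "norm x ^ m * norm (a * iterated_partial ks f x + b * iterated_partial ks g x)
        \<le> norm x ^ m * (norm a * norm (iterated_partial ks f x) + norm b * norm (iterated_partial ks g x))"
        by (intro mult_left_mono norm_triangle_mono) (auto simp: norm_mult)
      also have "\<dots> = norm a * (norm x ^ m * norm (iterated_partial ks f x)) +
          norm b * (norm x ^ m * norm (iterated_partial ks g x))" by (simp add: algebra_simps)
      also have "\<dots> \<le> norm a * C + norm b * D"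
        by (intro add_mono mult_left_mono C D) auto
      finally show ?thesis .
    qed
    then show ?thesis unfolding eq by blast
  qed
  moreover have "iterated_partial ks (\<lambda>x. a * f x + b * g x) differentiable (at x)" for ks x
    unfolding eq by (intro derivative_intros schwartz_differentiable f g)
  ultimately show ?thesis by (simp add: schwartz_def)
qed

text \<open>Each factor 1 + x_k^2 is at most 2 max(1, |x|^2), and the square of the product has 2n
  such factors, whence 2^(2n) = 4^n and the power 4n of the norm. The weight is squared because the
  bound for an autocorrelation spends one copy on the integral and keeps the other.\<close>

lemma one_le_weight_sq:
  "1 \<le> 4 ^ CARD('n) * (1 + norm x ^ (4 * CARD('n))) * (weight (x :: real ^ 'n::finite))\<^sup>2"
proof -
  let ?n = "CARD('n)"
  have "(\<Prod>k\<in>UNIV. 1 + (x $ k)\<^sup>2) \<le> (\<Prod>k\<in>(UNIV::'n set). 1 + (norm x)\<^sup>2)"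
    by (intro prod_mono) (auto simp: add_nonneg_nonneg abs_le_square_iff[symmetric] component_le_norm_cart)
  also have "\<dots> = (1 + (norm x)\<^sup>2) ^ ?n" by simp
  finally have 1: "(\<Prod>k\<in>UNIV. 1 + (x $ k)\<^sup>2)\<^sup>2 \<le> ((1 + (norm x)\<^sup>2) ^ ?n)\<^sup>2"
    by (intro power_mono) (auto intro!: prod_nonneg)
  have "1 + (norm x)\<^sup>2 \<le> 2 * max 1 ((norm x)\<^sup>2)" by auto
  then have "(1 + (norm x)\<^sup>2) ^ (2 * ?n) \<le> (2 * max 1 ((norm x)\<^sup>2)) ^ (2 * ?n)"
    by (intro power_mono) auto
  also have "\<dots> = 4 ^ ?n * max 1 ((norm x)\<^sup>2) ^ (2 * ?n)"
    by (simp add: power_mult_distrib power_mult)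
  also have "max 1 ((norm x)\<^sup>2) ^ (2 * ?n) \<le> 1 + norm x ^ (4 * ?n)"
    by (auto simp: max_def simp flip: power_mult)
  finally have 2: "((1 + (norm x)\<^sup>2) ^ ?n)\<^sup>2 \<le> 4 ^ ?n * (1 + norm x ^ (4 * ?n))"
    by (simp add: mult.commute flip: power_mult)
  have w: "weight x * (\<Prod>k\<in>UNIV. 1 + (x $ k)\<^sup>2) = 1"
    unfolding weight_def prod.distrib[symmetric]
    by (intro prod.neutral) (auto simp: add_pos_nonneg less_imp_neq[symmetric])
  have "1 = (\<Prod>k\<in>UNIV. 1 + (x $ k)\<^sup>2)\<^sup>2 * (weight x)\<^sup>2"
    using w by (simp add: mult.commute flip: power_mult_distrib)
  also have "\<dots> \<le> 4 ^ ?n * (1 + norm x ^ (4 * ?n)) * (weight x)\<^sup>2"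
    using 1 2 by (intro mult_right_mono) auto
  finally show ?thesis .
qed

text \<open>Only a bound on the values and one weighted bound enter; with seminorms for
  \<open>A\<close> and \<open>B\<close> this becomes the continuity estimate for the
  distribution.\<close>

lemma norm_le_weight_sq:
  fixes x :: "real ^ 'n::finite" and v :: "'a::real_normed_vector"
  assumes "norm v \<le> A" "norm x ^ (4 * CARD('n)) * norm v \<le> B"
  shows "norm v \<le> 4 ^ CARD('n) * (A + B) * (weight x)\<^sup>2"
proof -
  have "norm v * 1 \<le> norm v * (4 ^ CARD('n) * (1 + norm x ^ (4 * CARD('n))) * (weight x)\<^sup>2)"
    by (intro mult_left_mono one_le_weight_sq) auto
  also have "\<dots> = 4 ^ CARD('n) * (weight x)\<^sup>2 * (norm v + norm x ^ (4 * CARD('n)) * norm v)"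
    by (simp add: algebra_simps)
  also have "\<dots> \<le> 4 ^ CARD('n) * (weight x)\<^sup>2 * (A + B)"
    using assms by (intro mult_left_mono add_mono) auto
  finally show ?thesis by (simp add: mult_ac)
qed

lemma schwartz_le_weight_sq:
  assumes "\<phi> \<in> schwartz"
  obtains C where "0 \<le> C" "\<And>x. norm (\<phi> x) \<le> C * (weight x)\<^sup>2"
proof -
  obtain A B where A: "\<And>x. norm (\<phi> x) \<le> A"
    and B: "\<And>x. norm x ^ (4 * CARD('a)) * norm (\<phi> x) \<le> B"
    using schwartz_decay[OF assms, of 0 "[]"] schwartz_decay[OF assms, of "4 * CARD('a)" "[]"]
    by auto metis
  have "0 \<le> A" using order_trans[OF norm_ge_zero A] .
  moreover have "0 \<le> B" by (rule order_trans[OF _ B[of 0]]) simp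
  ultimately show thesis
    using norm_le_weight_sq[OF A B] by (intro that[of "4 ^ CARD('a) * (A + B)"]) auto
qed

lemma weight_sq_le: "(weight x)\<^sup>2 \<le> weight x"
  using mult_left_mono[OF weight_le_1, of "weight x" x] by (simp add: power2_eq_square)

lemma schwartz_le_weight:
  assumes "\<phi> \<in> schwartz"
  obtains C where "0 \<le> C" "\<And>x. norm (\<phi> x) \<le> C * weight x"
proof -
  obtain C where C: "0 \<le> C" "\<And>x. norm (\<phi> x) \<le> C * (weight x)\<^sup>2"
    using schwartz_le_weight_sq[OF assms] by blast
  have "norm (\<phi> x) \<le> C * weight x" for x
    by (rule order_trans[OF C(2) mult_left_mono[OF weight_sq_le C(1)]])
  with C(1) show thesis using that by blast
qed

lemma integrable_le_weight:
  fixes f :: "real ^ 'n::finite \<Rightarrow> 'a::{banach,second_countable_topology}"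
  assumes "f \<in> borel_measurable borel" "\<And>x. norm (f x) \<le> C * weight x"
  shows "integrable lborel f"
  by (rule Bochner_Integration.integrable_bound[OF integrable_mult_right[OF integrable_weight, of C]])
     (use assms in \<open>auto intro!: AE_I2 intro: order_trans[OF _ abs_ge_self]\<close>)

lemma schwartz_integrable:
  assumes "\<phi> \<in> schwartz" shows "integrable lborel \<phi>"
  using schwartz_le_weight[OF assms] integrable_le_weight[OF schwartz_borel_measurable[OF assms]] by metis

section \<open>Fourier transforms of Schwartz functions\<close>

lemma integrable_mult_exp_inner:
  fixes \<phi> :: "'a::euclidean_space \<Rightarrow> complex"
  assumes "integrable lborel \<phi>"
  shows "integrable lborel (\<lambda>x. \<phi> x * echar (x \<bullet> \<xi>))"
proof (rule Bochner_Integration.integrable_bound[OF assms])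
  have [measurable]: "\<phi> \<in> borel_measurable borel"
    using assms by (auto dest: borel_measurable_integrable)
  show "(\<lambda>x. \<phi> x * echar (x \<bullet> \<xi>)) \<in> borel_measurable lborel" by measurable
qed (simp add: norm_mult)

lemma norm_fourier_le: "norm (fourier \<phi> \<xi>) \<le> (LBINT x. norm (\<phi> x))"
  unfolding fourier_def
  by (rule order_trans[OF integral_norm_bound]) (simp add: norm_mult)

lemma borel_measurable_fourier [measurable (raw)]:
  assumes [measurable]: "\<phi> \<in> borel_measurable borel"
  shows "fourier \<phi> \<in> borel_measurable borel"
  unfolding fourier_def[abs_def] by measurable

text \<open>Integration by parts: the difference of the two integrands is the derivative of \<phi>
  times the character in direction \<open>axis k 1\<close>, so it integrates to 0.\<close>

lemma fourier_partial_derivative: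
  assumes "\<phi> \<in> schwartz"
  shows "fourier (partial_derivative k \<phi>) \<xi> = \<i> * complex_of_real (\<xi> $ k) * fourier \<phi> \<xi>"
proof -
  let ?e = "\<lambda>x. echar (x \<bullet> \<xi>)"
  let ?d = "partial_derivative k \<phi>"
  let ?f' = "\<lambda>x. ?d x * ?e x - \<i> * complex_of_real (\<xi> $ k) * (\<phi> x * ?e x)"
  have d: "?d \<in> schwartz" using assms by (rule schwartz_partial_derivative)
  note ints = integrable_mult_exp_inner[OF schwartz_integrable[OF assms], of \<xi>]
    integrable_mult_exp_inner[OF schwartz_integrable[OF d], of \<xi>]
  have "(LBINT x. ?f' x) = 0"
  proof (rule integral_directional_derivative_eq_0)
    show "integrable lborel (\<lambda>x. \<phi> x * ?e x)" "integrable lborel ?f'"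
      using ints by auto
    show "continuous_on UNIV ?f'"
      by (intro continuous_intros schwartz_continuous assms d)
    fix x :: "real ^ 'a" and t :: real
    let ?y = "x + t *\<^sub>R axis k 1"
    have \<phi>': "(\<phi> has_derivative frechet_derivative \<phi> (at ?y)) (at ?y)"
      using schwartz_differentiable[OF assms, of "[]"] by (simp flip: frechet_derivative_works)
    have "((\<lambda>t. \<phi> (x + t *\<^sub>R axis k 1)) has_derivative
        (\<lambda>h. frechet_derivative \<phi> (at ?y) (h *\<^sub>R axis k 1))) (at t)"
    proof -
      have "((\<lambda>t. x + t *\<^sub>R axis k 1) has_derivative (\<lambda>h. h *\<^sub>R axis k 1)) (at t)"
        by (auto intro!: derivative_eq_intros)
      from has_derivative_compose[OF this \<phi>'] show ?thesis .
    qed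
    moreover have "frechet_derivative \<phi> (at ?y) (h *\<^sub>R axis k 1) = h *\<^sub>R ?d ?y" for h
      using linear_scale[OF has_derivative_linear[OF \<phi>']] by (simp add: partial_derivative_def)
    ultimately have 1: "((\<lambda>t. \<phi> (x + t *\<^sub>R axis k 1)) has_vector_derivative ?d ?y) (at t)"
      by (simp add: has_vector_derivative_def)
    have 2: "((\<lambda>t. ?e (x + t *\<^sub>R axis k 1)) has_vector_derivative - (\<i> * complex_of_real (\<xi> $ k)) * ?e ?y) (at t)"
    proof -
      have e: "?e (x + t *\<^sub>R axis k 1) = exp (- (\<i> * complex_of_real (x \<bullet> \<xi>)) + t *\<^sub>R (- (\<i> * complex_of_real (\<xi> $ k))))" for t
        by (simp add: inner_left_distrib inner_axis') (simp add: scaleR_conv_of_real algebra_simps)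
      show ?thesis unfolding e by (rule has_vector_derivative_exp_line)
    qed
    show "((\<lambda>t. \<phi> (x + t *\<^sub>R axis k 1) * ?e (x + t *\<^sub>R axis k 1)) has_vector_derivative ?f' ?y) (at t)"
      using has_vector_derivative_mult[OF 1 2] by (simp add: algebra_simps)
  qed
  then have "(LBINT x. ?d x * ?e x) - \<i> * complex_of_real (\<xi> $ k) * (LBINT x. \<phi> x * ?e x) = 0"
    using ints by simp
  then show ?thesis by (simp add: fourier_def)
qed

lemma fourier_iterated_partial:
  assumes "\<phi> \<in> schwartz"
  shows "fourier (iterated_partial (replicate m k) \<phi>) \<xi> = (\<i> * complex_of_real (\<xi> $ k)) ^ m * fourier \<phi> \<xi>"
  by (induction m) (auto simp: fourier_partial_derivative schwartz_iterated_partial[OF assms])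

lemma norm_power_le_sum:
  fixes x :: "real ^ 'n::finite"
  shows "norm x ^ m \<le> real CARD('n) ^ m * (\<Sum>k\<in>UNIV. \<bar>x $ k\<bar> ^ m)"
proof -
  obtain k where k: "\<And>j. \<bar>x $ j\<bar> \<le> \<bar>x $ k\<bar>"
  proof -
    have "Max (range (\<lambda>j. \<bar>x $ j\<bar>)) \<in> range (\<lambda>j. \<bar>x $ j\<bar>)" by (intro Max_in) auto
    then obtain k where "Max (range (\<lambda>j. \<bar>x $ j\<bar>)) = \<bar>x $ k\<bar>" by blast
    then show thesis using Max_ge[of "range (\<lambda>j. \<bar>x $ j\<bar>)"] that[of k] by auto
  qed
  have "norm x \<le> (\<Sum>j\<in>UNIV. \<bar>x $ j\<bar>)" by (rule norm_le_l1_cart)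
  also have "\<dots> \<le> real CARD('n) * \<bar>x $ k\<bar>" using sum_bounded_above[of UNIV "\<lambda>j. \<bar>x $ j\<bar>"] k by simp
  finally have "norm x ^ m \<le> (real CARD('n) * \<bar>x $ k\<bar>) ^ m" by (intro power_mono) auto
  also have "\<dots> = real CARD('n) ^ m * \<bar>x $ k\<bar> ^ m" by (simp add: power_mult_distrib)
  also have "\<dots> \<le> real CARD('n) ^ m * (\<Sum>k\<in>UNIV. \<bar>x $ k\<bar> ^ m)"
    by (intro mult_left_mono member_le_sum) auto
  finally show ?thesis .
qed

lemma schwartz_fourier_decay:
  assumes "\<phi> \<in> schwartz"
  obtains C where "\<And>\<xi>. (1 + norm \<xi> ^ m) * norm (fourier \<phi> \<xi>) \<le> C"
proof -
  let ?I = "\<lambda>\<psi>::real^'a\<Rightarrow>complex. LBINT x. norm (\<psi> x)"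
  let ?C = "?I \<phi> + real CARD('a) ^ m * (\<Sum>k\<in>UNIV. ?I (iterated_partial (replicate m k) \<phi>))"
  have "(1 + norm \<xi> ^ m) * norm (fourier \<phi> \<xi>) \<le> ?C" for \<xi>
  proof -
    have "\<bar>\<xi> $ k\<bar> ^ m * norm (fourier \<phi> \<xi>) \<le> ?I (iterated_partial (replicate m k) \<phi>)" for k
      using norm_fourier_le[of "iterated_partial (replicate m k) \<phi>" \<xi>]
      by (simp add: fourier_iterated_partial[OF assms] norm_mult norm_power)
    then have "(\<Sum>k\<in>UNIV. \<bar>\<xi> $ k\<bar> ^ m) * norm (fourier \<phi> \<xi>) \<le> (\<Sum>k\<in>UNIV. ?I (iterated_partial (replicate m k) \<phi>))"
      unfolding sum_distrib_right by (intro sum_mono)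
    then have "real CARD('a) ^ m * ((\<Sum>k\<in>UNIV. \<bar>\<xi> $ k\<bar> ^ m) * norm (fourier \<phi> \<xi>))
        \<le> real CARD('a) ^ m * (\<Sum>k\<in>UNIV. ?I (iterated_partial (replicate m k) \<phi>))"
      by (intro mult_left_mono) auto
    moreover have "norm \<xi> ^ m * norm (fourier \<phi> \<xi>) \<le> real CARD('a) ^ m * ((\<Sum>k\<in>UNIV. \<bar>\<xi> $ k\<bar> ^ m) * norm (fourier \<phi> \<xi>))"
      unfolding mult.assoc[symmetric] by (intro mult_right_mono norm_power_le_sum) auto
    ultimately show ?thesis using norm_fourier_le[of \<phi> \<xi>] unfolding distrib_right mult_1 by linarith
  qed
  then show thesis by (rule that)
qed

section \<open>Convolution with the reflected conjugate\<close>

lemma borel_measurable_cnj [measurable (raw)]: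
  "f \<in> borel_measurable M \<Longrightarrow> (\<lambda>x. cnj (f x)) \<in> borel_measurable M"
  using borel_measurable_continuous_onI[of cnj] by (auto intro!: measurable_compose[of f M borel cnj] continuous_intros)

text \<open>Stated over an arbitrary Euclidean space because it serves twice: on
  \<open>real ^ 'n\<close> for autocorrelations and on the line for products of transforms of
  unimodal functions.\<close>

lemma integral_convolution_exp:
  fixes f g :: "'a::euclidean_space \<Rightarrow> complex" and \<xi> :: 'a
  defines "e \<equiv> \<lambda>x. echar (x \<bullet> \<xi>)"
  assumes f: "integrable lborel f" and g: "integrable lborel g"
  shows "(LBINT x. (LBINT y. f y * g (x - y)) * e x) =
    (LBINT x. f x * e x) * (LBINT x. g x * e x)"
proof -
  have [measurable]: "f \<in> borel_measurable borel" "g \<in> borel_measurable borel"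
    using f g by (auto dest: borel_measurable_integrable)
  have em [measurable]: "e \<in> borel_measurable borel" unfolding e_def by measurable
  let ?h = "\<lambda>(y, x). f y * g (x - y) * e x"
  have e: "e (x + y) = e x * e y" for x y
    by (simp add: e_def inner_left_distrib ring_distribs flip: exp_add)
  have ne: "norm (e x) = 1" for x by (simp add: e_def)
  have int: "integrable lborel (\<lambda>x. g (x - y) * e x)" for y
    unfolding e_def using integrable_lborel_shift[of g "-y"] g by (intro integrable_mult_exp_inner) simp
  have h: "integrable (lborel \<Otimes>\<^sub>M lborel) ?h"
  proof (rule lborel_pair.Fubini_integrable)
    have "(LBINT x. norm (?h (y, x))) = norm (f y) * (LBINT x. norm (g x))" for y
      using integral_lborel_shift[of "\<lambda>x. norm (g x)" "-y"] by (simp add: norm_mult ne)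
    then show "integrable lborel (\<lambda>y. LBINT x. norm (?h (y, x)))" using f by simp
    show "AE y in lborel. integrable lborel (\<lambda>x. ?h (y, x))"
      using int by (auto simp: mult.assoc)
  qed measurable
  have "(LBINT x. (LBINT y. f y * g (x - y)) * e x) = (LBINT x. (LBINT y. ?h (y, x)))"
    by simp
  also have "\<dots> = (LBINT y. (LBINT x. ?h (y, x)))"
    using lborel_pair.Fubini_integral[of "\<lambda>y x. ?h (y, x)"] h by simp
  also have "(\<lambda>y. LBINT x. ?h (y, x)) = (\<lambda>y. f y * e y * (LBINT x. g x * e x))"
  proof
    fix y
    have "(LBINT x. ?h (y, x)) = (LBINT x. f y * (g (x - y) * e x))"
      by (simp add: mult.assoc)
    also have "\<dots> = f y * (LBINT x. g (x - y) * e x)" by simp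
    also have "(LBINT x. g (x - y) * e x) = (LBINT x. g x * e (x + y))"
      using integral_lborel_shift[of "\<lambda>x. g x * e (x + y)" "-y"] by simp
    also have "\<dots> = (LBINT x. e y * (g x * e x))"
      unfolding e by (simp add: mult_ac)
    finally show "(LBINT x. ?h (y, x)) = f y * e y * (LBINT x. g x * e x)"
      by simp
  qed
  also have "(LBINT y. f y * e y * (LBINT x. g x * e x)) = (LBINT x. f x * e x) * (LBINT x. g x * e x)"
    by simp
  finally show ?thesis .
qed

lemma fourier_convolution:
  assumes "integrable lborel f" "integrable lborel g"
  shows "fourier (Defs.convolution f g) \<xi> = fourier f \<xi> * fourier g \<xi>"
  unfolding fourier_def Defs.convolution_def by (rule integral_convolution_exp[OF assms])

definition autocorrelation :: "(real ^ 'n::finite \<Rightarrow> complex) \<Rightarrow> real ^ 'n \<Rightarrow> complex" where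
  "autocorrelation \<phi> = Defs.convolution \<phi> (\<lambda>x. cnj (\<phi> (- x)))"

lemma fourier_cnj_uminus:
  assumes [measurable]: "\<phi> \<in> borel_measurable borel"
  shows "fourier (\<lambda>x. cnj (\<phi> (- x))) \<xi> = cnj (fourier \<phi> \<xi>)"
proof -
  have "fourier (\<lambda>x. cnj (\<phi> (- x))) \<xi> = (LBINT x. cnj (\<phi> x) * exp (\<i> * complex_of_real (x \<bullet> \<xi>)))"
    using integral_lborel_uminus[of "\<lambda>x. cnj (\<phi> x) * exp (\<i> * complex_of_real (x \<bullet> \<xi>))"]
    by (simp add: fourier_def)
  also have "\<dots> = (LBINT x. cnj (\<phi> x * echar (x \<bullet> \<xi>)))"
    by (simp add: exp_cnj)
  finally show ?thesis by (simp add: fourier_def del: complex_cnj_mult)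
qed

lemma fourier_autocorrelation:
  assumes \<phi>: "integrable lborel \<phi>"
  shows "fourier (autocorrelation \<phi>) \<xi> = complex_of_real ((norm (fourier \<phi> \<xi>))\<^sup>2)"
proof -
  have m [measurable]: "\<phi> \<in> borel_measurable borel"
    using \<phi> by (auto dest: borel_measurable_integrable)
  have "integrable lborel (\<lambda>x. cnj (\<phi> (- x)))"
    using \<phi> by (simp add: integrable_lborel_uminus)
  then show ?thesis
    by (simp add: autocorrelation_def fourier_convolution \<phi> fourier_cnj_uminus complex_norm_square[unfolded of_real_power])
qed

lemma borel_measurable_autocorrelation:
  assumes [measurable]: "\<phi> \<in> borel_measurable borel"
  shows "autocorrelation \<phi> \<in> borel_measurable borel"
  unfolding autocorrelation_def Defs.convolution_def[abs_def] by measurable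

lemma weight_uminus [simp]: "weight (- x) = weight x"
  by (simp add: weight_def)

text \<open>The bound on the integrand contains \<open>weight y * weight (x - y)\<close> twice. One
  copy yields \<open>weight x\<close> by \<open>weight_mult_le\<close>; in the other
  \<open>weight (x - y)\<close> is dropped and \<open>weight y\<close> makes the integral
  finite.\<close>

lemma autocorrelation_le_weight:
  fixes \<phi> :: "real ^ 'n::finite \<Rightarrow> complex"
  assumes [measurable]: "\<phi> \<in> borel_measurable borel" and \<phi>: "\<And>x. norm (\<phi> x) \<le> C * (weight x)\<^sup>2"
  shows "norm (autocorrelation \<phi> x) \<le> (C\<^sup>2 * 2 ^ CARD('n) * (\<integral>y. weight y \<partial>(lborel :: (real ^ 'n) measure))) * weight x"
proof -
  have C: "0 \<le> C"
    using order_trans[OF norm_ge_zero \<phi>[of 0]] weight_pos[of "0 :: real ^ 'n"] by (simp add: zero_le_mult_iff)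
  have le: "norm (\<phi> y * cnj (\<phi> (- (x - y)))) \<le> C\<^sup>2 * 2 ^ CARD('n) * weight x * weight y" for y
  proof -
    have "norm (\<phi> y * cnj (\<phi> (- (x - y)))) \<le> (C * (weight y)\<^sup>2) * (C * (weight (x - y))\<^sup>2)"
      unfolding norm_mult complex_mod_cnj using \<phi>[of "- (x - y)"]
      by (intro mult_mono \<phi>) (auto simp: C simp del: minus_diff_eq)
    also have "\<dots> = C\<^sup>2 * (weight y * weight (x - y)) * (weight y * weight (x - y))"
      by (simp add: power2_eq_square)
    also have "\<dots> \<le> C\<^sup>2 * (2 ^ CARD('n) * weight x) * (weight y * 1)"
      by (intro mult_mono mult_nonneg_nonneg weight_mult_le mult_left_mono weight_le_1) auto
    finally show ?thesis by (simp add: mult_ac)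
  qed
  have "norm (autocorrelation \<phi> x) \<le> (LBINT y. norm (\<phi> y * cnj (\<phi> (- (x - y)))))"
    unfolding autocorrelation_def Defs.convolution_def by (rule integral_norm_bound)
  also have "\<dots> \<le> (\<integral>y. C\<^sup>2 * 2 ^ CARD('n) * weight x * weight y \<partial>(lborel :: (real ^ 'n) measure))"
  proof (rule Bochner_Integration.integral_mono)
    have "(\<lambda>y. \<phi> y * cnj (\<phi> (- (x - y)))) \<in> borel_measurable borel" by measurable
    from integrable_le_weight[OF this le]
    show "integrable lborel (\<lambda>y. norm (\<phi> y * cnj (\<phi> (- (x - y)))))" by (rule integrable_norm)
    show "integrable (lborel :: (real ^ 'n) measure) (\<lambda>y. C\<^sup>2 * 2 ^ CARD('n) * weight x * weight y)"
      using integrable_weight by (rule integrable_mult_right)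
  qed (rule le)
  finally show ?thesis by (simp add: mult_ac)
qed

section \<open>Gaussians\<close>

text \<open>Polynomials in the coordinates, given by closure rules so that stability under partial
  differentiation and polynomial growth both follow by induction. Every iterated derivative of a
  Gaussian is such a polynomial times the Gaussian.\<close>

inductive_set coord_polys :: "(real ^ 'n::finite \<Rightarrow> complex) set" where
  const: "(\<lambda>x. c) \<in> coord_polys"
| coord: "(\<lambda>x. complex_of_real (x $ k)) \<in> coord_polys"
| add: "f \<in> coord_polys \<Longrightarrow> g \<in> coord_polys \<Longrightarrow> (\<lambda>x. f x + g x) \<in> coord_polys"
| mult: "f \<in> coord_polys \<Longrightarrow> g \<in> coord_polys \<Longrightarrow> (\<lambda>x. f x * g x) \<in> coord_polys"

lemma has_derivative_coord_polys:
  assumes "f \<in> coord_polys"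
  shows "\<exists>f'. (\<forall>x. (f has_derivative f' x) (at x)) \<and> (\<forall>k. (\<lambda>x. f' x (axis k 1)) \<in> coord_polys)"
  using assms
proof induction
  case (const c)
  show ?case by (rule exI[of _ "\<lambda>x h. 0"]) (auto intro: coord_polys.intros)
next
  case (coord k)
  show ?case
    by (rule exI[of _ "\<lambda>x h. complex_of_real (h $ k)"])
       (auto intro!: coord_polys.intros derivative_eq_intros bounded_linear.has_derivative[OF bounded_linear_vec_nth])
next
  case (add f g)
  then obtain f' g' where
    d: "\<And>x. (f has_derivative f' x) (at x)" "\<And>x. (g has_derivative g' x) (at x)"
    and p: "\<And>k. (\<lambda>x. f' x (axis k 1)) \<in> coord_polys" "\<And>k. (\<lambda>x. g' x (axis k 1)) \<in> coord_polys"
    by blast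
  show ?case
    by (rule exI[of _ "\<lambda>x h. f' x h + g' x h"]) (auto intro!: coord_polys.intros has_derivative_add d p)
next
  case (mult f g)
  then obtain f' g' where
    d: "\<And>x. (f has_derivative f' x) (at x)" "\<And>x. (g has_derivative g' x) (at x)"
    and p: "\<And>k. (\<lambda>x. f' x (axis k 1)) \<in> coord_polys" "\<And>k. (\<lambda>x. g' x (axis k 1)) \<in> coord_polys"
    by blast
  show ?case
    by (rule exI[of _ "\<lambda>x h. f x * g' x h + f' x h * g x"])
       (auto intro!: coord_polys.intros has_derivative_mult d p mult.hyps)
qed

lemma coord_polys_bound:
  assumes "f \<in> coord_polys"
  shows "\<exists>C m. \<forall>x. norm (f x) \<le> C * (1 + norm x) ^ m"
  using assms
proof induction
  case (const c)
  show ?case by (rule exI[of _ "norm c"], rule exI[of _ 0]) auto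
next
  case (coord k)
  show ?case
    by (rule exI[of _ 1], rule exI[of _ 1]) (auto intro: order_trans[OF component_le_norm_cart])
next
  case (add f g)
  then obtain C m D l where *: "\<And>x. norm (f x) \<le> C * (1 + norm x) ^ m" "\<And>x. norm (g x) \<le> D * (1 + norm x) ^ l"
    by blast
  have pos: "0 \<le> C" "0 \<le> D"
    using order_trans[OF norm_ge_zero *(1)[of 0]] order_trans[OF norm_ge_zero *(2)[of 0]] by auto
  have "norm (f x + g x) \<le> (C + D) * (1 + norm x) ^ (m + l)" for x
  proof -
    have "norm (f x + g x) \<le> C * (1 + norm x) ^ m + D * (1 + norm x) ^ l"
      by (intro norm_triangle_mono *)
    also have "\<dots> \<le> C * (1 + norm x) ^ (m + l) + D * (1 + norm x) ^ (m + l)"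
      by (intro add_mono mult_left_mono power_increasing pos) auto
    finally show ?thesis by (simp add: algebra_simps)
  qed
  then show ?case by blast
next
  case (mult f g)
  then obtain C m D l where *: "\<And>x. norm (f x) \<le> C * (1 + norm x) ^ m" "\<And>x. norm (g x) \<le> D * (1 + norm x) ^ l"
    by blast
  have "norm (f x * g x) \<le> (C * D) * (1 + norm x) ^ (m + l)" for x
  proof -
    have "norm (f x * g x) \<le> (C * (1 + norm x) ^ m) * (D * (1 + norm x) ^ l)"
      unfolding norm_mult by (intro mult_mono * order_trans[OF norm_ge_zero *(1)]) auto
    then show ?thesis by (simp add: power_add mult_ac)
  qed
  then show ?case by blast
qed

text \<open>Each coordinate has its own weight, since later the Gaussian is narrowed along one axis
  while its width in the other directions stays fixed.\<close>

definition gauss :: "('n \<Rightarrow> real) \<Rightarrow> real ^ 'n \<Rightarrow> real ^ 'n::finite \<Rightarrow> real" where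
  "gauss w v x = exp (- (\<Sum>k\<in>UNIV. w k * (x $ k - v $ k)\<^sup>2))"

lemma gauss_pos: "0 < gauss w v x"
  by (simp add: gauss_def)

lemma borel_measurable_gauss [measurable]: "gauss w v \<in> borel_measurable borel"
  unfolding gauss_def[abs_def] by measurable

lemma has_derivative_gauss:
  "((\<lambda>x. complex_of_real (gauss w v x)) has_derivative
     (\<lambda>h. - (\<Sum>k\<in>UNIV. complex_of_real (2 * w k * (x $ k - v $ k) * h $ k)) * complex_of_real (gauss w v x))) (at x)"
proof -
  have "(gauss w v has_derivative (\<lambda>h. - ((\<Sum>k\<in>UNIV. w k * (2 * h $ k * (x $ k - v $ k))) * gauss w v x))) (at x)"
    unfolding gauss_def[abs_def]
    by (auto intro!: derivative_eq_intros bounded_linear.has_derivative[OF bounded_linear_vec_nth])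
  from bounded_linear.has_derivative[OF bounded_linear_of_real[where 'a = complex] this] show ?thesis
    by (simp add: mult_ac)
qed

lemma iterated_partial_poly_gauss:
  assumes "f \<in> coord_polys"
  shows "\<exists>g\<in>coord_polys. iterated_partial ks (\<lambda>x. f x * complex_of_real (gauss w v x)) =
    (\<lambda>x. g x * complex_of_real (gauss w v x))"
proof (induction ks)
  case Nil
  show ?case using assms by auto
next
  case (Cons k ks)
  then obtain g where g: "g \<in> coord_polys"
    and eq: "iterated_partial ks (\<lambda>x. f x * complex_of_real (gauss w v x)) = (\<lambda>x. g x * complex_of_real (gauss w v x))"
    by blast
  from has_derivative_coord_polys[OF g] obtain g' where
    g': "\<And>x. (g has_derivative g' x) (at x)" "\<And>k. (\<lambda>x. g' x (axis k 1)) \<in> coord_polys" by blast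
  let ?h = "\<lambda>x. g x * (complex_of_real (- 2 * w k) * (complex_of_real (x $ k) + complex_of_real (- v $ k))) + g' x (axis k 1)"
  have "?h \<in> coord_polys"
    by (intro coord_polys.intros g g')
  moreover have "partial_derivative k (\<lambda>x. g x * complex_of_real (gauss w v x)) = (\<lambda>x. ?h x * complex_of_real (gauss w v x))"
  proof
    fix x
    have "(\<Sum>j\<in>UNIV. complex_of_real (2 * w j * (x $ j - v $ j) * axis k 1 $ j)) = complex_of_real (2 * w k * (x $ k - v $ k))"
      by (subst sum.remove[of _ k]) (auto simp: axis_def intro!: sum.neutral)
    then show "partial_derivative k (\<lambda>x. g x * complex_of_real (gauss w v x)) x = ?h x * complex_of_real (gauss w v x)"
      by (subst partial_derivative_eq[OF has_derivative_mult[OF g'(1) has_derivative_gauss]])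
         (simp only:, simp add: ring_distribs)
  qed
  ultimately show ?case by (auto simp: eq)
qed

text \<open>The polynomial factor is dominated by an exponential of the l1 norm of x - v, and
  completing the square gives |t| - w t^2 <= 1 / (4 w) in each coordinate.\<close>

lemma gauss_decay:
  fixes v :: "real ^ 'n::finite"
  assumes w: "\<And>k. 0 < w k"
  obtains C where "\<And>x. (1 + norm x) ^ m * gauss w v x \<le> C"
proof -
  let ?C = "(1 + norm v) ^ m * (fact m * exp (1 + (\<Sum>k\<in>UNIV. 1 / (4 * w k))))"
  have "(1 + norm x) ^ m * gauss w v x \<le> ?C" for x
  proof -
    let ?s = "x - v"
    have "norm x \<le> norm v + norm ?s" using norm_triangle_ineq[of v ?s] by simp
    moreover have "0 \<le> norm v * norm ?s" by simp
    ultimately have "1 + norm x \<le> (1 + norm v) * (1 + norm ?s)" unfolding ring_distribs by linarith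
    then have 1: "(1 + norm x) ^ m \<le> (1 + norm v) ^ m * (1 + norm ?s) ^ m"
      unfolding power_mult_distrib[symmetric] by (rule power_mono) simp
    have "(1 + norm ?s) ^ m \<le> fact m * exp (1 + norm ?s)"
      by (rule power_le_fact_exp) auto
    also have "\<dots> \<le> fact m * exp (1 + (\<Sum>k\<in>UNIV. \<bar>?s $ k\<bar>))"
      using norm_le_l1_cart[of ?s] by simp
    finally have "(1 + norm v) ^ m * (1 + norm ?s) ^ m
        \<le> (1 + norm v) ^ m * (fact m * exp (1 + (\<Sum>k\<in>UNIV. \<bar>?s $ k\<bar>)))"
      by (rule mult_left_mono) simp
    from mult_right_mono[OF order_trans[OF 1 this], of "gauss w v x"]
    have "(1 + norm x) ^ m * gauss w v x
        \<le> (1 + norm v) ^ m * (fact m * exp (1 + (\<Sum>k\<in>UNIV. \<bar>?s $ k\<bar>))) * gauss w v x"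
      by (simp add: less_imp_le[OF gauss_pos])
    also have "\<dots> = (1 + norm v) ^ m * (fact m * exp (1 + (\<Sum>k\<in>UNIV. \<bar>?s $ k\<bar> - w k * (?s $ k)\<^sup>2)))"
      by (simp add: gauss_def sum_subtractf algebra_simps flip: exp_add)
    also have "\<dots> \<le> ?C"
    proof -
      have "\<bar>t\<bar> - w k * t\<^sup>2 \<le> 1 / (4 * w k)" for k and t :: real
      proof -
        have "0 \<le> (2 * w k * \<bar>t\<bar> - 1)\<^sup>2" by simp
        also have "(2 * w k * \<bar>t\<bar> - 1)\<^sup>2 = 4 * w k * (w k * t\<^sup>2 - \<bar>t\<bar>) + 1"
          by (simp add: power2_eq_square algebra_simps)
        finally show ?thesis using w[of k] by (simp add: field_simps)
      qed
      then show ?thesis by (intro mult_left_mono) (auto intro: sum_mono)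
    qed
    finally show ?thesis .
  qed
  then show thesis by (rule that)
qed

lemma gauss_schwartz:
  assumes w: "\<And>k. 0 < w k"
  shows "(\<lambda>x. complex_of_real (gauss w v x)) \<in> schwartz"
proof -
  have *: "\<exists>g\<in>coord_polys. iterated_partial ks (\<lambda>x. complex_of_real (gauss w v x)) =
      (\<lambda>x. g x * complex_of_real (gauss w v x))" for ks
    using iterated_partial_poly_gauss[OF coord_polys.const[of 1], of ks w v] by simp
  have "iterated_partial ks (\<lambda>x. complex_of_real (gauss w v x)) differentiable (at x)" for ks x
  proof -
    obtain g where g: "g \<in> coord_polys"
      and eq: "iterated_partial ks (\<lambda>x. complex_of_real (gauss w v x)) = (\<lambda>x. g x * complex_of_real (gauss w v x))"
      using * by blast
    show ?thesis unfolding eq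
      using has_derivative_coord_polys[OF g] has_derivative_gauss[of w v x]
      by (intro differentiable_mult) (auto simp: differentiable_def)
  qed
  moreover have "\<exists>B. \<forall>x. norm x ^ m * norm (iterated_partial ks (\<lambda>x. complex_of_real (gauss w v x)) x) \<le> B" for m ks
  proof -
    obtain g where g: "g \<in> coord_polys"
      and eq: "iterated_partial ks (\<lambda>x. complex_of_real (gauss w v x)) = (\<lambda>x. g x * complex_of_real (gauss w v x))"
      using * by blast
    obtain C l where C: "\<And>x. norm (g x) \<le> C * (1 + norm x) ^ l"
      using coord_polys_bound[OF g] by blast
    have "norm (g 0) \<le> C" using C[of 0] by simp
    then have "0 \<le> C" using norm_ge_zero[of "g 0"] by linarith
    obtain B where B: "\<And>x. (1 + norm x) ^ (m + l) * gauss w v x \<le> B"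
      by (rule gauss_decay[where w = w and m = "m + l" and v = v, OF w]) blast
    have "norm x ^ m * norm (g x * complex_of_real (gauss w v x)) \<le> C * B" for x
    proof -
      have "norm x ^ m * norm (g x * complex_of_real (gauss w v x))
          \<le> (1 + norm x) ^ m * ((C * (1 + norm x) ^ l) * gauss w v x)"
        unfolding norm_mult using C[of x] gauss_pos[of w v x] order_trans[OF norm_ge_zero C[of x]]
        by (intro mult_mono power_mono) auto
      also have "\<dots> = C * ((1 + norm x) ^ (m + l) * gauss w v x)"
        by (simp add: power_add mult_ac)
      also have "\<dots> \<le> C * B" by (intro mult_left_mono B \<open>0 \<le> C\<close>)
      finally show ?thesis .
    qed
    then show ?thesis unfolding eq by blast
  qed
  ultimately show ?thesis by (simp add: schwartz_def)
qed

section \<open>The one-dimensional exponential\<close>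

definition gexp :: "real \<Rightarrow> real \<Rightarrow> real" where
  "gexp q x = exp (- (\<bar>x\<bar> powr q))"

lemma gexp_pos: "0 < gexp q x" by (simp add: gexp_def)

lemma borel_measurable_gexp [measurable]: "gexp q \<in> borel_measurable borel"
  unfolding gexp_def[abs_def] by measurable

lemma integrable_powr_gexp:
  assumes a: "a > -1" and q: "0 < q"
  shows "integrable lborel (\<lambda>x. \<bar>x\<bar> powr a * gexp q x)"
proof -
  \<comment> \<open>With y = |x|^q >= 1 this exponent gives |x|^(a + 2) <= y^m <= m! e^y, hence a
    bound by a multiple of 1 / (1 + x^2) outside [-1, 1].\<close>
  define m where "m = nat \<lceil>(a + 2) / q\<rceil>"
  have m: "(a + 2) / q \<le> real m" unfolding m_def by linarith
  let ?g = "\<lambda>x::real. indicator {0<..1} \<bar>x\<bar> *\<^sub>R \<bar>x\<bar> powr a + 2 * fact m * (1 / (1 + x\<^sup>2))"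
  have "integrable lborel ?g"
    by (intro Bochner_Integration.integrable_add integrable_powr_near_0 a integrable_mult_right integrable_inverse_1_plus_sq)
  then show ?thesis
  proof (rule Bochner_Integration.integrable_bound)
    show "AE x in lborel. norm (\<bar>x\<bar> powr a * gexp q x) \<le> norm (?g x)"
    proof (rule AE_I2)
      fix x :: real
      show "norm (\<bar>x\<bar> powr a * gexp q x) \<le> norm (?g x)"
      proof (cases "\<bar>x\<bar> \<le> 1")
        case True
        have "\<bar>x\<bar> powr a * gexp q x \<le> \<bar>x\<bar> powr a * 1"
          by (intro mult_left_mono) (auto simp: gexp_def)
        with True gexp_pos[of q x] show ?thesis by (cases "x = 0") (auto simp: abs_mult intro!: add_increasing2)
      next
        case False
        let ?y = "\<bar>x\<bar> powr q"
        have y: "1 \<le> ?y" using False q by (simp add: ge_one_powr_ge_zero)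
        have "x\<^sup>2 = \<bar>x\<bar> powr 2" using False by (simp add: powr_numeral)
        then have "\<bar>x\<bar> powr a * (1 + x\<^sup>2) \<le> \<bar>x\<bar> powr a * (2 * \<bar>x\<bar> powr 2)"
          using False ge_one_powr_ge_zero[of "\<bar>x\<bar>" 2] by (intro mult_left_mono) auto
        also have "\<dots> = 2 * ?y powr ((a + 2) / q)"
          using q by (simp add: powr_powr powr_add)
        also have "\<dots> \<le> 2 * ?y powr real m"
          using y m by (intro mult_left_mono powr_mono) auto
        also have "\<dots> = 2 * ?y ^ m" using y by (subst powr_realpow) auto
        also have "\<dots> \<le> 2 * (fact m * exp ?y)"
          by (intro mult_left_mono power_le_fact_exp) auto
        finally have "\<bar>x\<bar> powr a * (1 + x\<^sup>2) * gexp q x \<le> 2 * (fact m * exp ?y) * gexp q x"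
          by (intro mult_right_mono) (auto simp: gexp_def)
        then have "\<bar>x\<bar> powr a * gexp q x * (1 + x\<^sup>2) \<le> 2 * fact m"
          by (simp add: gexp_def mult_ac flip: exp_add)
        then have "\<bar>x\<bar> powr a * gexp q x \<le> 2 * fact m * (1 / (1 + x\<^sup>2))"
          by (simp add: field_simps add_pos_nonneg)
        with False gexp_pos[of q x] show ?thesis by (auto simp: abs_mult)
      qed
    qed
  qed auto
qed

lemma integrable_gexp:
  assumes "0 < q" shows "integrable lborel (gexp q)"
proof -
  \<comment> \<open>The indicator compensates for \<open>0 powr 0 = 0\<close>.\<close>
  have "integrable lborel (\<lambda>x. \<bar>x\<bar> powr 0 * gexp q x + indicator {0} x)"
    using assms by (intro Bochner_Integration.integrable_add integrable_powr_gexp) auto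
  moreover have "(\<lambda>x. \<bar>x\<bar> powr 0 * gexp q x + indicator {0} x) = gexp q"
    using assms by (auto simp: gexp_def indicator_def)
  ultimately show ?thesis by simp
qed

section \<open>Fourier transforms on the line\<close>

definition ft :: "(real \<Rightarrow> real) \<Rightarrow> real \<Rightarrow> complex" where
  "ft f t = (LBINT x. complex_of_real (f x) * echar (x * t))"

lemma integrable_ft:
  assumes "integrable lborel f"
  shows "integrable lborel (\<lambda>x. complex_of_real (f x) * echar (x * t))"
  using integrable_mult_exp_inner[of "\<lambda>x. complex_of_real (f x)" t] assms by simp

lemma borel_measurable_ft [measurable (raw)]:
  assumes [measurable]: "f \<in> borel_measurable borel"
  shows "ft f \<in> borel_measurable borel"
  unfolding ft_def[abs_def] by measurable

lemma norm_ft_le: "norm (ft f t) \<le> (LBINT x. \<bar>f x\<bar>)"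
  unfolding ft_def by (rule order_trans[OF integral_norm_bound]) (simp add: norm_mult)

lemma ft_even_real:
  assumes [measurable]: "f \<in> borel_measurable borel" and even: "\<And>x. f (- x) = f x"
  shows "ft f t = complex_of_real (Re (ft f t))" "ft f (- t) = ft f t"
proof -
  show *: "ft f (- t) = ft f t" for t
    using integral_lborel_uminus[of "\<lambda>x. complex_of_real (f x) * echar (x * t)"]
    by (simp add: ft_def even)
  have "cnj (ft f t) = (LBINT x. cnj (complex_of_real (f x) * echar (x * t)))"
    unfolding ft_def by (rule Bochner_Integration.integral_cnj[symmetric])
  also have "\<dots> = ft f (- t)"
    by (simp add: ft_def exp_cnj del: Bochner_Integration.integral_cnj)
  finally have "cnj (ft f t) = ft f (- t)" .
  then show "ft f t = complex_of_real (Re (ft f t))"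
    using * by (metis Reals_cnj_iff complex_is_Real_iff of_real_Re)
qed

lemma ft_derivative:
  assumes "integrable lborel f" "integrable lborel f'" "continuous_on UNIV f'"
    and d: "\<And>x. (f has_real_derivative f' x) (at x)"
  shows "ft f' t = \<i> * complex_of_real t * ft f t"
proof -
  let ?e = "\<lambda>x. echar (x * t)"
  let ?f = "\<lambda>x. complex_of_real (f x)" and ?f' = "\<lambda>x. complex_of_real (f' x)"
  note ints = integrable_ft[OF assms(1), of t] integrable_ft[OF assms(2), of t]
  have "(LBINT x. ?f' x * ?e x - \<i> * complex_of_real t * (?f x * ?e x)) = 0"
  proof (rule integral_directional_derivative_eq_0[where e=1 and f="\<lambda>x. ?f x * ?e x"])
    have "continuous_on UNIV f" using d by (meson DERIV_isCont continuous_at_imp_continuous_on)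
    then show "continuous_on UNIV (\<lambda>x. ?f' x * ?e x - \<i> * complex_of_real t * (?f x * ?e x))"
      using assms by (intro continuous_intros)
    fix x s :: real
    let ?y = "x + s *\<^sub>R 1"
    have l: "((\<lambda>s. x + s *\<^sub>R 1) has_real_derivative 1) (at s)"
      by (auto intro!: derivative_eq_intros)
    have "((\<lambda>s. f (x + s *\<^sub>R 1)) has_real_derivative f' ?y) (at s)"
      using DERIV_chain2[OF d l] by simp
    then have 1: "((\<lambda>s. ?f (x + s *\<^sub>R 1)) has_vector_derivative ?f' ?y) (at s)"
      using has_vector_derivative_of_real[of "\<lambda>s. f (x + s *\<^sub>R 1)"] by (simp add: has_real_derivative_iff_has_vector_derivative)
    have 2: "((\<lambda>s. ?e (x + s *\<^sub>R 1)) has_vector_derivative - (\<i> * complex_of_real t) * ?e ?y) (at s)"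
    proof -
      have e: "?e (x + s *\<^sub>R 1) = exp (- (\<i> * complex_of_real (x * t)) + s *\<^sub>R (- (\<i> * complex_of_real t)))" for s
        by (simp add: scaleR_conv_of_real algebra_simps)
      show ?thesis unfolding e by (rule has_vector_derivative_exp_line)
    qed
    show "((\<lambda>s. ?f (x + s *\<^sub>R 1) * ?e (x + s *\<^sub>R 1)) has_vector_derivative
        ?f' ?y * ?e ?y - \<i> * complex_of_real t * (?f ?y * ?e ?y)) (at s)"
      using has_vector_derivative_mult[OF 1 2] by (simp add: algebra_simps)
  qed (use ints in auto)
  then have "(LBINT x. ?f' x * ?e x) - \<i> * complex_of_real t * (LBINT x. ?f x * ?e x) = 0"
    using ints by simp
  then show ?thesis by (simp add: ft_def)
qed

text \<open>For an exponent above 1 the difference quotient at 0 tends to 0. The signed version is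
  needed because the derivative of the first function carries a sign and has to be differentiated
  again.\<close>

lemma has_derivative_abs_powr:
  fixes a x :: real assumes a: "a > 1"
  shows "((\<lambda>x. \<bar>x\<bar> powr a) has_real_derivative a * sgn x * \<bar>x\<bar> powr (a - 1)) (at x)"
    and "((\<lambda>x. sgn x * \<bar>x\<bar> powr a) has_real_derivative a * \<bar>x\<bar> powr (a - 1)) (at x)"
proof -
  have 0: "((\<lambda>h::real. \<bar>h\<bar> powr (a - 1)) \<longlongrightarrow> 0) (at 0)"
    using a by (auto intro!: tendsto_eq_intros)
  consider "x > 0" | "x < 0" | "x = 0" by linarith
  then show "((\<lambda>x. \<bar>x\<bar> powr a) has_real_derivative a * sgn x * \<bar>x\<bar> powr (a - 1)) (at x)"
  proof cases
    case 1
    then have "((\<lambda>x. x powr a) has_real_derivative a * sgn x * \<bar>x\<bar> powr (a - 1)) (at x)"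
      by (auto intro!: derivative_eq_intros)
    then show ?thesis
      by (rule DERIV_cong_ev[THEN iffD1, OF refl _ refl, rotated])
         (use 1 eventually_nhds_in_open[of "{0<..}" x] in \<open>auto elim!: eventually_mono\<close>)
  next
    case 2
    then have "((\<lambda>x. (- x) powr a) has_real_derivative a * sgn x * \<bar>x\<bar> powr (a - 1)) (at x)"
      by (auto intro!: derivative_eq_intros)
    then show ?thesis
      by (rule DERIV_cong_ev[THEN iffD1, OF refl _ refl, rotated])
         (use 2 eventually_nhds_in_open[of "{..<0}" x] in \<open>auto elim!: eventually_mono\<close>)
  next
    case 3
    have "((\<lambda>h. sgn h * \<bar>h\<bar> powr (a - 1)) \<longlongrightarrow> 0) (at 0)"
      by (rule tendsto_rabs_zero_cancel, rule Lim_transform_eventually[OF 0])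
         (auto simp: eventually_at_filter abs_mult abs_sgn_eq)
    then have "((\<lambda>h. (\<bar>0 + h\<bar> powr a - \<bar>0\<bar> powr a) / h) \<longlongrightarrow> 0) (at 0)"
      by (rule Lim_transform_eventually)
         (auto simp: eventually_at_filter sgn_if powr_diff field_simps)
    then show ?thesis using 3 by (simp add: DERIV_def)
  qed
  consider "x > 0" | "x < 0" | "x = 0" by linarith
  then show "((\<lambda>x. sgn x * \<bar>x\<bar> powr a) has_real_derivative a * \<bar>x\<bar> powr (a - 1)) (at x)"
  proof cases
    case 1
    then have "((\<lambda>x. x powr a) has_real_derivative a * \<bar>x\<bar> powr (a - 1)) (at x)"
      by (auto intro!: derivative_eq_intros)
    then show ?thesis
      by (rule DERIV_cong_ev[THEN iffD1, OF refl _ refl, rotated])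
         (use 1 eventually_nhds_in_open[of "{0<..}" x] in \<open>auto elim!: eventually_mono\<close>)
  next
    case 2
    then have "((\<lambda>x. - ((- x) powr a)) has_real_derivative a * \<bar>x\<bar> powr (a - 1)) (at x)"
      by (auto intro!: derivative_eq_intros)
    then show ?thesis
      by (rule DERIV_cong_ev[THEN iffD1, OF refl _ refl, rotated])
         (use 2 eventually_nhds_in_open[of "{..<0}" x] in \<open>auto elim!: eventually_mono\<close>)
  next
    case 3
    have "((\<lambda>h. (sgn (0 + h) * \<bar>0 + h\<bar> powr a - sgn 0 * \<bar>0\<bar> powr a) / h) \<longlongrightarrow> 0) (at 0)"
      by (rule Lim_transform_eventually[OF 0])
         (auto simp: eventually_at_filter sgn_if powr_diff field_simps)
    then show ?thesis using 3 by (simp add: DERIV_def)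
  qed
qed

text \<open>Two integrations by parts. Since q > 2, the second derivative, with its term in |x|^(q -
  2), is continuous at 0 and integrable; so t^2 times the transform is bounded as well as the
  transform itself.\<close>

lemma ft_gexp_decay:
  assumes q: "2 < q"
  obtains C where "0 \<le> C" "\<And>t. norm (ft (gexp q) t) \<le> C * (1 / (1 + t\<^sup>2))"
proof -
  let ?g1 = "\<lambda>x. - q * (sgn x * \<bar>x\<bar> powr (q - 1)) * gexp q x"
  let ?g2 = "\<lambda>x. q\<^sup>2 * (\<bar>x\<bar> powr (2 * q - 2) * gexp q x) - q * (q - 1) * (\<bar>x\<bar> powr (q - 2) * gexp q x)"
  have d1: "(gexp q has_real_derivative ?g1 x) (at x)" for x
  proof -
    have "((\<lambda>x. exp (- (\<bar>x\<bar> powr q))) has_real_derivative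
        exp (- (\<bar>x\<bar> powr q)) * - (q * sgn x * \<bar>x\<bar> powr (q - 1))) (at x)"
      using q by (intro DERIV_fun_exp DERIV_minus has_derivative_abs_powr) auto
    then show ?thesis by (simp add: gexp_def[abs_def] mult_ac)
  qed
  have d2: "(?g1 has_real_derivative ?g2 x) (at x)" for x
  proof -
    have s: "sgn x * sgn x * (\<bar>x\<bar> powr (q - 1) * \<bar>x\<bar> powr (q - 1)) = \<bar>x\<bar> powr (2 * q - 2)"
      by (cases "x = 0") (auto simp: sgn_if powr_add[symmetric])
    have "(?g1 has_real_derivative (- q * ((q - 1) * \<bar>x\<bar> powr (q - 1 - 1))) * gexp q x + ?g1 x * (- q * (sgn x * \<bar>x\<bar> powr (q - 1)))) (at x)"
      using DERIV_mult[OF DERIV_cmult[OF has_derivative_abs_powr(2)[of "q - 1" x], of "- q"] d1[of x]] q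
      by (simp add: mult_ac)
    also have "(- q * ((q - 1) * \<bar>x\<bar> powr (q - 1 - 1))) * gexp q x + ?g1 x * (- q * (sgn x * \<bar>x\<bar> powr (q - 1)))
       = q\<^sup>2 * (sgn x * sgn x * (\<bar>x\<bar> powr (q - 1) * \<bar>x\<bar> powr (q - 1)) * gexp q x) - q * (q - 1) * (\<bar>x\<bar> powr (q - 2) * gexp q x)"
      by (simp add: power2_eq_square algebra_simps)
    finally show ?thesis unfolding s .
  qed
  have q0: "0 < q" using q by simp
  have i0: "integrable lborel (gexp q)" using q0 by (rule integrable_gexp)
  have i1: "integrable lborel ?g1"
    by (rule Bochner_Integration.integrable_bound[OF integrable_mult_right[OF integrable_powr_gexp[of "q - 1" q], of q]])
       (use q in \<open>auto simp: abs_mult sgn_if\<close>)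
  have i2: "integrable lborel ?g2"
    using q by (intro Bochner_Integration.integrable_diff integrable_mult_right integrable_powr_gexp) auto
  have c1: "continuous_on UNIV ?g1"
    using d2 by (meson DERIV_isCont continuous_at_imp_continuous_on)
  have c0: "continuous_on UNIV (gexp q)"
    using d1 by (meson DERIV_isCont continuous_at_imp_continuous_on)
  have c2: "continuous_on UNIV ?g2"
    using q c0 by (intro continuous_intros continuous_on_powr') auto
  let ?C = "(LBINT x. \<bar>gexp q x\<bar>) + (LBINT x. \<bar>?g2 x\<bar>)"
  have "norm (ft (gexp q) t) \<le> ?C * (1 / (1 + t\<^sup>2))" for t
  proof -
    have "ft ?g2 t = (\<i> * complex_of_real t) * ((\<i> * complex_of_real t) * ft (gexp q) t)"
      by (simp only: ft_derivative[OF i1 i2 c2 d2] ft_derivative[OF i0 i1 c1 d1])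
    then have "t\<^sup>2 * norm (ft (gexp q) t) \<le> (LBINT x. \<bar>?g2 x\<bar>)"
      using norm_ft_le[of ?g2 t] by (simp add: norm_mult power2_eq_square)
    then have "(1 + t\<^sup>2) * norm (ft (gexp q) t) \<le> ?C"
      using norm_ft_le[of "gexp q" t] by (simp add: ring_distribs)
    then show ?thesis by (simp add: field_simps add_pos_nonneg)
  qed
  then show thesis by (intro that[of ?C]) auto
qed

section \<open>Gaussian smoothing and Fourier inversion\<close>

lemma integrable_exp_sq:
  assumes "0 < u" shows "integrable lborel (\<lambda>t::real. exp (- (u * t\<^sup>2 / 2)))"
proof -
  have "integrable lborel (\<lambda>t. sqrt (2 * pi) * std_normal_density (0 + sqrt u * t))"
    using assms by (intro integrable_mult_right lborel_integrable_real_affine integrable_normal_density) auto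
  then show ?thesis
    using assms by (simp add: normal_density_def power_mult_distrib)
qed

text \<open>Scaling by \<open>sqrt u\<close> reduces this to the characteristic function of the
  standard normal distribution at \<open>- x / sqrt u\<close>.\<close>

lemma ft_exp_sq:
  assumes u: "0 < u"
  shows "(LBINT t. complex_of_real (exp (- (u * t\<^sup>2 / 2))) * echar (t * x)) =
    complex_of_real (sqrt (2 * pi / u) * exp (- (x\<^sup>2 / (2 * u))))"
proof -
  have su: "sqrt u \<noteq> 0" "0 < sqrt u" using u by auto
  let ?f = "\<lambda>t. complex_of_real (exp (- (u * t\<^sup>2 / 2))) * echar (t * x)"
  have "(LBINT t. std_normal_density t *\<^sub>R exp (\<i> * complex_of_real ((- x / sqrt u) * t))) = char std_normal_distribution (- x / sqrt u)"
    unfolding char_def by (subst integral_density) (auto simp: normal_density_nonneg)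
  also have "\<dots> = complex_of_real (exp (- (x\<^sup>2 / (2 * u))))"
    using u by (simp add: char_std_normal_distribution power_divide)
  finally have c: "(LBINT t. std_normal_density t *\<^sub>R exp (\<i> * complex_of_real ((- x / sqrt u) * t)))
      = complex_of_real (exp (- (x\<^sup>2 / (2 * u))))" .
  have "(LBINT t. std_normal_density t *\<^sub>R exp (\<i> * complex_of_real ((- x / sqrt u) * t))) =
      sqrt u *\<^sub>R (LBINT t. std_normal_density (0 + sqrt u * t) *\<^sub>R exp (\<i> * complex_of_real ((- x / sqrt u) * (0 + sqrt u * t))))"
    using lborel_integral_real_affine[OF su(1), of "\<lambda>t. std_normal_density t *\<^sub>R exp (\<i> * complex_of_real ((- x / sqrt u) * t))" 0] su
    by simp
  also have "(\<lambda>t. std_normal_density (0 + sqrt u * t) *\<^sub>R exp (\<i> * complex_of_real ((- x / sqrt u) * (0 + sqrt u * t))))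
      = (\<lambda>t. (1 / sqrt (2 * pi)) *\<^sub>R ?f t)"
    using u by (auto simp: normal_density_def power_mult_distrib scaleR_conv_of_real mult_ac)
  also have "sqrt u *\<^sub>R (LBINT t. (1 / sqrt (2 * pi)) *\<^sub>R ?f t) = (sqrt u / sqrt (2 * pi)) *\<^sub>R (LBINT t. ?f t)"
    by simp
  finally have "(sqrt u / sqrt (2 * pi)) *\<^sub>R (LBINT t. ?f t) = complex_of_real (exp (- (x\<^sup>2 / (2 * u))))"
    using c by simp
  then have "(sqrt (2 * pi) / sqrt u) *\<^sub>R ((sqrt u / sqrt (2 * pi)) *\<^sub>R (LBINT t. ?f t)) =
      (sqrt (2 * pi) / sqrt u) *\<^sub>R complex_of_real (exp (- (x\<^sup>2 / (2 * u))))"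
    by simp
  then show ?thesis using su by (simp add: real_sqrt_divide scaleR_conv_of_real)
qed

text \<open>The Gaussian factor makes the double integral absolutely convergent even when
  \<open>ft f\<close> is not integrable. Damping by exp(-u t^2 / 2) on the Fourier side averages f
  over a normal distribution of variance u around y.\<close>

lemma ft_gauss_smoothing:
  assumes f: "integrable lborel f" and u: "0 < u"
  shows "(LBINT t. ft f t * complex_of_real (exp (- (u * t\<^sup>2 / 2))) * exp (\<i> * complex_of_real (t * y))) =
    complex_of_real (2 * pi * (LBINT v. std_normal_density v * f (y + sqrt u * v)))"
proof -
  have [measurable]: "f \<in> borel_measurable borel" using f by (auto dest: borel_measurable_integrable)
  let ?E = "\<lambda>t. complex_of_real (exp (- (u * t\<^sup>2 / 2)))"
  let ?h = "\<lambda>(x, t). complex_of_real (f x) * (?E t * echar (t * (x - y)))"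
  have hn: "norm (?h (x, t)) = \<bar>f x\<bar> * exp (- (u * t\<^sup>2 / 2))" for x t
    by (simp add: norm_mult)
  have h: "integrable (lborel \<Otimes>\<^sub>M lborel) ?h"
  proof (rule lborel_pair.Fubini_integrable)
    show "integrable lborel (\<lambda>x. LBINT t. norm (?h (x, t)))"
      unfolding hn using f by simp
    show "AE x in lborel. integrable lborel (\<lambda>t. ?h (x, t))"
    proof (rule AE_I2)
      fix x
      show "integrable lborel (\<lambda>t. ?h (x, t))"
        by (rule Bochner_Integration.integrable_bound[OF integrable_mult_right[OF integrable_exp_sq[OF u], of "\<bar>f x\<bar>"]])
           (auto simp: norm_mult abs_mult)
    qed
  qed measurable
  have "(LBINT t. ft f t * ?E t * exp (\<i> * complex_of_real (t * y))) = (LBINT t. (LBINT x. ?h (x, t)))"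
  proof (rule Bochner_Integration.integral_cong[OF refl])
    fix t
    have "(LBINT x. ?h (x, t)) = (LBINT x. (?E t * exp (\<i> * complex_of_real (t * y))) *
        (complex_of_real (f x) * echar (x * t)))"
      by (intro Bochner_Integration.integral_cong[OF refl]) (simp add: algebra_simps flip: exp_add)
    also have "\<dots> = (?E t * exp (\<i> * complex_of_real (t * y))) * ft f t"
      unfolding ft_def by (rule integral_mult_right_zero)
    finally show "ft f t * ?E t * exp (\<i> * complex_of_real (t * y)) = (LBINT x. ?h (x, t))"
      by (simp add: mult_ac)
  qed
  also have "\<dots> = (LBINT x. (LBINT t. ?h (x, t)))"
    using lborel_pair.Fubini_integral[of "\<lambda>x t. ?h (x, t)"] h by simp
  also have "\<dots> = (LBINT x. complex_of_real (f x * (sqrt (2 * pi / u) * exp (- ((x - y)\<^sup>2 / (2 * u))))))"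
  proof (rule Bochner_Integration.integral_cong[OF refl])
    fix x
    have "(LBINT t. ?h (x, t)) = complex_of_real (f x) * (LBINT t. ?E t * echar (t * (x - y)))"
      by (simp del: of_real_mult of_real_diff)
    then show "(LBINT t. ?h (x, t)) = complex_of_real (f x * (sqrt (2 * pi / u) * exp (- ((x - y)\<^sup>2 / (2 * u)))))"
      unfolding ft_exp_sq[OF u] by simp
  qed
  also have "\<dots> = complex_of_real (LBINT x. f x * (sqrt (2 * pi / u) * exp (- ((x - y)\<^sup>2 / (2 * u)))))"
    by (rule integral_complex_of_real)
  also have "(LBINT x. f x * (sqrt (2 * pi / u) * exp (- ((x - y)\<^sup>2 / (2 * u))))) =
      sqrt u * (LBINT v. f (y + sqrt u * v) * (sqrt (2 * pi / u) * exp (- ((y + sqrt u * v - y)\<^sup>2 / (2 * u)))))"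
    using lborel_integral_real_affine[of "sqrt u" "\<lambda>x. f x * (sqrt (2 * pi / u) * exp (- ((x - y)\<^sup>2 / (2 * u))))" y] u
    by simp
  also have "\<dots> = sqrt u * (LBINT v. (2 * pi / sqrt u) * (std_normal_density v * f (y + sqrt u * v)))"
    using u by (intro arg_cong[where f="(*) (sqrt u)"] Bochner_Integration.integral_cong[OF refl])
      (simp add: normal_density_def power_mult_distrib real_sqrt_divide real_sqrt_mult field_simps)
  also have "\<dots> = 2 * pi * (LBINT v. std_normal_density v * f (y + sqrt u * v))"
    using u by simp
  finally show ?thesis .
qed

text \<open>Let u tend to 0 in \<open>ft_gauss_smoothing\<close>: on the left \<open>ft f\<close>
  dominates, on the right the bound \<open>B\<close> times the normal density does, and continuity
  identifies the limit.\<close>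

lemma ft_inversion:
  assumes f: "integrable lborel f" and cont: "continuous_on UNIV f" and bd: "\<And>x. \<bar>f x\<bar> \<le> B"
    and ft: "integrable lborel (ft f)"
  shows "(LBINT t. ft f t * exp (\<i> * complex_of_real (t * y))) = complex_of_real (2 * pi * f y)"
proof -
  have [measurable]: "f \<in> borel_measurable borel" using f by (auto dest: borel_measurable_integrable)
  define u where "u n = 1 / real (Suc n)" for n
  have u: "0 < u n" for n by (simp add: u_def)
  have u0: "u \<longlonglongrightarrow> 0" unfolding u_def by (rule LIMSEQ_Suc[OF lim_const_over_n])
  let ?X = "\<lambda>n. LBINT t. ft f t * complex_of_real (exp (- (u n * t\<^sup>2 / 2))) * exp (\<i> * complex_of_real (t * y))"
  have 1: "?X \<longlonglongrightarrow> (LBINT t. ft f t * exp (\<i> * complex_of_real (t * y)))"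
  proof (rule integral_dominated_convergence[where w="\<lambda>t. norm (ft f t)"])
    show "AE t in lborel. (\<lambda>n. ft f t * complex_of_real (exp (- (u n * t\<^sup>2 / 2))) * exp (\<i> * complex_of_real (t * y)))
        \<longlonglongrightarrow> ft f t * exp (\<i> * complex_of_real (t * y))"
      by (auto intro!: AE_I2 tendsto_eq_intros u0)
    show "AE t in lborel. norm (ft f t * complex_of_real (exp (- (u n * t\<^sup>2 / 2))) * exp (\<i> * complex_of_real (t * y))) \<le> norm (ft f t)" for n
      using u[of n] by (auto simp: norm_mult intro!: mult_left_le)
  qed (use ft in auto)
  have "(\<lambda>n. LBINT v. std_normal_density v * f (y + sqrt (u n) * v)) \<longlonglongrightarrow> (LBINT v. std_normal_density v * f y)"
  proof (rule integral_dominated_convergence[where w="\<lambda>v. std_normal_density v * B"])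
    have "(\<lambda>n. f (y + sqrt (u n) * v)) \<longlonglongrightarrow> f y" for v
    proof (rule isCont_tendsto_compose[of _ f])
      show "isCont f y" using cont by (simp add: continuous_on_eq_continuous_at)
      show "(\<lambda>n. y + sqrt (u n) * v) \<longlonglongrightarrow> y" by (auto intro!: tendsto_eq_intros u0)
    qed
    then show "AE v in lborel. (\<lambda>n. std_normal_density v * f (y + sqrt (u n) * v)) \<longlonglongrightarrow> std_normal_density v * f y"
      by (intro AE_I2 tendsto_mult_left)
    show "AE v in lborel. norm (std_normal_density v * f (y + sqrt (u n) * v)) \<le> std_normal_density v * B" for n
      by (auto simp: abs_mult intro!: mult_left_mono bd)
  qed auto
  also have "(LBINT v. std_normal_density v * f y) = f y"
    by simp
  finally have "?X \<longlonglongrightarrow> complex_of_real (2 * pi * f y)"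
    unfolding ft_gauss_smoothing[OF f u] by (intro tendsto_of_real tendsto_mult_left)
  with 1 show ?thesis by (rule LIMSEQ_unique)
qed

section \<open>Symmetric unimodal functions\<close>

text \<open>Comparing absolute values encodes evenness and monotonicity away from 0 in one
  condition.\<close>

definition unimodal :: "(real \<Rightarrow> real) \<Rightarrow> bool" where
  "unimodal f \<longleftrightarrow> (\<forall>x. 0 \<le> f x) \<and> (\<forall>x y. \<bar>x\<bar> \<le> \<bar>y\<bar> \<longrightarrow> f y \<le> f x)"

lemma unimodal_nonneg: "unimodal f \<Longrightarrow> 0 \<le> f x"
  and unimodal_antimono: "unimodal f \<Longrightarrow> \<bar>x\<bar> \<le> \<bar>y\<bar> \<Longrightarrow> f y \<le> f x"
  and unimodal_le_0: "unimodal f \<Longrightarrow> f x \<le> f 0"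
  by (auto simp: unimodal_def)

lemma unimodal_even: "unimodal f \<Longrightarrow> f (- x) = f x"
  by (auto simp: unimodal_def intro!: antisym)

lemma unimodal_gexp: "0 < q \<Longrightarrow> unimodal (\<lambda>x. c\<^sup>2 * gexp q (x / z))"
  by (auto simp: unimodal_def gexp_def abs_div_pos intro!: mult_left_mono powr_mono2 divide_right_mono)

text \<open>For 0 <= v <= w, folding the integral for h v - h w about the midpoint turns its
  integrand into (f x - f (2c - x)) (g (v - x) - g (w - x)). The two factors change sign together at
  x = c, so the product is nonnegative. Transforms multiply by
  \<open>integral_convolution_exp\<close>.\<close>

lemma
  assumes f: "unimodal f" "integrable lborel f" and g: "unimodal g" "integrable lborel g"
  defines "h \<equiv> \<lambda>x. LBINT y. f y * g (x - y)"
  shows unimodal_convolution: "unimodal h"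
    and integrable_unimodal_convolution: "integrable lborel h"
    and ft_unimodal_convolution: "ft h t = ft f t * ft g t"
proof -
  have [measurable]: "f \<in> borel_measurable borel" "g \<in> borel_measurable borel"
    using f g by (auto dest: borel_measurable_integrable)
  have int: "integrable lborel (\<lambda>y. f y * g (x - y))" for x
    by (rule Bochner_Integration.integrable_bound[OF integrable_mult_right[OF f(2), of "g 0"]])
       (auto simp: abs_mult unimodal_nonneg f g mult.commute[of "g 0"] intro!: AE_I2 mult_left_mono unimodal_le_0[OF g(1)])
  have even: "h (- x) = h x" for x
  proof -
    have "h (- x) = (LBINT y. f (- y) * g (- x - (- y)))"
      unfolding h_def using integral_lborel_uminus[of "\<lambda>y. f y * g (- x - y)"] by simp
    also have "\<dots> = h x"
      unfolding h_def using unimodal_even[OF f(1)] unimodal_even[OF g(1), of "x - _"] by simp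
    finally show ?thesis .
  qed
  have mono: "h w \<le> h v" if "0 \<le> v" "v \<le> w" for v w
  proof -
    define c where "c = (v + w) / 2" \<comment> \<open>reflection at this midpoint negates \<open>g (v - x) - g (w - x)\<close>\<close>
    have c2: "2 * c = v + w" by (simp add: c_def)
    let ?D = "\<lambda>x. g (v - x) - g (w - x)"
    have iD: "integrable lborel (\<lambda>x. f x * ?D x)"
      unfolding right_diff_distrib by (intro Bochner_Integration.integrable_diff int)
    have refl: "?D (2 * c - x) = - ?D x" for x
    proof -
      have e: "v - (2 * c - x) = - (w - x)" "w - (2 * c - x) = - (v - x)"
        by (simp_all add: c_def field_simps)
      show ?thesis unfolding e unimodal_even[OF g(1)] by simp
    qed
    have hD: "h v - h w = (LBINT x. f x * ?D x)"
      unfolding h_def right_diff_distrib by (rule Bochner_Integration.integral_diff[symmetric]) (rule int)+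
    have iD': "integrable lborel (\<lambda>x. f (2 * c - x) * ?D (2 * c - x))"
      using iD by (subst integrable_lborel_reflect[of "\<lambda>x. f x * ?D x"]) auto
    have "(LBINT x. f x * ?D x) = (LBINT x. f (2 * c - x) * ?D (2 * c - x))"
      by (rule integral_lborel_reflect[symmetric]) measurable
    then have "2 * (h v - h w) = (LBINT x. f x * ?D x + f (2 * c - x) * ?D (2 * c - x))"
      using iD iD' by (simp add: hD)
    also have "\<dots> \<ge> 0"
    proof (rule integral_nonneg_AE, rule AE_I2)
      fix x
      have "f x * ?D x + f (2 * c - x) * ?D (2 * c - x) = (f x - f (2 * c - x)) * ?D x"
        unfolding refl by (simp add: algebra_simps)
      also have "\<dots> \<ge> 0"
      proof (cases "x \<le> c")
        case True
        then have "\<bar>x\<bar> \<le> \<bar>2 * c - x\<bar>" "\<bar>v - x\<bar> \<le> \<bar>w - x\<bar>" using that c2 by linarith+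
        then show ?thesis by (intro mult_nonneg_nonneg) (auto intro: unimodal_antimono f g)
      next
        case False
        then have "\<bar>2 * c - x\<bar> \<le> \<bar>x\<bar>" "\<bar>w - x\<bar> \<le> \<bar>v - x\<bar>" using that c2 by linarith+
        then show ?thesis by (intro mult_nonpos_nonpos) (auto intro: unimodal_antimono f g)
      qed
      finally show "0 \<le> f x * ?D x + f (2 * c - x) * ?D (2 * c - x)" .
    qed
    finally show ?thesis by simp
  qed
  have abs: "h x = h \<bar>x\<bar>" for x using even[of x] by (simp add: abs_if)
  show "unimodal h"
    unfolding unimodal_def
  proof (intro conjI allI impI)
    show "0 \<le> h x" for x unfolding h_def by (simp add: unimodal_nonneg f g)
    show "h y \<le> h x" if "\<bar>x\<bar> \<le> \<bar>y\<bar>" for x y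
      using mono[OF _ that] abs[of x] abs[of y] by simp
  qed
  have hm [measurable]: "h \<in> borel_measurable borel" unfolding h_def by measurable
  have "integrable (lborel \<Otimes>\<^sub>M lborel) (\<lambda>(y, x). f y * g (x - y))"
  proof (rule lborel_pair.Fubini_integrable)
    have "(LBINT x. norm (f y * g (x - y))) = f y * (LBINT x. g x)" for y
      using integral_lborel_shift[of g "-y"] by (simp add: abs_mult unimodal_nonneg f g)
    then show "integrable lborel (\<lambda>y. LBINT x. norm (case (y, x) of (y, x) \<Rightarrow> f y * g (x - y)))"
      using f by simp
    show "AE y in lborel. integrable lborel (\<lambda>x. case (y, x) of (y, x) \<Rightarrow> f y * g (x - y))"
      using integrable_lborel_shift[of g "- _"] g(2) by (intro AE_I2) simp
  qed measurable
  from lborel_pair.integrable_snd[OF this] show "integrable lborel h" by (simp add: h_def)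
  have "complex_of_real (h x) = (LBINT y. complex_of_real (f y) * complex_of_real (g (x - y)))" for x
    unfolding h_def by (simp flip: of_real_mult)
  then show "ft h t = ft f t * ft g t"
    using integral_convolution_exp[of "\<lambda>x. complex_of_real (f x)" "\<lambda>x. complex_of_real (g x)" t] f g
    by (simp add: ft_def)
qed

text \<open>Each factor is the transform of a dilate of \<open>gexp q\<close>, and products of
  transforms come from convolutions. A vanishing \<open>z k\<close> or an empty product would
  contribute a nonzero constant, which is not the transform of an integrable function.\<close>

lemma prod_ft_gexp_unimodal:
  assumes q: "0 < q" and "finite A" "A \<noteq> {}" "\<And>k. k \<in> A \<Longrightarrow> z k \<noteq> (0::real)"
  shows "\<exists>f. unimodal f \<and> integrable lborel f \<and> (\<forall>t. ft f t = (\<Prod>k\<in>A. ft (gexp q) (t * z k)))"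
  using assms(2-4)
proof (induction rule: finite_ne_induct)
  have *: "\<exists>f. unimodal f \<and> integrable lborel f \<and> (\<forall>t. ft f t = ft (gexp q) (t * z))" if z: "z \<noteq> 0" for z
  proof (intro exI conjI allI)
    \<comment> \<open>The normalising factor 1 / |z| is written as a square to fit
      \<open>unimodal_gexp\<close>, where the square encodes a nonnegative constant.\<close>
    let ?f = "\<lambda>x. (1 / sqrt \<bar>z\<bar>)\<^sup>2 * gexp q (x / z)"
    show "unimodal ?f" using q by (rule unimodal_gexp)
    show "integrable lborel ?f"
      using lborel_integrable_real_affine[OF integrable_gexp[OF q], of "1 / z" 0] z by simp
    fix t
    have "ft (gexp q) (t * z) = (1 / \<bar>z\<bar>) *\<^sub>R (LBINT x. complex_of_real (gexp q (x / z)) * echar ((x / z) * (t * z)))"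
      unfolding ft_def using z
      using lborel_integral_real_affine[of "1 / z" "\<lambda>x. complex_of_real (gexp q x) * echar (x * (t * z))" 0]
      by (simp del: of_real_divide of_real_mult)
    also have "\<dots> = ft ?f t"
      unfolding ft_def using z by (simp add: scaleR_conv_of_real mult_ac power_divide)
    finally show "ft ?f t = ft (gexp q) (t * z)" by simp
  qed
  {
    case (singleton k)
    then show ?case using *[of "z k"] by simp
  next
    case (insert k A)
    then obtain f where f: "unimodal f" "integrable lborel f" "\<And>t. ft f t = (\<Prod>k\<in>A. ft (gexp q) (t * z k))"
      by auto
    obtain g where g: "unimodal g" "integrable lborel g" "\<And>t. ft g t = ft (gexp q) (t * z k)"
      using *[of "z k"] insert by auto
    show ?case
      using unimodal_convolution[OF f(1,2) g(1,2)] integrable_unimodal_convolution[OF f(1,2) g(1,2)]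
        ft_unimodal_convolution[OF f(1,2) g(1,2)] insert f(3) g(3)
      by (intro exI[of _ "\<lambda>x. LBINT y. f y * g (x - y)"]) (simp add: mult.commute)
  }
qed

section \<open>Positivity of moments\<close>

text \<open>The Gaussian means of the transform of a unimodal function decrease in the width parameter,
  and \<open>\<bar>t\<bar> powr s\<close> is a positive mixture of \<open>exp (- u t\<^sup>2) - exp (- 2 u t\<^sup>2)\<close> for \<open>s < 2\<close>.\<close>

lemma unimodal_gauss_mean_antimono:
  assumes f: "unimodal f" "integrable lborel f" and h: "\<And>t. ft f t = complex_of_real (h t)"
    and "0 < u" "u \<le> v"
  shows "(LBINT t. h t * exp (- (v * t\<^sup>2 / 2))) \<le> (LBINT t. h t * exp (- (u * t\<^sup>2 / 2)))"
proof -
  have [measurable]: "f \<in> borel_measurable borel" using f by (auto dest: borel_measurable_integrable)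
  have J: "(LBINT t. h t * exp (- (u * t\<^sup>2 / 2))) = 2 * pi * (LBINT v. std_normal_density v * f (sqrt u * v))"
    if u: "0 < u" for u
  proof -
    have "complex_of_real (LBINT t. h t * exp (- (u * t\<^sup>2 / 2))) =
        (LBINT t. complex_of_real (h t * exp (- (u * t\<^sup>2 / 2))))"
      by (rule integral_complex_of_real[symmetric])
    also have "\<dots> = complex_of_real (2 * pi * (LBINT v. std_normal_density v * f (sqrt u * v)))"
      using ft_gauss_smoothing[OF f(2) u, of 0] by (simp add: h)
    finally show ?thesis by (simp only: of_real_eq_iff)
  qed
  have int: "integrable lborel (\<lambda>v. std_normal_density v * f (sqrt u * v))" for u
    by (rule Bochner_Integration.integrable_bound[OF integrable_mult_left[OF integrable_normal_density[OF zero_less_one, of 0], of "f 0"]])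
       (auto simp: abs_mult unimodal_nonneg f intro!: AE_I2 mult_left_mono unimodal_le_0[OF f(1)])
  have "(LBINT x. std_normal_density x * f (sqrt v * x)) \<le> (LBINT x. std_normal_density x * f (sqrt u * x))"
    using assms by (intro Bochner_Integration.integral_mono int mult_left_mono unimodal_antimono[OF f(1)])
      (auto simp: abs_mult intro!: mult_right_mono)
  then show ?thesis using assms by (simp add: J)
qed

lemma unimodal_ft_moment_nonneg_lt:
  assumes f: "unimodal f" "integrable lborel f" and h: "\<And>t. ft f t = complex_of_real (h t)"
    and hi: "integrable lborel h" and s: "s < 2" and hs: "integrable lborel (\<lambda>t. \<bar>t\<bar> powr s * h t)"
  shows "0 \<le> (LBINT t. \<bar>t\<bar> powr s * h t)"
proof -
  have [measurable]: "h \<in> borel_measurable borel" using hi by (auto dest: borel_measurable_integrable)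
  \<comment> \<open>The difference of exponentials vanishes to first order at 0, so the kernel is
    bounded there by u^(-s/2), which is integrable because s < 2. Substituting t^2 u for u recovers
    |t|^s up to the constant \<open>?c\<close>.\<close>
  let ?k = "\<lambda>u::real. indicator {0<..} u * ((exp (- u) - exp (- (2 * u))) * u powr (- s / 2 - 1))"
  let ?c = "LBINT u. ?k u"
  have k0: "0 \<le> ?k u" for u by (auto simp: indicator_def)
  have k: "integrable lborel ?k"
  proof (rule Bochner_Integration.integrable_bound[OF integrable_powr_gexp[of "- s / 2" 1]])
    show "AE u in lborel. norm (?k u) \<le> norm (\<bar>u\<bar> powr (- s / 2) * gexp 1 u)"
    proof (rule AE_I2)
      fix u :: real
      show "norm (?k u) \<le> norm (\<bar>u\<bar> powr (- s / 2) * gexp 1 u)"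
      proof (cases "0 < u")
        case True
        have "exp (- u) - exp (- (2 * u)) = exp (- u) * (1 - exp (- u))"
          by (simp add: algebra_simps flip: exp_add)
        also have "\<dots> \<le> exp (- u) * u"
          using exp_ge_add_one_self[of "- u"] by (intro mult_left_mono) auto
        finally have "(exp (- u) - exp (- (2 * u))) * u powr (- s / 2 - 1) \<le> (exp (- u) * u) * u powr (- s / 2 - 1)"
          by (intro mult_right_mono) auto
        also have "\<dots> = u powr (- s / 2) * exp (- u)"
          using True by (simp add: powr_diff)
        finally show ?thesis using True k0[of u] by (simp add: gexp_def)
      qed (auto simp: indicator_def)
    qed
  qed (use s in auto)
  have c: "0 < ?c"
  proof -
    have "?c \<noteq> 0"
    proof
      assume "?c = 0"
      then have "AE u in lborel. ?k u = 0"
        using integral_nonneg_eq_0_iff_AE[OF k] k0 by auto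
      then have "AE u in lborel. \<not> (0 < (u::real))"
        by eventually_elim (auto simp: indicator_def split: if_splits)
      then have "emeasure lborel {0<..<1::real} = 0"
        by (subst AE_iff_measurable[symmetric, where P="\<lambda>u. \<not> (0 < u \<and> u < 1)"]) (auto elim: eventually_mono)
      then show False by simp
    qed
    moreover have "0 \<le> ?c" using k0 by (intro integral_nonneg_AE AE_I2)
    ultimately show ?thesis by simp
  qed
  let ?K = "\<lambda>(t, u). h t * \<bar>t\<bar> powr (s + 2) * ?k (t\<^sup>2 * u)"
  have scale: "integrable lborel (\<lambda>u. ?k (t\<^sup>2 * u)) \<and> \<bar>t\<bar> powr (s + 2) * (LBINT u. ?k (t\<^sup>2 * u)) = \<bar>t\<bar> powr s * ?c" for t
  proof (cases "t = 0")
    case False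
    then have "?c = t\<^sup>2 * (LBINT u. ?k (t\<^sup>2 * u))"
      using lborel_integral_real_affine[of "t\<^sup>2" ?k 0] by simp
    moreover have "\<bar>t\<bar> powr (s + 2) = \<bar>t\<bar> powr s * t\<^sup>2"
      using False by (simp add: powr_add powr_numeral)
    ultimately show ?thesis
      using lborel_integrable_real_affine[OF k, of "t\<^sup>2" 0] False by simp
  qed simp
  have K: "integrable (lborel \<Otimes>\<^sub>M lborel) ?K"
  proof (rule lborel_pair.Fubini_integrable)
    have "(LBINT u. norm (?K (t, u))) = norm (\<bar>t\<bar> powr s * h t) * ?c" for t
    proof -
      have "(LBINT u. norm (?K (t, u))) = (LBINT u. \<bar>h t\<bar> * \<bar>t\<bar> powr (s + 2) * ?k (t\<^sup>2 * u))"
        by (simp only: prod.case real_norm_def abs_mult[of "h t * \<bar>t\<bar> powr (s + 2)"] abs_mult[of "h t"]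
            abs_of_nonneg[OF k0] abs_of_nonneg[OF powr_ge_zero])
      also have "\<dots> = \<bar>h t\<bar> * (\<bar>t\<bar> powr (s + 2) * (LBINT u. ?k (t\<^sup>2 * u)))" by simp
      also have "\<dots> = norm (\<bar>t\<bar> powr s * h t) * ?c"
        using scale[of t] by (simp add: abs_mult)
      finally show ?thesis .
    qed
    then show "integrable lborel (\<lambda>t. LBINT u. norm (?K (t, u)))"
      using hs by simp
    show "AE t in lborel. integrable lborel (\<lambda>u. ?K (t, u))"
      using scale by (auto intro!: AE_I2)
  qed measurable
  have "(LBINT t. \<bar>t\<bar> powr s * h t) * ?c = (LBINT t. (LBINT u. ?K (t, u)))"
  proof -
    have "(LBINT u. ?K (t, u)) = \<bar>t\<bar> powr s * h t * ?c" for t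
    proof -
      have "(LBINT u. ?K (t, u)) = h t * (\<bar>t\<bar> powr (s + 2) * (LBINT u. ?k (t\<^sup>2 * u)))" by simp
      then show ?thesis using scale[of t] by simp
    qed
    then show ?thesis by (simp only: Bochner_Integration.integral_mult_left_zero)
  qed
  also have "\<dots> = (LBINT u. (LBINT t. ?K (t, u)))"
    using lborel_pair.Fubini_integral[of "\<lambda>t u. ?K (t, u)"] K by simp
  also have "\<dots> \<ge> 0"
  \<comment> \<open>For fixed u > 0 the powers of t cancel, and the inner integral becomes a
    positive multiple of \<open>?J (2 * u) - ?J (4 * u)\<close>, a difference of two Gaussian means
    at increasing parameters.\<close>
  proof (rule integral_nonneg_AE, rule AE_I2)
    fix u :: real
    show "0 \<le> (LBINT t. ?K (t, u))"
    proof (cases "0 < u")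
      case True
      let ?J = "\<lambda>u. LBINT t. h t * exp (- (u * t\<^sup>2 / 2))"
      have int: "integrable lborel (\<lambda>t. h t * exp (- (v * t\<^sup>2 / 2)))" if "0 < v" for v
        by (rule Bochner_Integration.integrable_bound[OF hi]) (use that in \<open>auto simp: abs_mult intro!: mult_left_le\<close>)
      have "?K (t, u) = u powr (- s / 2 - 1) * (h t * exp (- ((2 * u) * t\<^sup>2 / 2)) - h t * exp (- ((4 * u) * t\<^sup>2 / 2)))" for t
      proof (cases "t = 0")
        case False
        then have "(t\<^sup>2 * u) powr (- s / 2 - 1) = (\<bar>t\<bar> powr 2) powr (- s / 2 - 1) * u powr (- s / 2 - 1)"
          using True by (simp add: powr_mult powr_numeral)
        also have "(\<bar>t\<bar> powr 2) powr (- s / 2 - 1) = \<bar>t\<bar> powr (- (s + 2))"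
          unfolding powr_powr by (rule arg_cong[where f = "(powr) \<bar>t\<bar>"]) simp
        finally have "\<bar>t\<bar> powr (s + 2) * (t\<^sup>2 * u) powr (- s / 2 - 1) = u powr (- s / 2 - 1)"
          using False by (simp flip: powr_add mult.assoc)
        then have "?K (t, u) = h t * (exp (- (t\<^sup>2 * u)) - exp (- (2 * (t\<^sup>2 * u)))) * u powr (- s / 2 - 1)"
          using True False by (simp add: mult_ac)
        then show ?thesis by (simp add: algebra_simps)
      qed simp
      then have "(LBINT t. ?K (t, u)) = u powr (- s / 2 - 1) * (?J (2 * u) - ?J (4 * u))"
        using int[of "2 * u"] int[of "4 * u"] True by simp
      also have "\<dots> \<ge> 0"
        using True unimodal_gauss_mean_antimono[OF f h, of "2 * u" "4 * u"] by (intro mult_nonneg_nonneg) auto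
      finally show ?thesis .
    next
      case False
      then have "\<not> 0 < t\<^sup>2 * u" for t by (simp add: mult_nonneg_nonpos not_less)
      then show ?thesis by simp
    qed
  qed
  finally show ?thesis using c by (simp add: zero_le_mult_iff)
qed

text \<open>At s = 2, which corresponds to p = n - 3, the mixing kernel is no longer integrable at
  0. The endpoint is reached by letting the order increase to 2, dominated by the sum of the
  absolute moments of orders 0 and s.\<close>

lemma unimodal_ft_moment_nonneg:
  assumes f: "unimodal f" "integrable lborel f" and h: "\<And>t. ft f t = complex_of_real (h t)"
    and hi: "integrable lborel h" and s: "s \<le> 2" and hs: "integrable lborel (\<lambda>t. \<bar>t\<bar> powr s * h t)"
  shows "0 \<le> (LBINT t. \<bar>t\<bar> powr s * h t)"
proof (cases "s < 2")
  case True
  then show ?thesis using unimodal_ft_moment_nonneg_lt[OF f h hi _ hs] by simp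
next
  case False
  then have s2: "s = 2" using s by simp
  have [measurable]: "h \<in> borel_measurable borel" using hi by (auto dest: borel_measurable_integrable)
  define r where "r n = 2 - 1 / real (Suc n)" for n
  have r: "0 \<le> r n" "r n < 2" for n by (auto simp: r_def field_simps)
  have "(\<lambda>n. 1 / real (Suc n)) \<longlonglongrightarrow> 0" by (rule LIMSEQ_Suc[OF lim_const_over_n])
  then have "(\<lambda>n. 2 - 1 / real (Suc n)) \<longlonglongrightarrow> 2 - 0" by (intro tendsto_diff tendsto_const)
  then have r2: "r \<longlonglongrightarrow> 2" unfolding r_def by simp
  have le: "\<bar>t\<bar> powr r n * \<bar>h t\<bar> \<le> \<bar>h t\<bar> + \<bar>t\<bar> powr s * \<bar>h t\<bar>" for t n
  proof -
    have "\<bar>t\<bar> powr r n \<le> 1 + \<bar>t\<bar> powr s"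
    proof (cases "\<bar>t\<bar> \<le> 1")
      case True
      then have "\<bar>t\<bar> powr r n \<le> 1" using r[of n] by (intro powr_le1) auto
      then show ?thesis by (simp add: add_increasing2)
    next
      case False
      then have "\<bar>t\<bar> powr r n \<le> \<bar>t\<bar> powr s" using r[of n] s2 by (intro powr_mono) auto
      then show ?thesis by simp
    qed
    then have "\<bar>t\<bar> powr r n * \<bar>h t\<bar> \<le> (1 + \<bar>t\<bar> powr s) * \<bar>h t\<bar>" by (intro mult_right_mono) auto
    then show ?thesis by (simp add: algebra_simps)
  qed
  have w: "integrable lborel (\<lambda>t. \<bar>h t\<bar> + \<bar>t\<bar> powr s * \<bar>h t\<bar>)"
    using integrable_norm[OF hi] integrable_norm[OF hs]
    by (intro Bochner_Integration.integrable_add) (auto simp: abs_mult)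
  have int: "integrable lborel (\<lambda>t. \<bar>t\<bar> powr r n * h t)" for n
    by (rule Bochner_Integration.integrable_bound[OF w]) (use le in \<open>auto simp: abs_mult intro: order_trans[OF _ abs_ge_self]\<close>)
  have "(\<lambda>n. LBINT t. \<bar>t\<bar> powr r n * h t) \<longlonglongrightarrow> (LBINT t. \<bar>t\<bar> powr s * h t)"
  proof (rule integral_dominated_convergence[OF _ _ w])
    show "AE t in lborel. (\<lambda>n. \<bar>t\<bar> powr r n * h t) \<longlonglongrightarrow> \<bar>t\<bar> powr s * h t"
      using AE_lborel_singleton[of 0]
      by eventually_elim (auto intro!: tendsto_eq_intros r2 simp: s2)
    show "AE t in lborel. norm (\<bar>t\<bar> powr r n * h t) \<le> \<bar>h t\<bar> + \<bar>t\<bar> powr s * \<bar>h t\<bar>" for n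
      using le by (auto simp: abs_mult)
  qed auto
  then show ?thesis
    by (rule LIMSEQ_le_const) (use unimodal_ft_moment_nonneg_lt[OF f h hi r(2) int] in auto)
qed

section \<open>The transform of the exponential of the norm\<close>

definition gexp_ft :: "real \<Rightarrow> real \<Rightarrow> real" where
  "gexp_ft q t = Re (ft (gexp q) t)"

text \<open>Up to constants this is the Fourier transform of x \<mapsto> exp(-N(x)^q), where N is
  the norm: the exponential factors over the coordinates.\<close>

definition gexp_ft_prod :: "real \<Rightarrow> real ^ 'n::finite \<Rightarrow> real" where
  "gexp_ft_prod q y = (\<Prod>k\<in>UNIV. gexp_ft q (y $ k))"

lemma gexp_uminus: "gexp q (- x) = gexp q x"
  by (simp add: gexp_def)

lemma ft_gexp: "ft (gexp q) t = complex_of_real (gexp_ft q t)"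
  unfolding gexp_ft_def by (rule ft_even_real) (auto simp: gexp_uminus)

lemma gexp_ft_uminus: "gexp_ft q (- t) = gexp_ft q t"
  unfolding gexp_ft_def by (subst ft_even_real(2)) (auto simp: gexp_uminus)

lemma gexp_ft_prod_uminus: "gexp_ft_prod q (- y) = gexp_ft_prod q y"
  by (simp add: gexp_ft_prod_def gexp_ft_uminus)

lemma borel_measurable_gexp_ft [measurable]: "gexp_ft q \<in> borel_measurable borel"
  unfolding gexp_ft_def[abs_def] by measurable

lemma borel_measurable_gexp_ft_prod [measurable]: "gexp_ft_prod q \<in> borel_measurable borel"
  unfolding gexp_ft_prod_def[abs_def] by measurable

lemma gexp_ft_decay:
  assumes "2 < q"
  obtains C where "0 \<le> C" "\<And>t. \<bar>gexp_ft q t\<bar> \<le> C * (1 / (1 + t\<^sup>2))"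
  using ft_gexp_decay[OF assms] by (simp add: ft_gexp) blast

lemma gexp_ft_prod_le_weight:
  assumes "2 < q"
  obtains C where "0 \<le> C" "\<And>y::real^'n::finite. \<bar>gexp_ft_prod q y\<bar> \<le> C * weight y"
proof -
  obtain C where C: "0 \<le> C" "\<And>t. \<bar>gexp_ft q t\<bar> \<le> C * (1 / (1 + t\<^sup>2))"
    using gexp_ft_decay[OF assms] by blast
  have "\<bar>gexp_ft_prod q y\<bar> \<le> C ^ CARD('n) * weight y" for y :: "real^'n"
  proof -
    have "\<bar>gexp_ft_prod q y\<bar> = (\<Prod>k\<in>UNIV. \<bar>gexp_ft q (y $ k)\<bar>)" by (simp add: gexp_ft_prod_def abs_prod)
    also have "\<dots> \<le> (\<Prod>k\<in>(UNIV::'n set). C * (1 / (1 + (y $ k)\<^sup>2)))"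
      by (intro prod_mono conjI C(2)) auto
    also have "\<dots> = C ^ CARD('n) * weight y"
      by (simp only: weight_def prod.distrib prod_constant)
    finally show ?thesis .
  qed
  then show thesis using C(1) by (intro that[of "C ^ CARD('n)"]) auto
qed

lemma integrable_gexp_ft_prod:
  assumes "2 < q" shows "integrable lborel (gexp_ft_prod q :: real^'n::finite \<Rightarrow> real)"
proof -
  obtain C where "0 \<le> C" "\<And>y::real^'n. \<bar>gexp_ft_prod q y\<bar> \<le> C * weight y"
    using gexp_ft_prod_le_weight[OF assms] by blast
  then show ?thesis by (intro integrable_le_weight[of _ C]) auto
qed

text \<open>Used twice: for the majorant in the pairing formula, and to obtain finite moments along
  almost every ray.\<close>

lemma integrable_gexp_ft_prod_norm_powr:
  assumes q: "2 < q" and p: "0 \<le> p" "p < real CARD('n)"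
  shows "integrable lborel (\<lambda>y::real^'n::finite. gexp_ft_prod q y * norm y powr (- p))"
proof -
  obtain C where C: "0 \<le> C" "\<And>y::real^'n. \<bar>gexp_ft_prod q y\<bar> \<le> C * weight y"
    using gexp_ft_prod_le_weight[OF q] by blast
  have "integrable lborel (\<lambda>y::real^'n. norm y powr (- p) * weight y)"
    using p by (intro integrable_powr_neg_weight[of UNIV]) (auto simp: component_le_norm_cart)
  from integrable_mult_right[OF this, of C] show ?thesis
  proof (rule Bochner_Integration.integrable_bound)
    show "AE y::real^'n in lborel. norm (gexp_ft_prod q y * norm y powr (- p)) \<le> norm (C * (norm y powr (- p) * weight y))"
    proof (rule AE_I2)
      fix y :: "real^'n"
      have "\<bar>gexp_ft_prod q y\<bar> * norm y powr (- p) \<le> (C * weight y) * norm y powr (- p)"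
        by (intro mult_right_mono C) auto
      then show "norm (gexp_ft_prod q y * norm y powr (- p)) \<le> norm (C * (norm y powr (- p) * weight y))"
        using C(1) by (simp add: abs_mult mult_ac)
    qed
  qed auto
qed

lemma gexp_inversion:
  assumes q: "2 < q"
  shows "integrable lborel (\<lambda>t. complex_of_real (gexp_ft q t) * echar (t * y))"
    and "(LBINT t. complex_of_real (gexp_ft q t) * echar (t * y)) = complex_of_real (2 * pi * gexp q y)"
proof -
  have q0: "0 < q" using q by simp
  obtain C where C: "0 \<le> C" "\<And>t. norm (ft (gexp q) t) \<le> C * (1 / (1 + t\<^sup>2))"
    using ft_gexp_decay[OF q] by blast
  have int: "integrable lborel (ft (gexp q))"
    by (rule Bochner_Integration.integrable_bound[OF integrable_mult_right[OF integrable_inverse_1_plus_sq, of C]])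
       (use C in \<open>auto intro!: AE_I2 intro: order_trans[OF _ abs_ge_self]\<close>)
  have cont: "continuous_on UNIV (gexp q)"
    unfolding gexp_def[abs_def] using q0 by (intro continuous_intros continuous_on_powr') auto
  have bd: "\<bar>gexp q x\<bar> \<le> 1" for x by (simp add: gexp_def)
  have "(LBINT t. ft (gexp q) t * exp (\<i> * complex_of_real (t * (- y)))) = complex_of_real (2 * pi * gexp q (- y))"
    by (rule ft_inversion[OF integrable_gexp[OF q0] cont bd int])
  then show "(LBINT t. complex_of_real (gexp_ft q t) * echar (t * y)) = complex_of_real (2 * pi * gexp q y)"
    by (simp add: ft_gexp gexp_uminus)
  show "integrable lborel (\<lambda>t. complex_of_real (gexp_ft q t) * echar (t * y))"
    using integrable_mult_exp_inner[OF int, of y] by (simp add: ft_gexp)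
qed

lemma gexp_lq_norm:
  assumes "0 < q" shows "gexp q (t * lq_norm q x) = (\<Prod>k\<in>UNIV. gexp q (t * x $ k))"
proof -
  have "\<bar>t * lq_norm q x\<bar> powr q = (\<Sum>k\<in>UNIV. \<bar>t * x $ k\<bar> powr q)"
    using assms lq_norm_nonneg[OF assms, of x] lq_norm_powr[OF assms, of x]
    by (simp add: abs_mult powr_mult sum_distrib_left)
  then show ?thesis by (simp add: gexp_def exp_sum sum_negf[symmetric])
qed

lemma gexp_lq_norm_eq_integral:
  fixes x :: "real ^ 'n::finite"
  assumes q: "2 < q"
  shows "(LBINT y. complex_of_real (gexp_ft_prod q y) * echar (x \<bullet> (t *\<^sub>R y))) =
    complex_of_real ((2 * pi) ^ CARD('n) * gexp q (t * lq_norm q x))"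
proof -
  let ?f = "\<lambda>k s. complex_of_real (gexp_ft q s) * echar (s * (t * x $ k))"
  have "(LBINT y. complex_of_real (gexp_ft_prod q y) * echar (x \<bullet> (t *\<^sub>R y)))
      = (\<integral>y. (\<Prod>k\<in>UNIV. ?f k (y $ k)) \<partial>(lborel :: (real^'n) measure))"
  proof (rule Bochner_Integration.integral_cong[OF refl])
    fix y :: "real^'n"
    have "echar (x \<bullet> (t *\<^sub>R y)) = (\<Prod>k\<in>UNIV. echar (y $ k * (t * x $ k)))"
      by (simp add: inner_vec_def sum_distrib_left mult_ac flip: exp_sum sum_negf)
    then show "complex_of_real (gexp_ft_prod q y) * echar (x \<bullet> (t *\<^sub>R y)) = (\<Prod>k\<in>UNIV. ?f k (y $ k))"
      by (simp only: gexp_ft_prod_def of_real_prod prod.distrib)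
  qed
  also have "\<dots> = (\<Prod>k\<in>UNIV. (LBINT s. ?f k s))"
    by (rule integral_vec_prod) (rule gexp_inversion[OF q])
  also have "\<dots> = (\<Prod>k\<in>UNIV. complex_of_real (2 * pi * gexp q (t * x $ k)))"
    by (intro prod.cong refl gexp_inversion[OF q])
  also have "\<dots> = complex_of_real ((2 * pi) ^ CARD('n) * (\<Prod>k\<in>UNIV. gexp q (t * x $ k)))"
    by (simp only: of_real_prod[symmetric] prod.distrib prod_constant power_mult_distrib)
  finally show ?thesis using q by (simp add: gexp_lq_norm)
qed

text \<open>The multiplication formula: insert the inversion integral for the exponential of the
  norm and exchange the order of integration, so that the transform falls on \<phi>. Both
  \<open>gexp_ft_prod q\<close> and \<phi> are integrable.\<close>

lemma integral_gexp_lq_norm_mult: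
  fixes \<phi> :: "real ^ 'n::finite \<Rightarrow> complex"
  assumes q: "2 < q" and \<phi>: "integrable lborel \<phi>"
  shows "(2 * pi) ^ CARD('n) * (LBINT x. complex_of_real (gexp q (t * lq_norm q x)) * \<phi> x) =
    (LBINT y. complex_of_real (gexp_ft_prod q y) * fourier \<phi> (t *\<^sub>R y))"
proof -
  have [measurable]: "\<phi> \<in> borel_measurable borel" using \<phi> by (auto dest: borel_measurable_integrable)
  let ?h = "\<lambda>(y, x). complex_of_real (gexp_ft_prod q y) * (\<phi> x * echar (x \<bullet> (t *\<^sub>R y)))"
  have h: "integrable (lborel \<Otimes>\<^sub>M lborel) ?h"
  proof (rule lborel_pair.Fubini_integrable)
    have "(LBINT x. norm (?h (y, x))) = \<bar>gexp_ft_prod q y\<bar> * (LBINT x. norm (\<phi> x))" for y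
      by (simp add: norm_mult)
    then show "integrable lborel (\<lambda>y. LBINT x. norm (?h (y, x)))"
      using integrable_gexp_ft_prod[OF q, where 'n='n] by simp
    show "AE y in lborel. integrable lborel (\<lambda>x. ?h (y, x))"
      using integrable_mult_exp_inner[OF \<phi>] by (intro AE_I2) (simp del: inner_scaleR_right)
  qed measurable
  have "(LBINT y. complex_of_real (gexp_ft_prod q y) * fourier \<phi> (t *\<^sub>R y)) = (LBINT y. (LBINT x. ?h (y, x)))"
    by (simp add: fourier_def del: inner_scaleR_right)
  also have "\<dots> = (LBINT x. (LBINT y. ?h (y, x)))"
    using lborel_pair.Fubini_integral[of "\<lambda>y x. ?h (y, x)"] h by simp
  also have "\<dots> = (LBINT x. (2 * pi) ^ CARD('n) * (complex_of_real (gexp q (t * lq_norm q x)) * \<phi> x))"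
  proof (rule Bochner_Integration.integral_cong[OF refl])
    fix x
    have "(LBINT y. ?h (y, x)) = (LBINT y. \<phi> x * (complex_of_real (gexp_ft_prod q y) * echar (x \<bullet> (t *\<^sub>R y))))"
      by (intro Bochner_Integration.integral_cong[OF refl]) (simp add: mult_ac)
    also have "\<dots> = \<phi> x * complex_of_real ((2 * pi) ^ CARD('n) * gexp q (t * lq_norm q x))"
      unfolding gexp_lq_norm_eq_integral[OF q, symmetric] by (rule integral_mult_right_zero)
    finally show "(LBINT y. ?h (y, x)) = (2 * pi) ^ CARD('n) * (complex_of_real (gexp q (t * lq_norm q x)) * \<phi> x)"
      by (simp add: mult_ac)
  qed
  also have "\<dots> = (2 * pi) ^ CARD('n) * (LBINT x. complex_of_real (gexp q (t * lq_norm q x)) * \<phi> x)"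
    by (rule integral_mult_right_zero)
  finally show ?thesis by simp
qed

section \<open>Radial integrals\<close>

text \<open>For p > 0, with \<open>gexp\<close> in place of f, this produces the power
  \<open>r powr (- p)\<close> of the norm. For p = 0 it is the dilation invariance of dt / |t|, used
  with \<open>window\<close>.\<close>

lemma radial_scale:
  fixes f :: "real \<Rightarrow> real"
  assumes f: "integrable lborel (\<lambda>t. \<bar>t\<bar> powr (p - 1) * f t)" and r: "0 < r"
  shows "integrable lborel (\<lambda>t. \<bar>t\<bar> powr (p - 1) * f (t * r))"
    and "(LBINT t. \<bar>t\<bar> powr (p - 1) * f (t * r)) = r powr (- p) * (LBINT t. \<bar>t\<bar> powr (p - 1) * f t)"
proof -
  have eq: "\<bar>t\<bar> powr (p - 1) * f (t * r) = r powr (1 - p) * (\<bar>0 + r * t\<bar> powr (p - 1) * f (0 + r * t))" for t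
  proof -
    have "r powr (1 - p) * r powr (p - 1) = 1" using r by (simp flip: powr_add)
    then have "r powr (1 - p) * (r powr (p - 1) * x) = x" for x by (simp flip: mult.assoc)
    then show ?thesis using r by (simp add: abs_mult powr_mult mult_ac)
  qed
  show "integrable lborel (\<lambda>t. \<bar>t\<bar> powr (p - 1) * f (t * r))"
    unfolding eq using r by (intro integrable_mult_right lborel_integrable_real_affine[OF f]) auto
  have "(LBINT t. \<bar>t\<bar> powr (p - 1) * f (t * r)) = r powr (1 - p) * (LBINT t. \<bar>0 + r * t\<bar> powr (p - 1) * f (0 + r * t))"
    unfolding eq by simp
  also have "\<dots> = r powr (- p) * (r * (LBINT t. \<bar>0 + r * t\<bar> powr (p - 1) * f (0 + r * t)))"
    using r by (simp add: powr_diff powr_minus field_simps)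
  also have "r * (LBINT t. \<bar>0 + r * t\<bar> powr (p - 1) * f (0 + r * t)) = (LBINT t. \<bar>t\<bar> powr (p - 1) * f t)"
    using lborel_integral_real_affine[of r "\<lambda>t. \<bar>t\<bar> powr (p - 1) * f t" 0] r by simp
  finally show "(LBINT t. \<bar>t\<bar> powr (p - 1) * f (t * r)) = r powr (- p) * (LBINT t. \<bar>t\<bar> powr (p - 1) * f t)" .
qed

text \<open>Since p < n, the integrand is of order at most |t|^(-2) for large |t|; this explains the
  power n + 1 in \<open>admissible\<close>.\<close>

lemma integrable_powr_rational:
  assumes p: "0 < p" "p < real n"
  shows "integrable lborel (\<lambda>t::real. \<bar>t\<bar> powr (p - 1) * (1 / (1 + \<bar>t\<bar> ^ (n + 1))))"
proof -
  let ?g = "\<lambda>t::real. indicator {0<..1} \<bar>t\<bar> *\<^sub>R \<bar>t\<bar> powr (p - 1) + 2 * (1 / (1 + t\<^sup>2))"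
  have "integrable lborel ?g"
    using p by (intro Bochner_Integration.integrable_add integrable_powr_near_0 integrable_mult_right integrable_inverse_1_plus_sq) auto
  then show ?thesis
  proof (rule Bochner_Integration.integrable_bound)
    have "norm (\<bar>t\<bar> powr (p - 1) * (1 / (1 + \<bar>t\<bar> ^ (n + 1)))) \<le> ?g t" for t :: real
    proof (cases "\<bar>t\<bar> \<le> 1")
      case True
      have "\<bar>t\<bar> powr (p - 1) * (1 / (1 + \<bar>t\<bar> ^ (n + 1))) \<le> \<bar>t\<bar> powr (p - 1) * 1"
        by (intro mult_left_mono) (auto simp: field_simps add_pos_nonneg)
      with True show ?thesis by (cases "t = 0") (auto simp: abs_mult intro!: add_increasing2)
    next
      case False
      have "\<bar>t\<bar> powr (p - 1) \<le> \<bar>t\<bar> powr (real n - 1)" using False p by (intro powr_mono) auto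
      then have "\<bar>t\<bar> powr (p - 1) * \<bar>t\<bar> powr 2 \<le> \<bar>t\<bar> powr (real n - 1) * \<bar>t\<bar> powr 2" by (intro mult_right_mono) auto
      also have "\<dots> = \<bar>t\<bar> powr real (n + 1)" unfolding powr_add[symmetric] by simp
      also have "\<dots> = \<bar>t\<bar> ^ (n + 1)" using False by (intro powr_realpow) auto
      finally have 1: "\<bar>t\<bar> powr (p - 1) * t\<^sup>2 \<le> \<bar>t\<bar> ^ (n + 1)" using False by (simp add: powr_numeral)
      have "1 \<le> t\<^sup>2" using power_mono[of 1 "\<bar>t\<bar>" 2] False by simp
      then have "\<bar>t\<bar> powr (p - 1) * (1 + t\<^sup>2) \<le> \<bar>t\<bar> powr (p - 1) * (2 * t\<^sup>2)" by (intro mult_left_mono) auto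
      also have "\<dots> \<le> 2 * (1 + \<bar>t\<bar> ^ (n + 1))" using 1 by simp
      finally have 2: "\<bar>t\<bar> powr (p - 1) * (1 + t\<^sup>2) \<le> 2 * (1 + \<bar>t\<bar> ^ (n + 1))" .
      have pos: "0 < 1 + t\<^sup>2" "0 < 1 + \<bar>t\<bar> ^ (n + 1)" by (auto simp: add_pos_nonneg)
      have "x * (1 / b) \<le> 2 * (1 / a)" if "x * a \<le> 2 * b" "0 < a" "0 < b" for x a b :: real
        using that by (simp add: field_simps)
      from this[OF 2 pos] have "\<bar>t\<bar> powr (p - 1) * (1 / (1 + \<bar>t\<bar> ^ (n + 1))) \<le> 2 * (1 / (1 + t\<^sup>2))" .
      with False show ?thesis by (simp add: abs_mult)
    qed
    then show "AE t in lborel. norm (\<bar>t\<bar> powr (p - 1) * (1 / (1 + \<bar>t\<bar> ^ (n + 1)))) \<le> norm (?g t)"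
      by (intro AE_I2) (auto intro: order_trans[OF _ abs_ge_self])
  qed auto
qed

text \<open>Exactly the decay that the embedding formula needs.  The formula can then be applied to an
  autocorrelation without showing that the Schwartz space is closed under convolution.\<close>

definition admissible :: "(real ^ 'n::finite \<Rightarrow> complex) \<Rightarrow> bool" where
  "admissible \<phi> \<longleftrightarrow> \<phi> \<in> borel_measurable borel \<and> (\<exists>A. \<forall>x. norm (\<phi> x) \<le> A * weight x) \<and>
     (\<exists>B. \<forall>\<xi>. norm (fourier \<phi> \<xi>) \<le> B * (1 / (1 + norm \<xi> ^ (CARD('n) + 1))))"

lemma admissible_schwartz:
  fixes \<phi> :: "real ^ 'n::finite \<Rightarrow> complex"
  assumes "\<phi> \<in> schwartz" shows "admissible \<phi>"
proof -
  obtain A where "\<And>x. norm (\<phi> x) \<le> A * weight x" using schwartz_le_weight[OF assms] by blast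
  moreover obtain B where "\<And>\<xi>. (1 + norm \<xi> ^ (CARD('n) + 1)) * norm (fourier \<phi> \<xi>) \<le> B"
    using schwartz_fourier_decay[OF assms] by blast
  then have "norm (fourier \<phi> \<xi>) \<le> B * (1 / (1 + norm \<xi> ^ (CARD('n) + 1)))" for \<xi>
    by (simp add: field_simps add_pos_nonneg)
  ultimately show ?thesis
    unfolding admissible_def using schwartz_borel_measurable[OF assms] by blast
qed

text \<open>The transform is the squared modulus of the transform of \<phi>. Bounding one factor by
  the integral of |\<phi>| leaves the decay of the other.\<close>

lemma admissible_autocorrelation:
  fixes \<phi> :: "real ^ 'n::finite \<Rightarrow> complex"
  assumes "\<phi> \<in> schwartz" shows "admissible (autocorrelation \<phi>)"
proof -
  have m: "\<phi> \<in> borel_measurable borel" by (rule schwartz_borel_measurable[OF assms])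
  obtain C where "\<And>x. norm (\<phi> x) \<le> C * (weight x)\<^sup>2" using schwartz_le_weight_sq[OF assms] by blast
  note A = autocorrelation_le_weight[OF m this]
  obtain B where B: "\<And>\<xi>. norm (fourier \<phi> \<xi>) \<le> B * (1 / (1 + norm \<xi> ^ (CARD('n) + 1)))"
    using admissible_schwartz[OF assms] unfolding admissible_def by blast
  let ?I = "LBINT x. norm (\<phi> x)"
  have "norm (fourier (autocorrelation \<phi>) \<xi>) \<le> (?I * B) * (1 / (1 + norm \<xi> ^ (CARD('n) + 1)))" for \<xi>
  proof -
    have "norm (fourier (autocorrelation \<phi>) \<xi>) = norm (fourier \<phi> \<xi>) * norm (fourier \<phi> \<xi>)"
      by (simp add: fourier_autocorrelation[OF schwartz_integrable[OF assms]] power2_eq_square norm_mult)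
    also have "\<dots> \<le> ?I * (B * (1 / (1 + norm \<xi> ^ (CARD('n) + 1))))"
      by (intro mult_mono norm_fourier_le B) auto
    finally show ?thesis by (simp add: mult_ac)
  qed
  with A borel_measurable_autocorrelation[OF m] show ?thesis
    unfolding admissible_def by blast
qed

text \<open>The inner integral of the embedding formula, extended from the sphere to the whole
  space. It is homogeneous of degree -p, so its values on the sphere determine it away from
  0.\<close>

definition radial_ft :: "real \<Rightarrow> (real ^ 'n::finite \<Rightarrow> complex) \<Rightarrow> real ^ 'n \<Rightarrow> complex" where
  "radial_ft p \<phi> y = (LBINT t. complex_of_real (\<bar>t\<bar> powr (p - 1)) * fourier \<phi> (t *\<^sub>R y))"

lemma borel_measurable_radial_ft [measurable (raw)]:
  assumes [measurable]: "\<phi> \<in> borel_measurable borel"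
  shows "radial_ft p \<phi> \<in> borel_measurable borel"
proof -
  have [measurable]: "fourier \<phi> \<in> borel_measurable borel" by (rule borel_measurable_fourier) (rule assms)
  show ?thesis unfolding radial_ft_def[abs_def] by measurable
qed

lemma radial_ft_scaleR:
  assumes c: "c \<noteq> 0"
  shows "radial_ft p \<phi> (c *\<^sub>R y) = complex_of_real (\<bar>c\<bar> powr (- p)) * radial_ft p \<phi> y"
proof -
  let ?f = "\<lambda>t. complex_of_real (\<bar>t\<bar> powr (p - 1)) * fourier \<phi> (t *\<^sub>R y)"
  have c': "0 < \<bar>c\<bar>" using c by simp
  have "radial_ft p \<phi> y = \<bar>c\<bar> *\<^sub>R (LBINT t. ?f (0 + c * t))"
    unfolding radial_ft_def by (rule lborel_integral_real_affine[OF c])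
  also have "(\<lambda>t. ?f (0 + c * t)) = (\<lambda>t. complex_of_real (\<bar>c\<bar> powr (p - 1)) *
      (complex_of_real (\<bar>t\<bar> powr (p - 1)) * fourier \<phi> (t *\<^sub>R (c *\<^sub>R y))))"
    by (auto simp: abs_mult powr_mult mult_ac)
  also have "\<bar>c\<bar> *\<^sub>R (LBINT t. complex_of_real (\<bar>c\<bar> powr (p - 1)) *
      (complex_of_real (\<bar>t\<bar> powr (p - 1)) * fourier \<phi> (t *\<^sub>R (c *\<^sub>R y)))) =
      complex_of_real (\<bar>c\<bar> * \<bar>c\<bar> powr (p - 1)) * radial_ft p \<phi> (c *\<^sub>R y)"
    by (simp add: radial_ft_def scaleR_conv_of_real)
  also have "\<bar>c\<bar> * \<bar>c\<bar> powr (p - 1) = \<bar>c\<bar> powr p"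
    using c' by (simp add: powr_diff)
  finally show ?thesis using c' by (simp add: powr_minus)
qed

lemma AE_norm_pos: "AE x in (lborel :: 'a::euclidean_space measure). 0 < norm x"
  using AE_lborel_singleton[of "0::'a"] by simp

lemma integral_powr_gexp_pos:
  assumes p: "0 < p" and q: "0 < q"
  shows "0 < (LBINT t. \<bar>t\<bar> powr (p - 1) * gexp q t)"
proof -
  have "AE t in lborel. 0 < \<bar>t\<bar> powr (p - 1) * gexp q t"
    using AE_lborel_singleton[of "0::real"] by eventually_elim (simp add: gexp_pos)
  then show ?thesis using assms by (intro integral_pos_AE integrable_powr_gexp) auto
qed

lemma lq_norm_pos:
  assumes "0 < q" "x $ k \<noteq> 0" shows "0 < lq_norm q x"
  using lq_norm_ge_component[OF assms(1), of x k] assms(2) by linarith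

lemma integrable_lq_norm_powr_mult:
  fixes \<phi> :: "real ^ 'n::finite \<Rightarrow> 'b::{real_normed_field,banach,second_countable_topology}"
  assumes q: "0 < q" and p: "0 \<le> p" "p < real CARD('n)"
    and [measurable]: "\<phi> \<in> borel_measurable borel" and A: "\<And>x. norm (\<phi> x) \<le> A * weight x"
  shows "integrable lborel (\<lambda>x. of_real (lq_norm q x powr (- p)) * \<phi> x)"
proof -
  have "integrable lborel (\<lambda>x::real^'n. lq_norm q x powr (- p) * weight x)"
    using p q by (intro integrable_powr_neg_weight[of UNIV]) (auto simp: lq_norm_ge_component)
  from integrable_mult_right[OF this, of A] show ?thesis
  proof (rule Bochner_Integration.integrable_bound)
    show "AE x in lborel. norm (of_real (lq_norm q x powr (- p)) * \<phi> x) \<le> norm (A * (lq_norm q x powr (- p) * weight x))"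
    proof (rule AE_I2)
      fix x
      have "lq_norm q x powr (- p) * norm (\<phi> x) \<le> lq_norm q x powr (- p) * (A * weight x)"
        by (intro mult_left_mono A) auto
      also have "\<dots> \<le> norm (A * (lq_norm q x powr (- p) * weight x))" by (simp add: mult_ac)
      finally show "norm (of_real (lq_norm q x powr (- p)) * \<phi> x) \<le> norm (A * (lq_norm q x powr (- p) * weight x))"
        by (simp add: norm_mult)
    qed
  qed measurable
qed

text \<open>Both sides equal the integral of \<open>\<bar>t\<bar> powr (p - 1)\<close> against the pairing of \<open>\<phi>\<close> with
  \<open>exp (- (\<bar>t\<bar> * lq_norm q x) powr q)\<close>.\<close>

lemma
  fixes \<phi> :: "real ^ 'n::finite \<Rightarrow> complex"
  assumes q: "2 < q" and p: "0 < p" "p < real CARD('n)" and \<phi>: "admissible \<phi>"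
  shows integrable_gexp_ft_prod_radial_ft: "integrable lborel (\<lambda>y. complex_of_real (gexp_ft_prod q y) * radial_ft p \<phi> y)"
    and lq_norm_powr_pairing:
      "complex_of_real ((2 * pi) ^ CARD('n) * (LBINT t. \<bar>t\<bar> powr (p - 1) * gexp q t)) *
        (LBINT x. complex_of_real (lq_norm q x powr (- p)) * \<phi> x) =
       (LBINT y. complex_of_real (gexp_ft_prod q y) * radial_ft p \<phi> y)"
proof -
  let ?c = "LBINT t. \<bar>t\<bar> powr (p - 1) * gexp q t"
  let ?N = "lq_norm q :: real^'n \<Rightarrow> real"
  from \<phi> obtain A B where m [measurable]: "\<phi> \<in> borel_measurable borel"
    and A: "\<And>x. norm (\<phi> x) \<le> A * weight x"
    and B: "\<And>\<xi>. norm (fourier \<phi> \<xi>) \<le> B * (1 / (1 + norm \<xi> ^ (CARD('n) + 1)))"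
    unfolding admissible_def by blast
  have q0: "0 < q" using q by simp
  have fm [measurable]: "fourier \<phi> \<in> borel_measurable borel" by (rule borel_measurable_fourier) measurable
  have \<phi>i: "integrable lborel \<phi>" by (rule integrable_le_weight[OF m A])
  have N\<phi>: "integrable lborel (\<lambda>x. complex_of_real (?N x powr (- p)) * \<phi> x)"
    using p by (intro integrable_lq_norm_powr_mult[OF q0 _ _ m A]) auto
  have ci: "integrable lborel (\<lambda>t. \<bar>t\<bar> powr (p - 1) * gexp q t)"
    using p q0 by (intro integrable_powr_gexp) auto
  \<comment> \<open>A nonzero coordinate makes the norm positive; this is what
    \<open>radial_scale\<close> requires of the dilation factor.\<close>
  have Npos: "AE x in lborel. 0 < ?N x"
    using AE_vec_nonzero by eventually_elim (auto intro: lq_norm_pos[OF q0])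
  let ?h = "\<lambda>(x, t). complex_of_real (\<bar>t\<bar> powr (p - 1) * gexp q (t * ?N x)) * \<phi> x"
  have h: "integrable (lborel \<Otimes>\<^sub>M lborel) ?h"
  proof (rule lborel_pair.Fubini_integrable)
    have "AE x in lborel. norm (complex_of_real (?N x powr (- p)) * \<phi> x) * ?c = (LBINT t. norm (?h (x, t)))"
      using Npos
    proof eventually_elim
      case (elim x)
      have "(LBINT t. norm (?h (x, t))) = (LBINT t. \<bar>t\<bar> powr (p - 1) * gexp q (t * ?N x) * norm (\<phi> x))"
        by (simp add: norm_mult abs_mult less_imp_le[OF gexp_pos] abs_of_pos[OF gexp_pos])
      also have "\<dots> = (LBINT t. \<bar>t\<bar> powr (p - 1) * gexp q (t * ?N x)) * norm (\<phi> x)"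
        by (rule integral_mult_left_zero)
      finally have e: "(LBINT t. norm (?h (x, t))) = (LBINT t. \<bar>t\<bar> powr (p - 1) * gexp q (t * ?N x)) * norm (\<phi> x)" .
      show ?case unfolding e radial_scale(2)[OF ci elim] by (simp add: norm_mult)
    qed
    then show "integrable lborel (\<lambda>x. LBINT t. norm (?h (x, t)))"
      by (rule integrable_cong_AE_imp[rotated 2]) (use N\<phi> in \<open>auto intro!: integrable_mult_left integrable_norm\<close>)
    show "AE x in lborel. integrable lborel (\<lambda>t. ?h (x, t))"
      using Npos
    proof eventually_elim
      case (elim x)
      then show ?case using radial_scale(1)[OF ci elim]
        by (simp only: prod.case) (intro integrable_mult_left integrable_of_real)
    qed
  qed measurable
  have "complex_of_real ?c * (LBINT x. complex_of_real (?N x powr (- p)) * \<phi> x) = (LBINT x. (LBINT t. ?h (x, t)))"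
  proof -
    have "AE x in lborel. complex_of_real ?c * (complex_of_real (?N x powr (- p)) * \<phi> x) = (LBINT t. ?h (x, t))"
      using Npos
    proof eventually_elim
      case (elim x)
      have "(LBINT t. ?h (x, t)) = (LBINT t. complex_of_real (\<bar>t\<bar> powr (p - 1) * gexp q (t * ?N x))) * \<phi> x"
        unfolding prod.case by (rule integral_mult_left_zero)
      also have "(LBINT t. complex_of_real (\<bar>t\<bar> powr (p - 1) * gexp q (t * ?N x))) = complex_of_real (?N x powr (- p) * ?c)"
        unfolding radial_scale(2)[OF ci elim, symmetric] by (rule integral_complex_of_real)
      finally have e: "(LBINT t. ?h (x, t)) = complex_of_real (?N x powr (- p) * ?c) * \<phi> x" .
      show ?case unfolding e by (simp add: mult_ac)
    qed
    then have "(LBINT x. complex_of_real ?c * (complex_of_real (?N x powr (- p)) * \<phi> x)) = (LBINT x. (LBINT t. ?h (x, t)))"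
      by (intro integral_cong_AE) measurable
    then show ?thesis by (simp only: integral_mult_right_zero)
  qed
  also have "\<dots> = (LBINT t. (LBINT x. ?h (x, t)))"
    using lborel_pair.Fubini_integral[of "\<lambda>x t. ?h (x, t)"] h by simp
  finally have 1: "complex_of_real ?c * (LBINT x. complex_of_real (?N x powr (- p)) * \<phi> x) = (LBINT t. (LBINT x. ?h (x, t)))" .

  let ?g = "\<lambda>(y, t). complex_of_real (gexp_ft_prod q y) * (complex_of_real (\<bar>t\<bar> powr (p - 1)) * fourier \<phi> (t *\<^sub>R y))"
  let ?w = "\<lambda>t::real. B * (1 / (1 + \<bar>t\<bar> ^ (CARD('n) + 1)))"
  have wi: "integrable lborel (\<lambda>t. \<bar>t\<bar> powr (p - 1) * ?w t)"
    using integrable_mult_right[OF integrable_powr_rational[OF p], of B] by (simp add: mult_ac)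
  have B0: "0 \<le> B" using order_trans[OF norm_ge_zero B[of 0]] by simp
  let ?c1 = "LBINT t. \<bar>t\<bar> powr (p - 1) * ?w t"
  \<comment> \<open>The decay of \<open>fourier \<phi>\<close> supplies an integrable majorant that
    depends on y only through its norm. Integrating it over t gives a multiple of
    \<open>norm y powr (- p)\<close>, which \<open>integrable_gexp_ft_prod_norm_powr\<close>
    handles.\<close>
  let ?d = "\<lambda>(y::real^'n, t). \<bar>gexp_ft_prod q y\<bar> * (\<bar>t\<bar> powr (p - 1) * ?w (t * norm y))"
  have d: "integrable (lborel \<Otimes>\<^sub>M lborel) ?d"
  proof (rule lborel_pair.Fubini_integrable)
    have "AE y in lborel. norm (gexp_ft_prod q y * norm y powr (- p)) * ?c1 = (LBINT t. norm (?d (y, t)))"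
      using AE_norm_pos
    proof eventually_elim
      case (elim y)
      have nn: "0 \<le> \<bar>t\<bar> powr (p - 1) * ?w (t * norm y)" for t
        using B0 by (intro mult_nonneg_nonneg) auto
      have "(LBINT t. norm (?d (y, t))) = (LBINT t. \<bar>gexp_ft_prod q y\<bar> * (\<bar>t\<bar> powr (p - 1) * ?w (t * norm y)))"
        unfolding prod.case real_norm_def abs_mult[of "\<bar>gexp_ft_prod q y\<bar>"] abs_abs abs_of_nonneg[OF nn] ..
      also have "\<dots> = \<bar>gexp_ft_prod q y\<bar> * (norm y powr (- p) * ?c1)"
        unfolding radial_scale(2)[OF wi elim, symmetric] by (rule integral_mult_right_zero)
      finally show ?case by (simp add: abs_mult)
    qed
    then show "integrable lborel (\<lambda>y. LBINT t. norm (?d (y, t)))"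
      by (rule integrable_cong_AE_imp[rotated 2])
         (use integrable_gexp_ft_prod_norm_powr[OF q _ p(2)] p in \<open>auto intro!: integrable_mult_left integrable_norm\<close>)
    show "AE y in lborel. integrable lborel (\<lambda>t. ?d (y, t))"
      using AE_norm_pos
    proof eventually_elim
      case (elim y)
      then show ?case using radial_scale(1)[OF wi elim]
        by (simp only: prod.case) (rule integrable_mult_right)
    qed
  qed measurable
  have g: "integrable (lborel \<Otimes>\<^sub>M lborel) ?g"
  proof (rule Bochner_Integration.integrable_bound[OF d])
    have le: "norm (?g (y, t)) \<le> ?d (y, t)" for y t
    proof -
      have "norm (?g (y, t)) = \<bar>gexp_ft_prod q y\<bar> * (\<bar>t\<bar> powr (p - 1) * norm (fourier \<phi> (t *\<^sub>R y)))"
        by (simp add: norm_mult)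
      also have "\<dots> \<le> \<bar>gexp_ft_prod q y\<bar> * (\<bar>t\<bar> powr (p - 1) * ?w (t * norm y))"
        using B[of "t *\<^sub>R y"] by (intro mult_left_mono) (auto simp: abs_mult)
      finally show ?thesis by simp
    qed
    show "AE yt in lborel \<Otimes>\<^sub>M lborel. norm (?g yt) \<le> norm (?d yt)"
    proof (rule AE_I2)
      fix yt :: "(real^'n) \<times> real"
      obtain y t where yt: "yt = (y, t)" by (cases yt)
      show "norm (?g yt) \<le> norm (?d yt)"
        unfolding yt real_norm_def by (rule order_trans[OF le abs_ge_self])
    qed
  qed measurable
  have radial_ft_eq: "(LBINT t. ?g (y, t)) = complex_of_real (gexp_ft_prod q y) * radial_ft p \<phi> y" for y
    unfolding prod.case radial_ft_def by (rule integral_mult_right_zero)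
  show "integrable lborel (\<lambda>y. complex_of_real (gexp_ft_prod q y) * radial_ft p \<phi> y)"
    using lborel_pair.integrable_fst'[OF g] unfolding radial_ft_eq .
  have "complex_of_real ((2 * pi) ^ CARD('n)) * (LBINT t. (LBINT x. ?h (x, t))) = (LBINT t. (LBINT y. ?g (y, t)))"
  proof -
    have "complex_of_real ((2 * pi) ^ CARD('n)) * (LBINT x. ?h (x, t)) = (LBINT y. ?g (y, t))" for t
    proof -
      have "(LBINT x. ?h (x, t)) = (LBINT x. complex_of_real (\<bar>t\<bar> powr (p - 1)) * (complex_of_real (gexp q (t * ?N x)) * \<phi> x))"
        by (intro Bochner_Integration.integral_cong[OF refl]) simp
      also have "\<dots> = complex_of_real (\<bar>t\<bar> powr (p - 1)) * (LBINT x. complex_of_real (gexp q (t * ?N x)) * \<phi> x)"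
        by (rule integral_mult_right_zero)
      finally have "complex_of_real ((2 * pi) ^ CARD('n)) * (LBINT x. ?h (x, t)) =
          complex_of_real (\<bar>t\<bar> powr (p - 1)) * ((2 * pi) ^ CARD('n) * (LBINT x. complex_of_real (gexp q (t * ?N x)) * \<phi> x))"
        by simp
      also have "\<dots> = complex_of_real (\<bar>t\<bar> powr (p - 1)) * (LBINT y. complex_of_real (gexp_ft_prod q y) * fourier \<phi> (t *\<^sub>R y))"
        by (simp only: integral_gexp_lq_norm_mult[OF q \<phi>i])
      also have "\<dots> = (LBINT y. complex_of_real (\<bar>t\<bar> powr (p - 1)) * (complex_of_real (gexp_ft_prod q y) * fourier \<phi> (t *\<^sub>R y)))"
        by (rule integral_mult_right_zero[symmetric])
      also have "\<dots> = (LBINT y. ?g (y, t))"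
        by (intro Bochner_Integration.integral_cong[OF refl]) simp
      finally show ?thesis .
    qed
    then show ?thesis by (simp only: integral_mult_right_zero[symmetric])
  qed
  also have "\<dots> = (LBINT y. (LBINT t. ?g (y, t)))"
    using lborel_pair.Fubini_integral[of "\<lambda>y t. ?g (y, t)"] g by simp
  finally show "complex_of_real ((2 * pi) ^ CARD('n) * ?c) * (LBINT x. complex_of_real (?N x powr (- p)) * \<phi> x) =
       (LBINT y. complex_of_real (gexp_ft_prod q y) * radial_ft p \<phi> y)"
    unfolding radial_ft_eq 1[symmetric] by (simp only: of_real_mult mult.assoc)
qed

section \<open>Averaging over rays\<close>

text \<open>The scale invariance of \<open>1 / \<bar>s\<bar>\<close> moves an integral against a homogeneous function to an
  annulus; this replaces polar coordinates and a surface measure on the sphere.\<close>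

definition annulus :: "real ^ 'n::finite \<Rightarrow> real" where
  "annulus z = (if 1 \<le> norm z \<and> norm z \<le> 2 then 1 else 0)"

lemma borel_measurable_annulus [measurable]: "annulus \<in> borel_measurable borel"
  unfolding annulus_def[abs_def] by measurable

text \<open>The exponent collects n from the Jacobian of y = s z, -p from homogeneity and -1 from
  the invariant measure ds / |s|. The sign of this moment is what decides the positive range of
  p.\<close>

definition ray_mean :: "real \<Rightarrow> (real ^ 'n::finite \<Rightarrow> real) \<Rightarrow> real ^ 'n \<Rightarrow> real" where
  "ray_mean p h z = (LBINT s. \<bar>s\<bar> powr (real CARD('n) - p - 1) * h (s *\<^sub>R z))"

text \<open>The trace of the annulus on a ray: when y = s z with s nonzero,
  \<open>window (s * (1 / norm y))\<close> equals \<open>annulus z\<close>.\<close>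

definition window :: "real \<Rightarrow> real" where
  "window s = (if 1 / 2 \<le> \<bar>s\<bar> \<and> \<bar>s\<bar> \<le> 1 then 1 else 0)"

lemma borel_measurable_window [measurable]: "window \<in> borel_measurable borel"
  unfolding window_def[abs_def] by measurable

text \<open>The exponent is left as \<open>0 - 1\<close> so that \<open>radial_scale\<close> applies
  with its parameter equal to 0.\<close>

lemma integrable_window: "integrable lborel (\<lambda>s. \<bar>s\<bar> powr (0 - 1) * window s)"
proof (rule Bochner_Integration.integrable_bound)
  show "integrable lborel (\<lambda>s::real. 2 * indicator {-1..1} s :: real)" by simp
  show "AE s in lborel. norm (\<bar>s\<bar> powr (0 - 1) * window s) \<le> norm (2 * indicator {-1..1} s :: real)"
    by (auto simp: window_def powr_minus powr_one field_simps indicator_def abs_mult)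
qed auto

lemma integral_window_pos: "0 < (LBINT s. \<bar>s\<bar> powr (0 - 1) * window s)"
proof -
  have "(1/2::real) = (LBINT s. indicator {1/2..1::real} s)" by simp
  also have "\<dots> \<le> (LBINT s. \<bar>s\<bar> powr (0 - 1) * window s)"
  proof (rule Bochner_Integration.integral_mono[OF _ integrable_window])
    have "emeasure lborel {1/2..1::real} < \<infinity>" by (rule emeasure_bounded_finite) simp
    then show "integrable lborel (indicator {1/2..1::real} :: real \<Rightarrow> real)"
      by (intro integrable_real_indicator) auto
  qed (auto simp: window_def powr_minus powr_one field_simps indicator_def)
  finally show ?thesis by simp
qed

text \<open>Multiply \<open>h y * G y\<close> by window(s / |y|) / |s|, whose integral over s is the
  same constant for every nonzero y. Substituting y = s z and using homogeneity turns the window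
  into the annulus in z and leaves \<open>ray_mean p h z\<close> as the integral over s.\<close>

lemma
  fixes h :: "real ^ 'n::finite \<Rightarrow> real" and G :: "real ^ 'n \<Rightarrow> complex"
  assumes [measurable]: "h \<in> borel_measurable borel" "G \<in> borel_measurable borel"
    and hom: "\<And>c y. c \<noteq> 0 \<Longrightarrow> G (c *\<^sub>R y) = complex_of_real (\<bar>c\<bar> powr (- p)) * G y"
    and int: "integrable lborel (\<lambda>y. complex_of_real (h y) * G y)"
  shows ray_mean_AE_integrable: "AE z in lborel. integrable lborel
      (\<lambda>s. complex_of_real (\<bar>s\<bar> powr (real CARD('n) - p - 1) * h (s *\<^sub>R z)) * (complex_of_real (annulus z) * G z))"
    and integrable_ray_mean: "integrable lborel (\<lambda>z. complex_of_real (annulus z * ray_mean p h z) * G z)"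
    and integral_ray_mean: "(LBINT z. complex_of_real (annulus z * ray_mean p h z) * G z) =
      complex_of_real (LBINT s. \<bar>s\<bar> powr (0 - 1) * window s) * (LBINT y. complex_of_real (h y) * G y)"
proof -
  let ?c = "LBINT s. \<bar>s\<bar> powr (0 - 1) * window s"
  let ?K = "\<lambda>(y, s). complex_of_real (\<bar>s\<bar> powr (0 - 1) * window (s * (1 / norm y))) * (complex_of_real (h y) * G y)"
  let ?L = "\<lambda>(s, z). complex_of_real (\<bar>s\<bar> powr (real CARD('n) - p - 1) * h (s *\<^sub>R z)) * (complex_of_real (annulus z) * G z)"
  have w0: "0 \<le> window s" for s by (simp add: window_def)
  have scale: "(LBINT s. \<bar>s\<bar> powr (0 - 1) * window (s * (1 / norm y))) = ?c"
      "integrable lborel (\<lambda>s. \<bar>s\<bar> powr (0 - 1) * window (s * (1 / norm y)))" if "0 < norm y" for y :: "real^'n"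
    using radial_scale[OF integrable_window, of "1 / norm y"] that by (auto simp: powr_zero_eq_one)
  have K: "integrable (lborel \<Otimes>\<^sub>M lborel) ?K"
  proof (rule lborel_pair.Fubini_integrable)
    have "AE y in lborel. norm (complex_of_real (h y) * G y) * ?c = (LBINT s. norm (?K (y, s)))"
      using AE_norm_pos
    proof eventually_elim
      case (elim y)
      have "(LBINT s. norm (?K (y, s))) = (LBINT s. \<bar>s\<bar> powr (0 - 1) * window (s * (1 / norm y)) * norm (complex_of_real (h y) * G y))"
        unfolding prod.case norm_mult[of "complex_of_real (_ * _)"] norm_of_real
        by (simp only: abs_of_nonneg[OF mult_nonneg_nonneg[OF powr_ge_zero w0]])
      also have "\<dots> = ?c * norm (complex_of_real (h y) * G y)"
        unfolding scale(1)[OF elim, symmetric] by (rule integral_mult_left_zero)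
      finally show ?case by simp
    qed
    then show "integrable lborel (\<lambda>y. LBINT s. norm (?K (y, s)))"
      by (rule integrable_cong_AE_imp[rotated 2]) (use int in \<open>auto intro!: integrable_mult_left integrable_norm\<close>)
    show "AE y in lborel. integrable lborel (\<lambda>s. ?K (y, s))"
      using AE_norm_pos
    proof eventually_elim
      case (elim y)
      from scale(2)[OF elim] show ?case
        by (simp only: prod.case) (intro integrable_mult_left integrable_of_real)
    qed
  qed measurable
  have KL: "\<bar>s\<bar> ^ CARD('n) *\<^sub>R ?K (0 + s *\<^sub>R z, s) = ?L (s, z)" if s: "s \<noteq> 0" for s z
  proof -
    have w: "window (s * (1 / norm (s *\<^sub>R z))) = annulus z"
      using s by (cases "z = 0") (auto simp: window_def annulus_def field_simps)
    have "\<bar>s\<bar> ^ CARD('n) * \<bar>s\<bar> powr (0 - 1) * \<bar>s\<bar> powr (- p) = \<bar>s\<bar> powr (real CARD('n) + (0 - 1) + (- p))"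
    proof -
      have "\<bar>s\<bar> ^ CARD('n) = \<bar>s\<bar> powr real CARD('n)" using s by (simp add: powr_realpow)
      then show ?thesis by (simp only: powr_add)
    qed
    also have "real CARD('n) + (0 - 1) + (- p) = real CARD('n) - p - 1" by simp
    finally have "\<bar>s\<bar> ^ CARD('n) * \<bar>s\<bar> powr (0 - 1) * \<bar>s\<bar> powr (- p) = \<bar>s\<bar> powr (real CARD('n) - p - 1)" .
    then have "complex_of_real (\<bar>s\<bar> ^ CARD('n)) * complex_of_real (\<bar>s\<bar> powr (0 - 1)) * complex_of_real (\<bar>s\<bar> powr (- p)) = complex_of_real (\<bar>s\<bar> powr (real CARD('n) - p - 1))"
      by (simp only: of_real_mult[symmetric])
    then show ?thesis
      by (simp only: prod.case w add_0 hom[OF s] scaleR_conv_of_real[where 'a = complex] of_real_mult) (simp only: mult_ac)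
  qed
  have KLint: "(LBINT y. ?K (y, s)) = (LBINT z. ?L (s, z))" if s: "s \<noteq> 0" for s
    using integral_lborel_affine[of "\<lambda>y. ?K (y, s)" s 0] s unfolding KL[OF s, symmetric] by simp
  have KLnorm: "(LBINT y. norm (?K (y, s))) = (LBINT z. norm (?L (s, z)))" if s: "s \<noteq> 0" for s
    using integral_lborel_affine[of "\<lambda>y. norm (?K (y, s))" s 0] s unfolding KL[OF s, symmetric]
    by (simp add: split_beta')
  have s0: "AE s in lborel. s \<noteq> (0::real)" by (rule AE_lborel_singleton)
  \<comment> \<open>Joint integrability is carried over from \<open>?K\<close> by the substitution
    for each nonzero s, in the norms as well as in the sections; s = 0 is a null set.\<close>
  have L: "integrable (lborel \<Otimes>\<^sub>M lborel) ?L"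
  proof (rule lborel_pair.Fubini_integrable)
    have "integrable (lborel \<Otimes>\<^sub>M lborel) (\<lambda>(y, s). norm (?K (y, s)))"
      using integrable_norm[OF K] by (simp add: split_beta')
    from lborel_pair.integrable_snd[OF this]
    have "integrable lborel (\<lambda>s. LBINT y. norm (?K (y, s)))" .
    then show "integrable lborel (\<lambda>s. LBINT z. norm (?L (s, z)))"
    proof (rule integrable_cong_AE_imp)
      show "AE s in lborel. (LBINT y. norm (?K (y, s))) = (LBINT z. norm (?L (s, z)))"
        using s0 by eventually_elim (rule KLnorm)
    qed measurable
    have "integrable (lborel \<Otimes>\<^sub>M lborel) (\<lambda>(y, s). ?K (y, s))" using K by (simp add: split_beta')
    from lborel_pair.AE_integrable_snd[OF this] s0
    show "AE s in lborel. integrable lborel (\<lambda>z. ?L (s, z))"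
    proof eventually_elim
      case (elim s)
      have "(\<lambda>y. ?K (y, s)) \<in> borel_measurable borel" unfolding prod.case by measurable
      from integrable_lborel_affine[OF this, of s 0] elim
      have "integrable lborel (\<lambda>z. ?K (0 + s *\<^sub>R z, s))" by simp
      then have "integrable lborel (\<lambda>z. \<bar>s\<bar> ^ CARD('n) *\<^sub>R ?K (0 + s *\<^sub>R z, s))" by (rule integrable_scaleR_right)
      then show ?case unfolding KL[OF elim(2)] .
    qed
  qed measurable
  have L': "integrable (lborel \<Otimes>\<^sub>M lborel) (\<lambda>(s, z). ?L (s, z))" using L by (simp add: split_beta')
  have Leq: "(LBINT s. ?L (s, z)) = complex_of_real (annulus z * ray_mean p h z) * G z" for z
  proof -
    have "(LBINT s. ?L (s, z)) = (LBINT s. complex_of_real (\<bar>s\<bar> powr (real CARD('n) - p - 1) * h (s *\<^sub>R z))) * (complex_of_real (annulus z) * G z)"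
      unfolding prod.case by (rule integral_mult_left_zero)
    also have "(LBINT s. complex_of_real (\<bar>s\<bar> powr (real CARD('n) - p - 1) * h (s *\<^sub>R z))) = complex_of_real (ray_mean p h z)"
      unfolding ray_mean_def by (rule integral_complex_of_real)
    finally show ?thesis by (simp add: mult_ac)
  qed
  show "AE z in lborel. integrable lborel (\<lambda>s. complex_of_real (\<bar>s\<bar> powr (real CARD('n) - p - 1) * h (s *\<^sub>R z)) * (complex_of_real (annulus z) * G z))"
    using lborel_pair.AE_integrable_snd[OF L'] by simp
  show "integrable lborel (\<lambda>z. complex_of_real (annulus z * ray_mean p h z) * G z)"
    using lborel_pair.integrable_snd[OF L'] unfolding Leq .
  have "(LBINT z. complex_of_real (annulus z * ray_mean p h z) * G z) = (LBINT z. (LBINT s. ?L (s, z)))"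
    by (simp only: Leq)
  also have "\<dots> = (LBINT s. (LBINT z. ?L (s, z)))"
    by (rule lborel_pair.Fubini_integral[OF L'])
  also have "\<dots> = (LBINT s. (LBINT y. ?K (y, s)))"
  proof (rule integral_cong_AE)
    show "AE s in lborel. (LBINT z. ?L (s, z)) = (LBINT y. ?K (y, s))"
      using s0 by eventually_elim (rule KLint[symmetric])
  qed measurable
  also have "\<dots> = (LBINT y. (LBINT s. ?K (y, s)))"
    using lborel_pair.Fubini_integral[of "\<lambda>y s. ?K (y, s)"] K by simp
  also have "\<dots> = (LBINT y. complex_of_real ?c * (complex_of_real (h y) * G y))"
  proof (rule integral_cong_AE)
    show "AE y in lborel. (LBINT s. ?K (y, s)) = complex_of_real ?c * (complex_of_real (h y) * G y)"
      using AE_norm_pos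
    proof eventually_elim
      case (elim y)
      have "(LBINT s. ?K (y, s)) = (LBINT s. complex_of_real (\<bar>s\<bar> powr (0 - 1) * window (s * (1 / norm y)))) * (complex_of_real (h y) * G y)"
        unfolding prod.case by (rule integral_mult_left_zero)
      also have "(LBINT s. complex_of_real (\<bar>s\<bar> powr (0 - 1) * window (s * (1 / norm y)))) = complex_of_real ?c"
        unfolding scale(1)[OF elim, symmetric] by (rule integral_complex_of_real)
      finally show ?case .
    qed
  qed measurable
  also have "\<dots> = complex_of_real ?c * (LBINT y. complex_of_real (h y) * G y)"
    by (rule integral_mult_right_zero)
  finally show "(LBINT z. complex_of_real (annulus z * ray_mean p h z) * G z) =
      complex_of_real ?c * (LBINT y. complex_of_real (h y) * G y)" .
qed

section \<open>The representing measure\<close>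

text \<open>On almost every ray all coordinates are nonzero, so \<open>prod_ft_gexp_unimodal\<close>
  applies and the moment has order n - p - 1 <= 2.\<close>

lemma ray_mean_gexp_ft_prod_nonneg:
  assumes q: "2 < q" and p: "0 < p" "real CARD('n) - 3 \<le> p" "p < real CARD('n)"
  shows "AE z::real^'n::finite in lborel. annulus z = 1 \<longrightarrow> 0 \<le> ray_mean p (gexp_ft_prod q) z"
proof -
  have q0: "0 < q" using q by simp
  \<comment> \<open>A homogeneous function that is nonzero off the origin: the averaging lemma
    applied to it shows that the moment along almost every ray meeting the annulus converges
    absolutely.\<close>
  let ?G = "\<lambda>y::real^'n. complex_of_real (norm y powr (- p))"
  have "integrable lborel (\<lambda>y::real^'n. complex_of_real (gexp_ft_prod q y * norm y powr (- p)))"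
    using integrable_gexp_ft_prod_norm_powr[OF q _ p(3)] p(1) by (intro integrable_of_real) auto
  then have int: "integrable lborel (\<lambda>y::real^'n. complex_of_real (gexp_ft_prod q y) * ?G y)" by simp
  have hom: "?G (c *\<^sub>R y) = complex_of_real (\<bar>c\<bar> powr (- p)) * ?G y" for c y
    by (simp add: powr_mult)
  obtain C where C: "0 \<le> C" "\<And>y::real^'n. \<bar>gexp_ft_prod q y\<bar> \<le> C * weight y"
    using gexp_ft_prod_le_weight[OF q] by blast
  have "AE z in lborel. integrable lborel
      (\<lambda>s. complex_of_real (\<bar>s\<bar> powr (real CARD('n) - p - 1) * gexp_ft_prod q (s *\<^sub>R z)) * (complex_of_real (annulus z) * ?G z))"
    by (rule ray_mean_AE_integrable[OF _ _ hom int]) auto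
  then show ?thesis using AE_vec_nonzero
  proof eventually_elim
    case (elim z)
    show ?case
    proof
      assume ann: "annulus z = 1"
      let ?r = "norm z powr (- p)"
      have r: "?r \<noteq> 0" using ann by (auto simp: annulus_def split: if_splits)
      have "integrable lborel (\<lambda>s. norm (complex_of_real (\<bar>s\<bar> powr (real CARD('n) - p - 1) * gexp_ft_prod q (s *\<^sub>R z)) * (complex_of_real (annulus z) * ?G z)) * (1 / ?r))"
        by (intro integrable_mult_left integrable_norm elim)
      then have "integrable lborel (\<lambda>s. \<bar>\<bar>s\<bar> powr (real CARD('n) - p - 1) * gexp_ft_prod q (s *\<^sub>R z)\<bar>)"
        using r by (simp add: ann norm_mult abs_mult)
      then have hs: "integrable lborel (\<lambda>s. \<bar>s\<bar> powr (real CARD('n) - p - 1) * gexp_ft_prod q (s *\<^sub>R z))"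
        by (subst (asm) integrable_abs_iff) auto
      have "\<exists>f. unimodal f \<and> integrable lborel f \<and> (\<forall>t. ft f t = (\<Prod>k\<in>UNIV. ft (gexp q) (t * z $ k)))"
        using elim by (intro prod_ft_gexp_unimodal q0) auto
      then obtain f where f: "unimodal f" "integrable lborel f"
        and "\<And>t. ft f t = (\<Prod>k\<in>UNIV. ft (gexp q) (t * z $ k))" by blast
      then have h: "ft f t = complex_of_real (gexp_ft_prod q (t *\<^sub>R z))" for t
        by (simp add: gexp_ft_prod_def ft_gexp)
      obtain k :: 'n where True by simp
      have zk: "z $ k \<noteq> 0" using elim by simp
      \<comment> \<open>One nonzero coordinate already gives integrability along the ray; the other
        factors of the weight are at most 1.\<close>
      have hi: "integrable lborel (\<lambda>t. gexp_ft_prod q (t *\<^sub>R z))"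
      proof (rule Bochner_Integration.integrable_bound)
        show "integrable lborel (\<lambda>t. C * (1 / (1 + (0 + z $ k * t)\<^sup>2)))"
          by (intro integrable_mult_right lborel_integrable_real_affine[OF integrable_inverse_1_plus_sq zk])
        have "\<bar>gexp_ft_prod q (t *\<^sub>R z)\<bar> \<le> C * (1 / (1 + (0 + z $ k * t)\<^sup>2))" for t
        proof -
          have "weight (t *\<^sub>R z) = (1 / (1 + (t * z $ k)\<^sup>2)) * (\<Prod>j\<in>UNIV - {k}. 1 / (1 + (t * z $ j)\<^sup>2))"
            unfolding weight_def by (subst prod.remove[of _ k]) auto
          also have "\<dots> \<le> (1 / (1 + (t * z $ k)\<^sup>2)) * 1"
            by (intro mult_left_mono prod_le_1) (auto simp: field_simps add_pos_nonneg)
          finally have "C * weight (t *\<^sub>R z) \<le> C * (1 / (1 + (0 + z $ k * t)\<^sup>2))"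
            using C(1) by (intro mult_left_mono) (auto simp: mult.commute)
          with C(2)[of "t *\<^sub>R z"] show ?thesis by linarith
        qed
        then show "AE t in lborel. norm (gexp_ft_prod q (t *\<^sub>R z)) \<le> norm (C * (1 / (1 + (0 + z $ k * t)\<^sup>2)))"
          using C(1) by (intro AE_I2) (simp add: abs_of_nonneg)
      qed measurable
      show "0 \<le> ray_mean p (gexp_ft_prod q) z"
        unfolding ray_mean_def using p(2) hs by (intro unimodal_ft_moment_nonneg[OF f h hi]) auto
    qed
  qed
qed

lemma borel_measurable_ray_mean:
  assumes [measurable]: "h \<in> borel_measurable borel"
  shows "ray_mean p h \<in> borel_measurable borel"
  unfolding ray_mean_def[abs_def] by measurable

lemma nn_integral_lborel_uminus:
  fixes f :: "'a::euclidean_space \<Rightarrow> ennreal"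
  assumes [measurable]: "f \<in> borel_measurable borel"
  shows "(\<integral>\<^sup>+x. f (- x) \<partial>lborel) = (\<integral>\<^sup>+x. f x \<partial>lborel)"
proof -
  have eq: "lborel = distr lborel borel (\<lambda>x::'a. - x)"
    using lborel_affine[of "-1" "0::'a"] by (simp add: density_1)
  have "(\<integral>\<^sup>+x. f x \<partial>lborel) = (\<integral>\<^sup>+x. f x \<partial>distr lborel borel (\<lambda>x::'a. - x))"
    using eq by simp
  also have "\<dots> = (\<integral>\<^sup>+x. f (- x) \<partial>lborel)" by (rule nn_integral_distr) measurable
  finally show ?thesis by simp
qed

text \<open>The pairing formula followed by ray averaging writes the distribution as an integral of
  \<open>radial_ft p \<phi>\<close> over the annulus with a nonnegative density. Homogeneity moves
  each z to its direction, so the measure sought is the image of that density under z \<mapsto> z /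
  |z|. Having the formula for all admissible \<phi> gives both the embedding and positive
  definiteness.\<close>

lemma ex_representing_measure:
  assumes q: "2 < q" and p: "0 < p" "real CARD('n) - 3 \<le> p" "p < real CARD('n)"
  obtains \<gamma> :: "(real ^ 'n::finite) measure"
  where "sets \<gamma> = sets (restrict_space borel (sphere 0 1))" "finite_measure \<gamma>"
    "\<And>A. A \<in> sets \<gamma> \<Longrightarrow> emeasure \<gamma> (uminus ` A) = emeasure \<gamma> A"
    "\<And>\<phi>. admissible \<phi> \<Longrightarrow>
      (LBINT x. complex_of_real (lq_norm q x powr (- p)) * \<phi> x) = (\<integral>\<xi>. radial_ft p \<phi> \<xi> \<partial>\<gamma>)"
proof -
  let ?S = "restrict_space borel (sphere (0 :: real^'n) 1)"
  obtain e :: "real^'n" where e: "norm e = 1" using vector_choose_size[of 1] by auto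
  \<comment> \<open>The unit vector \<open>e\<close> is an arbitrary value at 0; it keeps
    \<open>dir\<close> inside the sphere and has no mass, because the annulus avoids 0.\<close>
  define dir where "dir z = (if z = 0 then e else z /\<^sub>R norm z)" for z :: "real^'n"
  \<comment> \<open>The product of the constant from the pairing formula and the one from ray
    averaging.\<close>
  define C where "C = (2 * pi) ^ CARD('n) * (LBINT t. \<bar>t\<bar> powr (p - 1) * gexp q t) *
    (LBINT s. \<bar>s\<bar> powr (0 - 1) * window s)"
  have C: "0 < C"
    unfolding C_def using integral_powr_gexp_pos[of p q] integral_window_pos p q
    by (intro mult_pos_pos) auto
  let ?H = "ray_mean p (gexp_ft_prod q) :: real^'n \<Rightarrow> real"
  have Hm [measurable]: "?H \<in> borel_measurable borel" by (rule borel_measurable_ray_mean) measurable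
  \<comment> \<open>\<open>max 0\<close> makes the density nonnegative everywhere, while the ray
    mean is known to be nonnegative only almost everywhere on the annulus. The power of the norm
    comes from replacing z by its direction.\<close>
  define d where "d z = annulus z * max 0 (?H z) * norm z powr (- p) / C" for z
  have dm [measurable]: "d \<in> borel_measurable borel" unfolding d_def[abs_def] by measurable
  have d0: "0 \<le> d z" for z using C by (simp add: d_def annulus_def)
  have H0: "AE z in lborel. annulus z = 1 \<longrightarrow> 0 \<le> ?H z"
    by (rule ray_mean_gexp_ft_prod_nonneg[OF q p])
  have dirm [measurable]: "dir \<in> borel \<rightarrow>\<^sub>M ?S"
    unfolding dir_def[abs_def] using e by (intro measurable_restrict_space2) auto
  define M0 where "M0 = density lborel (\<lambda>z. ennreal (d z))"
  define \<gamma> where "\<gamma> = distr M0 ?S dir"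
  have dirm0: "dir \<in> M0 \<rightarrow>\<^sub>M ?S" using dirm by (simp add: M0_def)
  have sets: "sets \<gamma> = sets ?S" by (simp add: \<gamma>_def)
  have di: "integrable lborel d"
  proof -
    let ?G = "\<lambda>y::real^'n. complex_of_real (norm y powr (- p))"
    have "integrable lborel (\<lambda>y::real^'n. complex_of_real (gexp_ft_prod q y * norm y powr (- p)))"
      using integrable_gexp_ft_prod_norm_powr[OF q _ p(3)] p(1) by (intro integrable_of_real) auto
    then have int: "integrable lborel (\<lambda>y::real^'n. complex_of_real (gexp_ft_prod q y) * ?G y)" by simp
    have hom: "?G (c *\<^sub>R y) = complex_of_real (\<bar>c\<bar> powr (- p)) * ?G y" for c y
      by (simp add: powr_mult)
    have "integrable lborel (\<lambda>z. complex_of_real (annulus z * ?H z) * ?G z)"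
      by (rule integrable_ray_mean[OF _ _ hom int]) auto
    then have "integrable lborel (\<lambda>z. norm (complex_of_real (annulus z * ?H z) * ?G z) * (1 / C))"
      by (intro integrable_mult_left integrable_norm)
    then show ?thesis
      by (rule Bochner_Integration.integrable_bound)
         (use C in \<open>auto simp: d_def annulus_def norm_mult abs_mult intro!: AE_I2 divide_right_mono mult_right_mono\<close>)
  qed
  have fin: "finite_measure \<gamma>"
    unfolding \<gamma>_def
  proof (rule finite_measure.finite_measure_distr[OF _ dirm0])
    have "emeasure M0 (space M0) = (\<integral>\<^sup>+z. ennreal (d z) \<partial>lborel)"
      by (simp add: M0_def emeasure_density)
    also have "\<dots> < \<infinity>" using di d0 by (simp add: nn_integral_eq_integral)
    finally show "finite_measure M0" by (intro finite_measureI) auto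
  qed
  have sym: "emeasure \<gamma> (uminus ` A) = emeasure \<gamma> A" if A: "A \<in> sets \<gamma>" for A
  proof -
    have AS: "A \<in> sets ?S" using A sets by simp
    then have Ab: "A \<in> sets borel" "A \<subseteq> sphere 0 1"
      by (auto simp: sets_restrict_space)
    have im: "uminus ` A = uminus -` A" by (auto simp: image_iff) (metis minus_minus)
    have "uminus -` A \<in> sets borel"
      using measurable_sets[of uminus borel borel A] Ab by auto
    then have uS: "uminus ` A \<in> sets ?S" unfolding im using Ab(2)
      by (subst sets_restrict_space_iff) auto
    have Am [measurable]: "{z. dir z \<in> A} \<in> sets borel"
      using measurable_sets[OF dirm AS] by (simp add: vimage_def)
    have uAm [measurable]: "{z. dir z \<in> uminus ` A} \<in> sets borel"
      using measurable_sets[OF dirm uS] by (simp add: vimage_def)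
    have H_even: "?H (- z) = ?H z" for z
      by (simp add: ray_mean_def gexp_ft_prod_uminus)
    have d_even: "d (- z) = d z" for z by (simp add: d_def annulus_def H_even)
    have em: "emeasure \<gamma> B = (\<integral>\<^sup>+z. ennreal (d z) * indicator {z. dir z \<in> B} z \<partial>lborel)"
      if B: "B \<in> sets ?S" "{z. dir z \<in> B} \<in> sets borel" for B
    proof -
      have "dir -` B \<inter> space M0 = {z. dir z \<in> B}" by (auto simp: M0_def)
      then have "emeasure \<gamma> B = emeasure M0 {z. dir z \<in> B}"
        by (simp add: \<gamma>_def emeasure_distr[OF dirm0 B(1)])
      also have "\<dots> = (\<integral>\<^sup>+z. ennreal (d z) * indicator {z. dir z \<in> B} z \<partial>lborel)"
        unfolding M0_def using B(2) by (intro emeasure_density) auto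
      finally show ?thesis .
    qed
    have "emeasure \<gamma> (uminus ` A) = (\<integral>\<^sup>+z. ennreal (d z) * indicator {z. dir z \<in> uminus ` A} z \<partial>lborel)"
      by (rule em[OF uS uAm])
    also have "\<dots> = (\<integral>\<^sup>+z. ennreal (d (- z)) * indicator {z. dir z \<in> A} (- z) \<partial>lborel)"
    proof (intro nn_integral_cong)
      fix z
      show "ennreal (d z) * indicator {z. dir z \<in> uminus ` A} z = ennreal (d (- z)) * indicator {z. dir z \<in> A} (- z)"
      \<comment> \<open>\<open>dir\<close> is odd away from 0, and at 0 the density
        vanishes.\<close>
      proof (cases "z = 0")
        case True
        then show ?thesis by (simp add: d_def annulus_def)
      next
        case False
        then have "dir (- z) = - dir z" by (simp add: dir_def)
        then show ?thesis unfolding im by (simp add: d_even indicator_def)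
      qed
    qed
    also have "\<dots> = (\<integral>\<^sup>+z. ennreal (d z) * indicator {z. dir z \<in> A} z \<partial>lborel)"
      by (rule nn_integral_lborel_uminus) measurable
    also have "\<dots> = emeasure \<gamma> A" by (rule em[OF AS Am, symmetric])
    finally show ?thesis .
  qed
  have repr: "(LBINT x. complex_of_real (lq_norm q x powr (- p)) * \<phi> x) = (\<integral>\<xi>. radial_ft p \<phi> \<xi> \<partial>\<gamma>)"
    if \<phi>: "admissible \<phi>" for \<phi> :: "real^'n \<Rightarrow> complex"
  proof -
    have pm [measurable]: "\<phi> \<in> borel_measurable borel" using \<phi> by (simp add: admissible_def)
    have rm [measurable]: "radial_ft p \<phi> \<in> borel_measurable borel" by (rule borel_measurable_radial_ft) measurable
    have rS: "radial_ft p \<phi> \<in> borel_measurable ?S" by (rule measurable_restrict_space1) measurable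
    have rdir: "(\<lambda>z. radial_ft p \<phi> (dir z)) \<in> borel_measurable borel"
      by (rule measurable_compose[OF dirm rS])
    have "(\<integral>\<xi>. radial_ft p \<phi> \<xi> \<partial>\<gamma>) = (\<integral>z. radial_ft p \<phi> (dir z) \<partial>M0)"
      unfolding \<gamma>_def by (rule integral_distr[OF dirm0 rS])
    also have "\<dots> = (LBINT z. d z *\<^sub>R radial_ft p \<phi> (dir z))"
      unfolding M0_def using d0 rdir by (intro integral_density) auto
    also have "\<dots> = (LBINT z. complex_of_real (1 / C) * (complex_of_real (annulus z * ?H z) * radial_ft p \<phi> z))"
    proof (rule integral_cong_AE)
      show "AE z in lborel. d z *\<^sub>R radial_ft p \<phi> (dir z) = complex_of_real (1 / C) * (complex_of_real (annulus z * ?H z) * radial_ft p \<phi> z)"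
        using H0
      proof eventually_elim
        case (elim z)
        show ?case
        proof (cases "annulus z = 1")
          case True
          then have z: "z \<noteq> 0" "0 \<le> ?H z" using elim by (auto simp: annulus_def)
          have "radial_ft p \<phi> z = radial_ft p \<phi> (norm z *\<^sub>R dir z)" using z by (simp add: dir_def)
          also have "\<dots> = complex_of_real (norm z powr (- p)) * radial_ft p \<phi> (dir z)"
            using z by (subst radial_ft_scaleR) auto
          finally show ?thesis using z by (simp add: d_def scaleR_conv_of_real)
        next
          case False
          then have "annulus z = 0" by (simp add: annulus_def split: if_splits)
          then show ?thesis by (simp add: d_def)
        qed
      qed
    qed (use rdir in measurable)
    also have "\<dots> = complex_of_real (1 / C) * (LBINT z. complex_of_real (annulus z * ?H z) * radial_ft p \<phi> z)"
      by (rule integral_mult_right_zero)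
    also have "(LBINT z. complex_of_real (annulus z * ?H z) * radial_ft p \<phi> z) =
        complex_of_real (LBINT s. \<bar>s\<bar> powr (0 - 1) * window s) * (LBINT y. complex_of_real (gexp_ft_prod q y) * radial_ft p \<phi> y)"
      by (rule integral_ray_mean[OF _ _ radial_ft_scaleR integrable_gexp_ft_prod_radial_ft[OF q p(1,3) \<phi>]]) auto
    also have "(LBINT y. complex_of_real (gexp_ft_prod q y) * radial_ft p \<phi> y) =
        complex_of_real ((2 * pi) ^ CARD('n) * (LBINT t. \<bar>t\<bar> powr (p - 1) * gexp q t)) *
        (LBINT x. complex_of_real (lq_norm q x powr (- p)) * \<phi> x)"
      by (rule lq_norm_powr_pairing[OF q p(1,3) \<phi>, symmetric])
    also have "complex_of_real (1 / C) * (complex_of_real (LBINT s. \<bar>s\<bar> powr (0 - 1) * window s) *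
        (complex_of_real ((2 * pi) ^ CARD('n) * (LBINT t. \<bar>t\<bar> powr (p - 1) * gexp q t)) *
        (LBINT x. complex_of_real (lq_norm q x powr (- p)) * \<phi> x))) =
        complex_of_real ((1 / C) * C) * (LBINT x. complex_of_real (lq_norm q x powr (- p)) * \<phi> x)"
      by (simp only: C_def of_real_mult mult_ac)
    finally show ?thesis using C by simp
  qed
  show thesis using that[OF sets fin sym repr] by blast
qed

lemma embeds_lq:
  assumes q: "2 < q" and p: "0 < p" "real CARD('n) - 3 \<le> p" "p < real CARD('n)"
  shows "embeds_in_L_neg p (lq_norm q :: real ^ 'n::finite \<Rightarrow> real)"
proof (rule ex_representing_measure[OF q p])
  fix \<gamma> :: "(real ^ 'n) measure"
  assume "sets \<gamma> = sets (restrict_space borel (sphere 0 1))" "finite_measure \<gamma>"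
    and "\<And>A. A \<in> sets \<gamma> \<Longrightarrow> emeasure \<gamma> (uminus ` A) = emeasure \<gamma> A"
    and *: "\<And>\<phi>. admissible \<phi> \<Longrightarrow>
      (LBINT x. complex_of_real (lq_norm q x powr (- p)) * \<phi> x) = (\<integral>\<xi>. radial_ft p \<phi> \<xi> \<partial>\<gamma>)"
  then show ?thesis
    unfolding embeds_in_L_neg_def
    by (intro exI[of _ \<gamma>] conjI ballI) (simp_all only: *[OF admissible_schwartz] radial_ft_def)
qed

section \<open>Positive definiteness from the representation\<close>

lemma radial_ft_autocorrelation:
  assumes "\<phi> \<in> schwartz"
  shows "radial_ft p (autocorrelation \<phi>) \<xi> =
    complex_of_real (LBINT t. \<bar>t\<bar> powr (p - 1) * (norm (fourier \<phi> (t *\<^sub>R \<xi>)))\<^sup>2)"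
proof -
  have "radial_ft p (autocorrelation \<phi>) \<xi> =
      (LBINT t. complex_of_real (\<bar>t\<bar> powr (p - 1) * (norm (fourier \<phi> (t *\<^sub>R \<xi>)))\<^sup>2))"
    by (simp add: radial_ft_def fourier_autocorrelation[OF schwartz_integrable[OF assms]])
  then show ?thesis by (simp only: integral_complex_of_real)
qed

text \<open>The integrand is a nonnegative real, and a Bochner integral that does not converge has
  the value 0, so the conclusion holds for every measure.\<close>

lemma integral_radial_ft_autocorrelation_nonneg:
  assumes "\<phi> \<in> schwartz"
  shows "(\<integral>\<xi>. radial_ft p (autocorrelation \<phi>) \<xi> \<partial>M) \<in> \<real>\<^sub>\<ge>\<^sub>0"
proof -
  have "(\<integral>\<xi>. radial_ft p (autocorrelation \<phi>) \<xi> \<partial>M) =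
      complex_of_real (\<integral>\<xi>. (LBINT t. \<bar>t\<bar> powr (p - 1) * (norm (fourier \<phi> (t *\<^sub>R \<xi>)))\<^sup>2) \<partial>M)"
    unfolding radial_ft_autocorrelation[OF assms] by (rule integral_complex_of_real)
  also have "\<dots> \<in> \<real>\<^sub>\<ge>\<^sub>0"
    by (simp add: complex_nonneg_Reals_iff)
  finally show ?thesis .
qed

lemma positive_definite_lq:
  assumes q: "2 < q" and p: "0 < p" "real CARD('n) - 3 \<le> p" "p < real CARD('n)"
  shows "positive_definite (function_distribution (\<lambda>x :: real ^ 'n::finite. lq_norm q x powr (- p)))"
proof (rule ex_representing_measure[OF q p])
  fix \<gamma> :: "(real ^ 'n) measure"
  assume *: "\<And>\<phi>. admissible \<phi> \<Longrightarrow>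
      (LBINT x. complex_of_real (lq_norm q x powr (- p)) * \<phi> x) = (\<integral>\<xi>. radial_ft p \<phi> \<xi> \<partial>\<gamma>)"
  show ?thesis
    unfolding positive_definite_def function_distribution_def autocorrelation_def[symmetric]
    by (intro ballI) (simp only: *[OF admissible_autocorrelation] integral_radial_ft_autocorrelation_nonneg)
qed

section \<open>Temperedness\<close>

lemma schwartz_seminorm_upper:
  assumes "\<phi> \<in> schwartz"
  shows "norm x ^ m * norm (iterated_partial ks \<phi> x) \<le> schwartz_seminorm m ks \<phi>"
proof -
  obtain C where "\<And>x. norm x ^ m * norm (iterated_partial ks \<phi> x) \<le> C"
    using schwartz_decay[OF assms] by blast
  then show ?thesis
    unfolding schwartz_seminorm_def by (intro cSUP_upper bdd_aboveI2) auto
qed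

lemma tempered_lq:
  assumes q: "0 < q" and p: "0 \<le> p" "p < real CARD('n)"
  shows "tempered_distribution (function_distribution (\<lambda>x :: real ^ 'n::finite. lq_norm q x powr (- p)))"
proof -
  let ?f = "\<lambda>x :: real ^ 'n. lq_norm q x powr (- p)"
  let ?T = "function_distribution ?f"
  have int: "integrable lborel (\<lambda>x. complex_of_real (?f x) * \<phi> x)" if \<phi>: "\<phi> \<in> schwartz" for \<phi>
  proof -
    obtain A where A: "\<And>x. norm (\<phi> x) \<le> A * weight x" using schwartz_le_weight[OF \<phi>] by blast
    show ?thesis by (rule integrable_lq_norm_powr_mult[OF q p schwartz_borel_measurable[OF \<phi>] A])
  qed
  have lin: "?T (\<lambda>x. a * \<phi> x + b * \<psi> x) = a * ?T \<phi> + b * ?T \<psi>"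
    if "\<phi> \<in> schwartz" "\<psi> \<in> schwartz" for \<phi> \<psi> a b
  proof -
    have "?T (\<lambda>x. a * \<phi> x + b * \<psi> x) =
        (LBINT x. a * (complex_of_real (?f x) * \<phi> x) + b * (complex_of_real (?f x) * \<psi> x))"
      unfolding function_distribution_def
      by (intro Bochner_Integration.integral_cong[OF refl]) (simp add: algebra_simps)
    then show ?thesis
      using int[OF that(1)] int[OF that(2)] by (simp add: function_distribution_def)
  qed
  let ?I = "LBINT x. ?f x * weight x"
  have fw: "integrable lborel (\<lambda>x. ?f x * weight x)"
    using integrable_lq_norm_powr_mult[OF q p borel_measurable_weight, of 1] by simp
  \<comment> \<open>Continuity is reduced to a bound by two seminorms: one for the values, and one
    of order 4n that supplies the decay of the weight.\<close>
  have bound: "norm (?T \<psi>) \<le> 4 ^ CARD('n) * (schwartz_seminorm 0 [] \<psi> + schwartz_seminorm (4 * CARD('n)) [] \<psi>) * ?I"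
    if \<psi>: "\<psi> \<in> schwartz" for \<psi> :: "real ^ 'n \<Rightarrow> complex"
  proof -
    let ?S = "schwartz_seminorm 0 [] \<psi> + schwartz_seminorm (4 * CARD('n)) [] \<psi>"
    have S: "0 \<le> ?S"
      using order_trans[OF _ schwartz_seminorm_upper[OF \<psi>, of 0 0 "[]"]]
        order_trans[OF _ schwartz_seminorm_upper[OF \<psi>, of 0 "4 * CARD('n)" "[]"]]
      by (intro add_nonneg_nonneg) auto
    have le: "norm (\<psi> x) \<le> 4 ^ CARD('n) * ?S * weight x" for x
    proof -
      have "norm (\<psi> x) \<le> 4 ^ CARD('n) * ?S * (weight x)\<^sup>2"
        using schwartz_seminorm_upper[OF \<psi>, of x 0 "[]"] schwartz_seminorm_upper[OF \<psi>, of x "4 * CARD('n)" "[]"]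
        by (intro norm_le_weight_sq) auto
      also have "\<dots> \<le> 4 ^ CARD('n) * ?S * weight x"
        using S by (intro mult_left_mono weight_sq_le) auto
      finally show ?thesis .
    qed
    have "norm (?T \<psi>) \<le> (LBINT x. norm (complex_of_real (?f x) * \<psi> x))"
      unfolding function_distribution_def by (rule integral_norm_bound)
    also have "\<dots> \<le> (LBINT x. 4 ^ CARD('n) * ?S * (?f x * weight x))"
    proof (rule Bochner_Integration.integral_mono)
      show "integrable lborel (\<lambda>x. norm (complex_of_real (?f x) * \<psi> x))"
        by (intro integrable_norm int \<psi>)
      show "integrable lborel (\<lambda>x. 4 ^ CARD('n) * ?S * (?f x * weight x))"
        by (intro integrable_mult_right fw)
      show "norm (complex_of_real (?f x) * \<psi> x) \<le> 4 ^ CARD('n) * ?S * (?f x * weight x)" for x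
        using mult_left_mono[OF le[of x], of "?f x"] by (simp add: norm_mult mult_ac)
    qed
    also have "\<dots> = 4 ^ CARD('n) * ?S * ?I" by (rule integral_mult_right_zero)
    finally show ?thesis .
  qed
  have cont: "(\<lambda>j. ?T (\<phi>s j)) \<longlonglongrightarrow> ?T \<phi>"
    if \<phi>: "\<phi> \<in> schwartz" and \<phi>s: "\<And>j. \<phi>s j \<in> schwartz" and lim: "schwartz_tendsto \<phi>s \<phi>" for \<phi>s \<phi>
  proof -
    have d: "(\<lambda>x. \<phi>s j x - \<phi> x) \<in> schwartz" for j
      using schwartz_linear[OF \<phi>s \<phi>, of 1 j "-1"] by simp
    have Td: "?T (\<lambda>x. \<phi>s j x - \<phi> x) = ?T (\<phi>s j) - ?T \<phi>" for j
      using lin[OF \<phi>s \<phi>, of 1 j "-1"] by simp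
    have s: "(\<lambda>j. schwartz_seminorm m ks (\<lambda>x. \<phi>s j x - \<phi> x)) \<longlonglongrightarrow> 0" for m ks
      using lim by (simp add: schwartz_tendsto_def)
    let ?b = "\<lambda>j. 4 ^ CARD('n) * (schwartz_seminorm 0 [] (\<lambda>x. \<phi>s j x - \<phi> x) +
        schwartz_seminorm (4 * CARD('n)) [] (\<lambda>x. \<phi>s j x - \<phi> x)) * ?I"
    have "?b \<longlonglongrightarrow> 4 ^ CARD('n) * (0 + 0) * ?I"
      by (rule tendsto_mult_right[OF tendsto_mult_left[OF tendsto_add[OF s s]]])
    then have b0: "?b \<longlonglongrightarrow> 0" by simp
    have "norm (?T (\<phi>s j) - ?T \<phi>) \<le> ?b j" for j
      using bound[OF d[of j]] unfolding Td .
    then have "(\<lambda>j. ?T (\<phi>s j) - ?T \<phi>) \<longlonglongrightarrow> 0"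
      by (intro Lim_null_comparison[OF always_eventually b0]) blast
    then show ?thesis by (rule LIM_zero_cancel)
  qed
  show ?thesis unfolding tempered_distribution_def using lin cont by blast
qed

section \<open>Fourth differences of Gaussians\<close>

text \<open>The polynomial factor is there to absorb the quadratic growth of the bound on second
  differences.\<close>

lemma gauss_poly_le_weight:
  fixes v :: "real ^ 'n::finite"
  assumes w: "\<And>k. 0 < w k"
  obtains C where "\<And>x. (1 + norm x) ^ m * gauss w v x \<le> C * weight x"
proof -
  let ?n = "4 * CARD('n)"
  obtain A where A: "\<And>x. (1 + norm x) ^ m * gauss w v x \<le> A"
    by (rule gauss_decay[where w = w and m = m and v = v, OF w]) blast
  obtain B where B: "\<And>x. (1 + norm x) ^ (m + ?n) * gauss w v x \<le> B"
    by (rule gauss_decay[where w = w and m = "m + ?n" and v = v, OF w]) blast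
  have nn: "0 \<le> (1 + norm x) ^ m * gauss w v x" for x using gauss_pos[of w v x] by simp
  have "0 \<le> (1 + norm 0) ^ (m + ?n) * gauss w v 0" using gauss_pos[of w v 0] by simp
  then have AB: "0 \<le> A + B"
    using order_trans[OF nn A[of 0]] order_trans[OF _ B[of 0]] by simp
  have "(1 + norm x) ^ m * gauss w v x \<le> 4 ^ CARD('n) * (A + B) * weight x" for x
  proof -
    let ?v = "(1 + norm x) ^ m * gauss w v x"
    have "norm x ^ ?n * ?v \<le> (1 + norm x) ^ ?n * ?v"
      using nn by (intro mult_right_mono power_mono) auto
    also have "\<dots> = (1 + norm x) ^ (m + ?n) * gauss w v x" by (simp only: power_add mult_ac)
    finally have "norm x ^ ?n * ?v \<le> B" using B[of x] by simp
    with A[of x] have "norm ?v \<le> 4 ^ CARD('n) * (A + B) * (weight x)\<^sup>2"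
      using nn[of x] by (intro norm_le_weight_sq) auto
    also have "\<dots> \<le> 4 ^ CARD('n) * (A + B) * weight x"
      using AB by (intro mult_left_mono weight_sq_le) auto
    finally show ?thesis using nn[of x] by simp
  qed
  then show thesis by (rule that)
qed

lemma integrable_gauss:
  assumes "\<And>k. 0 < w k" shows "integrable lborel (gauss w v)"
proof -
  obtain C where "\<And>x. (1 + norm x) ^ 0 * gauss w v x \<le> C * weight x"
    by (rule gauss_poly_le_weight[where w = w and m = 0 and v = v, OF assms]) blast
  then show ?thesis
    by (intro integrable_le_weight[of _ C]) (auto simp: abs_of_pos[OF gauss_pos])
qed

lemma gauss_uminus: "gauss w v (- x) = gauss w (- v) x"
  by (simp add: gauss_def power2_commute[of "- _"] power2_eq_square algebra_simps)

text \<open>Completing the square in each coordinate, w (y - a)^2 + w (x - y - b)^2 = 2w (y - m)^2 +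
  (w/2) (x - a - b)^2 with m = (a + x - b) / 2. Centres add and weights halve.\<close>

lemma gauss_convolution:
  fixes a b x :: "real ^ 'n::finite"
  shows "(LBINT y. gauss w a y * gauss w b (x - y)) =
    (\<integral>y. gauss (\<lambda>k. 2 * w k) 0 y \<partial>(lborel :: (real ^ 'n) measure)) * gauss (\<lambda>k. w k / 2) (a + b) x"
proof -
  let ?m = "(1/2) *\<^sub>R (a + x - b)"
  have "gauss w a y * gauss w b (x - y) = gauss (\<lambda>k. 2 * w k) 0 (y + (- ?m)) * gauss (\<lambda>k. w k / 2) (a + b) x" for y
  proof -
    have "w k * (y $ k - a $ k)\<^sup>2 + w k * ((x - y) $ k - b $ k)\<^sup>2 =
        2 * w k * ((y + (- ?m)) $ k - 0 $ k)\<^sup>2 + w k / 2 * (x $ k - (a + b) $ k)\<^sup>2" for k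
      by (simp add: power2_eq_square field_simps)
    then show ?thesis
      unfolding gauss_def exp_add[symmetric] minus_add_distrib[symmetric] sum.distrib[symmetric] by simp
  qed
  then have "(LBINT y. gauss w a y * gauss w b (x - y)) =
      (LBINT y. gauss (\<lambda>k. 2 * w k) 0 (y + (- ?m)) * gauss (\<lambda>k. w k / 2) (a + b) x)"
    by (simp only:)
  also have "\<dots> = (LBINT y. gauss (\<lambda>k. 2 * w k) 0 (y + (- ?m))) * gauss (\<lambda>k. w k / 2) (a + b) x"
    by (rule integral_mult_left_zero)
  also have "(\<integral>y. gauss (\<lambda>k. 2 * w k) 0 (y + (- ?m)) \<partial>(lborel :: (real^'n) measure)) = (LBINT y. gauss (\<lambda>k. 2 * w k) 0 y)"
    by (rule integral_lborel_shift) measurable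
  finally show ?thesis .
qed

lemma integral_gauss_pos:
  assumes "\<And>k. 0 < w k"
  shows "0 < (\<integral>y. gauss w v y \<partial>(lborel :: (real ^ 'n::finite) measure))"
  by (intro integral_pos_AE integrable_gauss assms AE_I2 gauss_pos) simp

text \<open>On the Fourier side a second difference multiplies by -2 (1 - cos), so its
  autocorrelation carries 4 (1 - cos)^2, the square on which the doubling inequality rests.\<close>

definition second_diff :: "('n \<Rightarrow> real) \<Rightarrow> real ^ 'n \<Rightarrow> real ^ 'n::finite \<Rightarrow> real" where
  "second_diff w v x = gauss w (- v) x - 2 * gauss w 0 x + gauss w v x"

definition fourth_diff :: "('n \<Rightarrow> real) \<Rightarrow> real ^ 'n \<Rightarrow> real ^ 'n::finite \<Rightarrow> real" where
  "fourth_diff w v x = gauss w (- v - v) x - 4 * gauss w (- v) x + 6 * gauss w 0 x - 4 * gauss w v x + gauss w (v + v) x"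

lemma gauss_lin_schwartz:
  assumes "\<And>k. 0 < w k"
  shows "(\<lambda>x. complex_of_real (second_diff w v x)) \<in> schwartz"
    and "(\<lambda>x. complex_of_real (fourth_diff w v x)) \<in> schwartz"
proof -
  note G = gauss_schwartz[where w = w, OF assms]
  have 1: "(\<lambda>x. 1 * (1 * complex_of_real (gauss w (- v) x) + (- 2) * complex_of_real (gauss w 0 x)) + 1 * complex_of_real (gauss w v x)) \<in> schwartz"
    by (intro schwartz_linear G)
  then show "(\<lambda>x. complex_of_real (second_diff w v x)) \<in> schwartz"
    by (simp add: second_diff_def)
  have "(\<lambda>x. 1 * (1 * (1 * (1 * complex_of_real (gauss w (- v - v) x) + (- 4) * complex_of_real (gauss w (- v) x))
      + 6 * complex_of_real (gauss w 0 x)) + (- 4) * complex_of_real (gauss w v x)) + 1 * complex_of_real (gauss w (v + v) x)) \<in> schwartz"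
    by (intro schwartz_linear G)
  then show "(\<lambda>x. complex_of_real (fourth_diff w v x)) \<in> schwartz"
    by (simp add: fourth_diff_def)
qed

text \<open>The coefficients 1, -2, 1 convolved with themselves are 1, -4, 6, -4, 1, and centres
  add. The second difference is even, so reflecting it changes nothing.\<close>

lemma autocorrelation_second_diff:
  fixes v :: "real ^ 'n::finite"
  assumes w: "\<And>k. 0 < w k"
  shows "autocorrelation (\<lambda>x. complex_of_real (second_diff w v x)) =
    (\<lambda>x. complex_of_real ((\<integral>y. gauss (\<lambda>k. 2 * w k) 0 y \<partial>(lborel :: (real ^ 'n) measure)) * fourth_diff (\<lambda>k. w k / 2) v x))"
proof
  fix x
  let ?c = "\<integral>y. gauss (\<lambda>k. 2 * w k) 0 y \<partial>(lborel :: (real ^ 'n) measure)"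
  let ?g = "\<lambda>a b y. gauss w a y * gauss w b (x - y)"
  have even: "second_diff w v (- x) = second_diff w v x" for x
    by (simp add: second_diff_def gauss_uminus)
  have int: "integrable lborel (?g a b)" for a b
  proof (rule Bochner_Integration.integrable_bound[OF integrable_gauss[where w = w and v = a, OF w]])
    have "gauss w b y \<le> 1" for y
      using w by (simp add: gauss_def sum_nonneg less_imp_le)
    then show "AE y in lborel. norm (?g a b y) \<le> norm (gauss w a y)"
      by (intro AE_I2) (auto simp: abs_mult abs_of_pos[OF gauss_pos] intro!: mult_left_le less_imp_le[OF gauss_pos])
  qed measurable
  have "autocorrelation (\<lambda>x. complex_of_real (second_diff w v x)) x =
      (LBINT y. complex_of_real (second_diff w v y * second_diff w v (x - y)))"
    unfolding autocorrelation_def Defs.convolution_def even by simp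
  also have "\<dots> = complex_of_real (LBINT y. second_diff w v y * second_diff w v (x - y))"
    by (rule integral_complex_of_real)
  also have "(LBINT y. second_diff w v y * second_diff w v (x - y)) = (\<integral>y.
      ?g (-v) (-v) y + (-2) * ?g (-v) 0 y + ?g (-v) v y +
      (-2) * ?g 0 (-v) y + 4 * ?g 0 0 y + (-2) * ?g 0 v y +
      ?g v (-v) y + (-2) * ?g v 0 y + ?g v v y \<partial>lborel)"
    by (intro Bochner_Integration.integral_cong[OF refl]) (simp add: second_diff_def algebra_simps)
  also have "\<dots> = integral\<^sup>L lborel (?g (-v) (-v)) + (-2) * integral\<^sup>L lborel (?g (-v) 0) + integral\<^sup>L lborel (?g (-v) v) +
      (-2) * integral\<^sup>L lborel (?g 0 (-v)) + 4 * integral\<^sup>L lborel (?g 0 0) + (-2) * integral\<^sup>L lborel (?g 0 v) +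
      integral\<^sup>L lborel (?g v (-v)) + (-2) * integral\<^sup>L lborel (?g v 0) + integral\<^sup>L lborel (?g v v)"
    by (simp only: Bochner_Integration.integral_add integral_mult_right_zero int
        Bochner_Integration.integrable_add integrable_mult_right)
  also have "\<dots> = ?c * fourth_diff (\<lambda>k. w k / 2) v x"
    unfolding gauss_convolution by (simp add: fourth_diff_def algebra_simps)
  finally show "autocorrelation (\<lambda>x. complex_of_real (second_diff w v x)) x = complex_of_real (?c * fourth_diff (\<lambda>k. w k / 2) v x)" .
qed

definition gauss_mean :: "real \<Rightarrow> real \<Rightarrow> ('n \<Rightarrow> real) \<Rightarrow> real ^ 'n::finite \<Rightarrow> real" where
  "gauss_mean p q w v = (LBINT x. lq_norm q x powr (- p) * gauss w v x)"

text \<open>The assumption concerns only those \<phi> whose autocorrelation is again Schwartz; this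
  is the form that both positive definiteness and an embedding provide.\<close>

lemma fourth_diff_gauss_mean_nonneg:
  fixes v :: "real ^ 'n::finite"
  assumes q: "0 < q" and p: "0 \<le> p" "p < real CARD('n)"
    and pos: "\<And>\<phi> :: real ^ 'n \<Rightarrow> complex. \<phi> \<in> schwartz \<Longrightarrow> autocorrelation \<phi> \<in> schwartz \<Longrightarrow>
      (LBINT x. complex_of_real (lq_norm q x powr (- p)) * autocorrelation \<phi> x) \<in> \<real>\<^sub>\<ge>\<^sub>0"
    and w: "\<And>k. 0 < w k"
  shows "0 \<le> gauss_mean p q w (- v - v) - 4 * gauss_mean p q w (- v) + 6 * gauss_mean p q w 0
    - 4 * gauss_mean p q w v + gauss_mean p q w (v + v)"
proof -
  \<comment> \<open>The weights are doubled in advance because convolution halves them.\<close>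
  let ?w = "\<lambda>k. 2 * w k" and ?f = "\<lambda>x :: real ^ 'n. lq_norm q x powr (- p)"
  have w': "\<And>k. 0 < ?w k" using w by simp
  let ?\<phi> = "\<lambda>x. complex_of_real (second_diff ?w v x)"
  let ?c = "\<integral>y. gauss (\<lambda>k. 2 * ?w k) 0 y \<partial>(lborel :: (real ^ 'n) measure)"
  have c: "0 < ?c" using w by (intro integral_gauss_pos) auto
  have eq: "autocorrelation ?\<phi> = (\<lambda>x. complex_of_real (?c * fourth_diff w v x))"
    using autocorrelation_second_diff[where w = ?w and v = v, OF w'] by simp
  \<comment> \<open>The term with coefficient 0 brings a scalar multiple into the shape of
    \<open>schwartz_linear\<close>.\<close>
  have "(\<lambda>x. complex_of_real ?c * complex_of_real (fourth_diff w v x) + 0 * complex_of_real (fourth_diff w v x)) \<in> schwartz"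
    by (intro schwartz_linear gauss_lin_schwartz w)
  then have "autocorrelation ?\<phi> \<in> schwartz" unfolding eq by simp
  from pos[OF gauss_lin_schwartz(1)[where w = ?w and v = v, OF w'] this]
  have P: "(LBINT x. complex_of_real (?f x) * complex_of_real (?c * fourth_diff w v x)) \<in> \<real>\<^sub>\<ge>\<^sub>0"
    unfolding eq .
  have "(LBINT x. complex_of_real (?f x) * complex_of_real (?c * fourth_diff w v x)) =
      (LBINT x. complex_of_real (?f x * (?c * fourth_diff w v x)))" by simp
  also have "\<dots> = complex_of_real (LBINT x. ?f x * (?c * fourth_diff w v x))"
    by (rule integral_complex_of_real)
  finally have "0 \<le> (LBINT x. ?f x * (?c * fourth_diff w v x))"
    using P by (simp add: complex_nonneg_Reals_iff del: of_real_mult)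
  also have "\<dots> = (LBINT x. ?c * (?f x * fourth_diff w v x))" by (simp only: mult_ac)
  also have "\<dots> = ?c * (LBINT x. ?f x * fourth_diff w v x)" by (rule integral_mult_right_zero)
  finally have "0 \<le> (LBINT x. ?f x * fourth_diff w v x)"
    using c by (simp add: zero_le_mult_iff)
  also have "(LBINT x. ?f x * fourth_diff w v x) = (LBINT x. ?f x * gauss w (- v - v) x + (-4) * (?f x * gauss w (- v) x) +
      6 * (?f x * gauss w 0 x) + (-4) * (?f x * gauss w v x) + ?f x * gauss w (v + v) x)"
    by (intro Bochner_Integration.integral_cong[OF refl]) (simp add: fourth_diff_def algebra_simps)
  also have "\<dots> = gauss_mean p q w (- v - v) + (-4) * gauss_mean p q w (- v) + 6 * gauss_mean p q w 0
    + (-4) * gauss_mean p q w v + gauss_mean p q w (v + v)"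
  proof -
    have int: "integrable lborel (\<lambda>x. ?f x * gauss w a x)" for a
    proof -
      obtain C where "\<And>x. (1 + norm x) ^ 0 * gauss w a x \<le> C * weight x"
        by (rule gauss_poly_le_weight[where w = w and m = 0 and v = a, OF w]) blast
      then have "norm (gauss w a x) \<le> C * weight x" for x by (simp add: abs_of_pos[OF gauss_pos])
      from integrable_lq_norm_powr_mult[OF q p borel_measurable_gauss this] show ?thesis by simp
    qed
    show ?thesis unfolding gauss_mean_def
      by (simp only: Bochner_Integration.integral_add integral_mult_right_zero int
        Bochner_Integration.integrable_add integrable_mult_right)
  qed
  finally show ?thesis by simp
qed

section \<open>Second differences in one coordinate\<close>

lemma integral_lborel_scale_vec:
  fixes f :: "real ^ 'n::finite \<Rightarrow> real"
  assumes [measurable]: "f \<in> borel_measurable borel" and c: "\<And>k. c k \<noteq> 0"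
  shows "(LBINT x. f x) = (\<Prod>k\<in>UNIV. \<bar>c k\<bar>) * (LBINT x. f (t + (\<chi> k. c k * x $ k)))"
proof -
  let ?c = "\<lambda>j :: real ^ 'n. c (axis_index j)"
  let ?T = "\<lambda>x :: real ^ 'n. t + (\<Sum>j\<in>Basis. (?c j * (x \<bullet> j)) *\<^sub>R j)"
  have B: "(Basis :: (real ^ 'n) set) = range (\<lambda>k. axis k 1)"
    by (auto simp: Basis_vec_def)
  have inj: "inj (\<lambda>k::'n. axis k (1::real))" by (auto simp: inj_on_def axis_eq_axis)
  have T: "?T x = t + (\<chi> k. c k * x $ k)" for x
  proof -
    have "(\<Sum>j\<in>Basis. (?c j * (x \<bullet> j)) *\<^sub>R j) = (\<Sum>k\<in>UNIV. (c k * x $ k) *\<^sub>R axis k 1)"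
      unfolding B by (subst sum.reindex[OF inj]) (simp add: inner_axis)
    also have "\<dots> = (\<chi> k. c k * x $ k)"
      by (simp add: vec_eq_iff axis_def if_distrib[of "(*) _"] sum.delta' cong: if_cong)
    finally show ?thesis by simp
  qed
  have P: "(\<Prod>j\<in>(Basis :: (real ^ 'n) set). \<bar>?c j\<bar>) = (\<Prod>k\<in>UNIV. \<bar>c k\<bar>)"
    unfolding B by (subst prod.reindex[OF inj]) simp
  have eq: "lborel = density (distr lborel borel ?T) (\<lambda>_. (\<Prod>j\<in>Basis. \<bar>?c j\<bar>))"
    by (rule lborel_affine_euclidean) (rule c)
  have Tm: "?T \<in> borel_measurable borel" by measurable
  have "(LBINT x. f x) = (\<integral>x. f x \<partial>density (distr lborel borel ?T) (\<lambda>_. ennreal (\<Prod>k\<in>UNIV. \<bar>c k\<bar>)))"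
    using eq unfolding P by simp
  also have "\<dots> = (\<integral>x. (\<Prod>k\<in>UNIV. \<bar>c k\<bar>) * f x \<partial>distr lborel borel ?T)"
    by (subst integral_density) (auto intro!: prod_nonneg AE_I2)
  also have "\<dots> = (LBINT x. (\<Prod>k\<in>UNIV. \<bar>c k\<bar>) * f (?T x))"
    using Tm by (intro integral_distr) auto
  finally show ?thesis unfolding T by simp
qed

definition section_sum :: "real \<Rightarrow> 'n \<Rightarrow> real ^ 'n::finite \<Rightarrow> real" where
  "section_sum q k0 y = (\<Sum>k\<in>UNIV - {k0}. \<bar>y $ k\<bar> powr q)"

text \<open>The power -p of the norm at the point obtained from y by setting coordinate
  \<open>k0\<close> to v.\<close>

definition slice :: "real \<Rightarrow> real \<Rightarrow> 'n \<Rightarrow> real ^ 'n::finite \<Rightarrow> real \<Rightarrow> real" where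
  "slice p q k0 y v = (section_sum q k0 y + \<bar>v\<bar> powr q) powr (- (p / q))"

lemma borel_measurable_section_sum [measurable]: "section_sum q k0 \<in> borel_measurable borel"
  unfolding section_sum_def[abs_def] by measurable

text \<open>Translating along the axis and scaling only coordinate \<open>k0\<close> by \<sigma>
  turns the Gaussian into a fixed one. All dependence on s and \<sigma> then sits in the argument of
  the slice, which is what dominated convergence needs; the Jacobian is \<sigma>.\<close>

lemma gauss_mean_slice:
  fixes k0 :: "'n::finite"
  assumes q: "0 < q" and \<sigma>: "0 < \<sigma>"
  shows "gauss_mean p q (\<lambda>k. if k = k0 then 1 / \<sigma>\<^sup>2 else 1) (s *\<^sub>R axis k0 1) =
    \<sigma> * (LBINT y. slice p q k0 y (s + \<sigma> * y $ k0) * gauss (\<lambda>_. 1) 0 y)"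
proof -
  let ?w = "\<lambda>k. if k = k0 then 1 / \<sigma>\<^sup>2 else 1"
  let ?v = "s *\<^sub>R axis k0 1 :: real ^ 'n"
  let ?c = "\<lambda>k. if k = k0 then \<sigma> else 1"
  let ?x = "\<lambda>y :: real ^ 'n. ?v + (\<chi> k. ?c k * y $ k)"
  have x: "?x y $ k = (if k = k0 then s + \<sigma> * y $ k0 else y $ k)" for y k
    by (simp add: axis_def)
  have N: "lq_norm q (?x y) powr (- p) = slice p q k0 y (s + \<sigma> * y $ k0)" for y
  proof -
    have "(\<Sum>k\<in>UNIV. \<bar>?x y $ k\<bar> powr q) = \<bar>s + \<sigma> * y $ k0\<bar> powr q + (\<Sum>k\<in>UNIV - {k0}. \<bar>?x y $ k\<bar> powr q)"
      by (subst sum.remove[of _ k0]) (simp_all only: x finite UNIV_I simp_thms if_True)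
    also have "(\<Sum>k\<in>UNIV - {k0}. \<bar>?x y $ k\<bar> powr q) = section_sum q k0 y"
      unfolding section_sum_def by (intro sum.cong refl) (simp only: x, simp)
    finally show ?thesis
      by (simp only: lq_norm_def slice_def powr_powr) (simp add: add.commute)
  qed
  have G: "gauss ?w ?v (?x y) = gauss (\<lambda>_. 1) 0 y" for y
  proof -
    have "?w k * (?x y $ k - ?v $ k)\<^sup>2 = 1 * (y $ k - (0 :: real ^ 'n) $ k)\<^sup>2" for k
      using \<sigma> by (simp add: axis_def power_mult_distrib)
    then show ?thesis unfolding gauss_def by simp
  qed
  have "gauss_mean p q ?w ?v = (\<Prod>k\<in>UNIV. \<bar>?c k\<bar>) * (LBINT y. lq_norm q (?x y) powr (- p) * gauss ?w ?v (?x y))"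
    unfolding gauss_mean_def using \<sigma> by (intro integral_lborel_scale_vec) auto
  also have "(\<Prod>k\<in>UNIV. \<bar>?c k\<bar>) = \<sigma>"
    using \<sigma> by (subst prod.remove[of _ k0]) auto
  finally show ?thesis unfolding N G .
qed

text \<open>The linear bound is Bernoulli's inequality (1 + x)^(-r) >= 1 - r x with x = b / a, from
  ln (1 + x) <= x and exp z >= 1 + z.\<close>

lemma powr_neg_diff_bounds:
  fixes a b r :: real
  assumes a: "0 < a" and b: "0 \<le> b" and r: "0 < r"
  shows "0 \<le> a powr (- r) - (a + b) powr (- r)"
    and "a powr (- r) - (a + b) powr (- r) \<le> a powr (- r) * (r * (b / a))"
    and "a powr (- r) - (a + b) powr (- r) \<le> a powr (- r)"
proof -
  show "0 \<le> a powr (- r) - (a + b) powr (- r)"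
    using assms by (simp add: powr_mono2')
  show "a powr (- r) - (a + b) powr (- r) \<le> a powr (- r)" by simp
  have x: "0 \<le> b / a" using a b by simp
  have "a + b = a * (1 + b / a)" using a by (simp add: field_simps)
  then have "(a + b) powr (- r) = a powr (- r) * (1 + b / a) powr (- r)"
    using a x by (simp add: powr_mult)
  moreover have "1 - r * (b / a) \<le> (1 + b / a) powr (- r)"
  proof -
    have "1 - r * (b / a) \<le> 1 - r * ln (1 + b / a)"
      using r ln_add_one_self_le_self[OF x] by (intro diff_left_mono mult_left_mono) auto
    also have "\<dots> \<le> exp (- r * ln (1 + b / a))"
      using exp_ge_add_one_self[of "- r * ln (1 + b / a)"] by simp
    also have "\<dots> = (1 + b / a) powr (- r)" using x by (simp add: powr_def)
    finally show ?thesis .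
  qed
  then have "a powr (- r) * (1 - r * (b / a)) \<le> a powr (- r) * (1 + b / a) powr (- r)"
    by (intro mult_left_mono) auto
  ultimately show "a powr (- r) - (a + b) powr (- r) \<le> a powr (- r) * (r * (b / a))"
    by (simp add: algebra_simps)
qed

text \<open>With x = |v|^q / a and a the section sum, the linear bound has factor x and the trivial
  one factor 1. Since 2 / q < 1, both are controlled by x^(2/q) = v^2 a^(-2/q). Interpolating costs
  only a^(-2/q), where the linear bound would cost a^(-1).\<close>

lemma slice_quadratic_bound:
  assumes a: "0 < section_sum q k0 y" and q: "2 < q" and p: "0 < p"
  shows "section_sum q k0 y powr (- (p / q)) - slice p q k0 y v \<le> (1 + p / q) * section_sum q k0 y powr (- ((p + 2) / q)) * v\<^sup>2"
proof (cases "v = 0")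
  case True
  then show ?thesis by (simp add: slice_def)
next
  case False
  let ?a = "section_sum q k0 y" and ?r = "p / q"
  let ?x = "\<bar>v\<bar> powr q / ?a"
  have r: "0 < ?r" using p q by simp
  have x: "0 < ?x" using a False by simp
  have v2: "?x powr (2 / q) = v\<^sup>2 * ?a powr (- (2 / q))"
  proof -
    have "?x powr (2 / q) = (\<bar>v\<bar> powr q) powr (2 / q) / ?a powr (2 / q)"
      by (rule powr_divide)
    also have "(\<bar>v\<bar> powr q) powr (2 / q) = v\<^sup>2" using q False by (simp add: powr_powr powr_numeral)
    finally show ?thesis by (simp add: powr_minus field_simps)
  qed
  have "?a powr (- ?r) - slice p q k0 y v \<le> ?a powr (- ?r) * ((1 + ?r) * ?x powr (2 / q))"
  proof (cases "?x \<le> 1")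
    case True
    have "?x powr 1 \<le> ?x powr (2 / q)" using True x q by (intro powr_mono') auto
    then have "?x \<le> ?x powr (2 / q)" using a by simp
    then have "?r * ?x \<le> ?r * ?x powr (2 / q)" using r by (intro mult_left_mono) auto
    also have "\<dots> \<le> (1 + ?r) * ?x powr (2 / q)" by (intro mult_right_mono) auto
    finally have "?a powr (- ?r) * (?r * ?x) \<le> ?a powr (- ?r) * ((1 + ?r) * ?x powr (2 / q))"
      by (intro mult_left_mono) auto
    with powr_neg_diff_bounds(2)[OF a _ r, of "\<bar>v\<bar> powr q"] show ?thesis by (simp add: slice_def)
  next
    case False
    have "1 * 1 \<le> (1 + ?r) * ?x powr (2 / q)"
      using False q r by (intro mult_mono ge_one_powr_ge_zero) auto
    then have "?a powr (- ?r) * 1 \<le> ?a powr (- ?r) * ((1 + ?r) * ?x powr (2 / q))"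
      by (intro mult_left_mono) auto
    moreover have "?a powr (- ?r) - slice p q k0 y v \<le> ?a powr (- ?r)" by (simp add: slice_def)
    ultimately show ?thesis by linarith
  qed
  also have "\<dots> = (1 + ?r) * (?a powr (- ?r) * ?a powr (- (2 / q))) * v\<^sup>2" unfolding v2 by simp
  also have "?a powr (- ?r) * ?a powr (- (2 / q)) = ?a powr (- ((p + 2) / q))"
    by (simp add: add_divide_distrib flip: powr_add)
  finally show ?thesis .
qed

text \<open>Nonnegative fourth differences make second differences at most quadruple when the step
  doubles. They therefore cannot be o(s^2) for small steps and positive for step 1, yet they are
  both after smoothing.\<close>

lemma fourth_diff_condition_fails:
  assumes q: "2 < q" and p: "0 < p" "p < real CARD('n) - 3"
    and pos: "\<And>w (v :: real ^ 'n::finite). (\<And>k. 0 < w k) \<Longrightarrow> 0 \<le> gauss_mean p q w (- v - v)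
      - 4 * gauss_mean p q w (- v) + 6 * gauss_mean p q w 0 - 4 * gauss_mean p q w v + gauss_mean p q w (v + v)"
  shows False
proof -
  obtain k0 :: 'n where True by simp
  let ?A = "UNIV - {k0} :: 'n set"
  have cA: "real (card ?A) = real CARD('n) - 1" using p by (simp add: card_Diff_singleton)
  have A0: "?A \<noteq> {}"
  proof
    assume "?A = {}"
    then have "real (card ?A) = 0" by (simp only: card.empty of_nat_0)
    with cA p show False by linarith
  qed
  have q0: "0 < q" using q by simp
  let ?r = "p / q" and ?a = "section_sum q k0" and ?Q = "slice p q k0"
  let ?\<Gamma> = "gauss (\<lambda>_. 1) (0 :: real ^ 'n)"
  let ?R = "\<lambda>y v. ?a y powr (- ?r) - ?Q y v"
  have r: "0 < ?r" using p q by simp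
  have \<Gamma>: "0 < ?\<Gamma> y" for y by (rule gauss_pos)
  have Qm [measurable]: "(\<lambda>y. ?Q y (s + t * y $ k0)) \<in> borel_measurable borel" for s t
    unfolding slice_def by measurable
  have apos: "AE y in lborel. 0 < ?a y"
    using AE_vec_nonzero
  proof eventually_elim
    case (elim y)
    then show ?case unfolding section_sum_def using A0 by (intro sum_pos) auto
  qed
  \<comment> \<open>Used with u = p, for the means to be finite, and with u = p + 2, for the
    quadratic majorant; the latter needs p + 2 < n - 1.\<close>
  have int: "integrable lborel (\<lambda>y. ?a y powr (- (u / q)) * ((1 + norm y) ^ 2 * ?\<Gamma> y))"
    if u: "0 \<le> u" "u < real CARD('n) - 1" for u
  proof -
    obtain C where C: "\<And>x :: real ^ 'n. (1 + norm x) ^ 2 * ?\<Gamma> x \<le> C * weight x"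
      by (rule gauss_poly_le_weight[where w = "\<lambda>_ :: 'n. 1" and m = 2 and v = 0]) auto
    let ?N = "\<lambda>y. ?a y powr (1 / q)"
    have "\<bar>y $ k\<bar> \<le> ?N y" if "k \<in> ?A" for y k
    proof -
      have "\<bar>y $ k\<bar> = (\<bar>y $ k\<bar> powr q) powr (1 / q)" using q by (simp add: powr_powr)
      also have "\<dots> \<le> ?N y" unfolding section_sum_def
        using that q by (intro powr_mono2 member_le_sum) auto
      finally show ?thesis .
    qed
    then have "integrable lborel (\<lambda>y. ?N y powr (- u) * weight y)"
      using u cA A0 by (intro integrable_powr_neg_weight[of ?A]) auto
    from integrable_mult_right[OF this, of C] show ?thesis
    proof (rule Bochner_Integration.integrable_bound)
      have le: "?a y powr (- (u / q)) * ((1 + norm y) ^ 2 * ?\<Gamma> y) \<le> C * (?N y powr (- u) * weight y)" for y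
        using mult_left_mono[OF C[of y], of "?a y powr (- (u / q))"] by (simp add: powr_powr mult_ac)
      have nn: "0 \<le> ?a y powr (- (u / q)) * ((1 + norm y) ^ 2 * ?\<Gamma> y)" for y
        by (intro mult_nonneg_nonneg less_imp_le[OF \<Gamma>]) auto
      show "AE y in lborel. norm (?a y powr (- (u / q)) * ((1 + norm y) ^ 2 * ?\<Gamma> y)) \<le> norm (C * (?N y powr (- u) * weight y))"
        unfolding real_norm_def abs_of_nonneg[OF nn] by (intro AE_I2 order_trans[OF le abs_ge_self])
    qed measurable
  qed
  have Q_le: "?Q y v \<le> ?a y powr (- ?r)" "0 \<le> ?Q y v" if "0 < ?a y" for y v
    using powr_neg_diff_bounds(1)[OF that, of "\<bar>v\<bar> powr q" ?r] r by (simp_all add: slice_def)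
  have int0: "integrable lborel (\<lambda>y. ?a y powr (- ?r) * ?\<Gamma> y)"
  proof (rule Bochner_Integration.integrable_bound[OF int[of p]])
    have "1 * ?\<Gamma> y \<le> (1 + norm y) ^ 2 * ?\<Gamma> y" for y
      by (intro mult_right_mono less_imp_le[OF \<Gamma>]) (simp add: one_le_power)
    then show "AE y in lborel. norm (?a y powr (- ?r) * ?\<Gamma> y) \<le> norm (?a y powr (- ?r) * ((1 + norm y) ^ 2 * ?\<Gamma> y))"
      using less_imp_le[OF \<Gamma>] by (intro AE_I2) (auto simp: abs_mult intro!: mult_left_mono)
  qed (use p in auto)
  have intQ: "integrable lborel (\<lambda>y. ?Q y (s + t * y $ k0) * ?\<Gamma> y)" for s t
    by (rule Bochner_Integration.integrable_bound[OF int0])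
       (use apos in \<open>auto elim!: eventually_mono simp: abs_mult abs_of_pos[OF \<Gamma>] Q_le intro!: mult_right_mono less_imp_le[OF \<Gamma>]\<close>)
  define M where "M t s = (LBINT y. ?Q y (s + t * y $ k0) * ?\<Gamma> y)" for t s
  \<comment> \<open>Half of a negated second central difference at 0, so positive when 0 dominates
    its neighbours on average.\<close>
  define D where "D t s = M t 0 - (M t s + M t (- s)) / 2" for t s
  have double: "D t (2 * s) \<le> 4 * D t s" if t: "0 < t" for t s
  proof -
    let ?w = "\<lambda>k. if k = k0 then 1 / t\<^sup>2 else 1"
    let ?v = "s *\<^sub>R axis k0 1 :: real ^ 'n"
    have gm: "gauss_mean p q ?w (s *\<^sub>R axis k0 1) = t * M t s" for s
      unfolding M_def by (rule gauss_mean_slice[OF q0 t])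
    have e: "- ?v - ?v = (- 2 * s) *\<^sub>R axis k0 1" "- ?v = (- s) *\<^sub>R axis k0 1" "?v + ?v = (2 * s) *\<^sub>R axis k0 1"
      by (simp_all add: vec_eq_iff)
    have gm': "gauss_mean p q ?w (- ?v - ?v) = t * M t (- 2 * s)" "gauss_mean p q ?w (- ?v) = t * M t (- s)"
      "gauss_mean p q ?w (?v + ?v) = t * M t (2 * s)" "gauss_mean p q ?w 0 = t * M t 0"
      using gm[of 0] by (simp_all only: e(1) gm scaleR_zero_left) (simp_all only: e gm)
    have "0 \<le> gauss_mean p q ?w (- ?v - ?v) - 4 * gauss_mean p q ?w (- ?v) + 6 * gauss_mean p q ?w 0
        - 4 * gauss_mean p q ?w ?v + gauss_mean p q ?w (?v + ?v)"
      by (rule pos) (use t in auto)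
    also have "\<dots> = t * (M t (- 2 * s) - 4 * M t (- s) + 6 * M t 0 - 4 * M t s + M t (2 * s))"
      unfolding gm gm' by (simp add: algebra_simps)
    finally have "0 \<le> M t (- 2 * s) - 4 * M t (- s) + 6 * M t 0 - 4 * M t s + M t (2 * s)"
      using t by (simp add: zero_le_mult_iff)
    \<comment> \<open>The right side minus the left side is half of the fourth difference.\<close>
    moreover have "m - (a + b) / 2 \<le> 4 * (m - (c + d) / 2)" if "0 \<le> b - 4 * d + 6 * m - 4 * c + a" for a b c d m :: real
      using that by (simp add: field_simps)
    ultimately show ?thesis unfolding D_def by simp
  qed
  have iter: "D t 1 \<le> 4 ^ k * D t (1 / 2 ^ k)" if t: "0 < t" for t k
  proof (induction k)
    case (Suc k)
    have "D t (1 / 2 ^ k) \<le> 4 * D t (1 / 2 ^ Suc k)" using double[OF t, of "1 / 2 ^ Suc k"] by simp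
    then have "4 ^ k * D t (1 / 2 ^ k) \<le> 4 ^ k * (4 * D t (1 / 2 ^ Suc k))" by (intro mult_left_mono) auto
    also have "\<dots> = 4 ^ Suc k * D t (1 / 2 ^ Suc k)" by simp
    finally show ?case by (rule order_trans[OF Suc])
  qed simp
  \<comment> \<open>One sequence serves as the smoothing width and as the final step. At a point of
    coordinate y the slices are then evaluated at multiples of \<open>\<sigma> k\<close> by
    constants, and \<open>4 ^ k\<close> cancels the square of \<open>\<sigma> k\<close> in the
    majorant.\<close>
  define \<sigma> :: "nat \<Rightarrow> real" where "\<sigma> k = 1 / 2 ^ k" for k
  have \<sigma>: "0 < \<sigma> k" "4 ^ k * (\<sigma> k)\<^sup>2 = 1" for k
    by (simp_all add: \<sigma>_def power_divide power2_eq_square flip: power_mult_distrib)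
  have \<sigma>0: "\<sigma> \<longlonglongrightarrow> 0"
    unfolding \<sigma>_def using LIMSEQ_realpow_zero[of "1/2"] by (simp add: power_one_over)
  have D_eq: "D t s = (LBINT y. (?Q y (t * y $ k0) - (?Q y (s + t * y $ k0) + ?Q y (- s + t * y $ k0)) / 2) * ?\<Gamma> y)" for t s
  proof -
    have "(LBINT y. (?Q y (t * y $ k0) - (?Q y (s + t * y $ k0) + ?Q y (- s + t * y $ k0)) / 2) * ?\<Gamma> y) =
      (LBINT y. ?Q y (0 + t * y $ k0) * ?\<Gamma> y - (1 / 2) * (?Q y (s + t * y $ k0) * ?\<Gamma> y + ?Q y (- s + t * y $ k0) * ?\<Gamma> y))"
      by (intro Bochner_Integration.integral_cong[OF refl]) (simp add: field_simps)
    also have "\<dots> = M t 0 - (1 / 2) * (M t s + M t (- s))"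
      unfolding M_def
      by (simp only: Bochner_Integration.integral_diff Bochner_Integration.integral_add integral_mult_right_zero intQ
        Bochner_Integration.integrable_add integrable_mult_right)
    finally show ?thesis by (simp add: D_def)
  qed
  \<comment> \<open>With the step fixed at 1 the smoothing disappears in the limit, leaving the drop
    of each slice from 0 to 1. The slices are even and bounded by their value at 0, which gives the
    majorant.\<close>
  have lim1: "(\<lambda>k. D (\<sigma> k) 1) \<longlonglongrightarrow> (LBINT y. ?R y 1 * ?\<Gamma> y)"
    unfolding D_eq
  proof (rule integral_dominated_convergence[where w = "\<lambda>y. 2 * (?a y powr (- ?r) * ?\<Gamma> y)"])
    show "integrable lborel (\<lambda>y. 2 * (?a y powr (- ?r) * ?\<Gamma> y))" using int0 by (rule integrable_mult_right)
    show "AE y in lborel. (\<lambda>k. (?Q y (\<sigma> k * y $ k0) - (?Q y (1 + \<sigma> k * y $ k0) + ?Q y (- 1 + \<sigma> k * y $ k0)) / 2) * ?\<Gamma> y)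
        \<longlonglongrightarrow> ?R y 1 * ?\<Gamma> y"
      using apos
    proof eventually_elim
      case (elim y)
      have Ql: "(\<lambda>k. ?Q y (f k)) \<longlonglongrightarrow> ?Q y l" if "f \<longlonglongrightarrow> l" for f l
        unfolding slice_def
      proof (rule tendsto_powr[OF tendsto_add[OF tendsto_const] tendsto_const])
        show "(\<lambda>k. \<bar>f k\<bar> powr q) \<longlonglongrightarrow> \<bar>l\<bar> powr q"
          using q that by (intro tendsto_powr' tendsto_rabs tendsto_const) auto
        show "section_sum q k0 y + \<bar>l\<bar> powr q \<noteq> 0" using elim powr_ge_zero[of "\<bar>l\<bar>" q] by linarith
      qed
      have z: "(\<lambda>k. \<sigma> k * y $ k0) \<longlonglongrightarrow> 0" using tendsto_mult_left_zero[OF \<sigma>0] .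
      have "(\<lambda>k. (?Q y (\<sigma> k * y $ k0) - (?Q y (1 + \<sigma> k * y $ k0) + ?Q y (- 1 + \<sigma> k * y $ k0)) / 2) * ?\<Gamma> y)
          \<longlonglongrightarrow> (?Q y 0 - (?Q y (1 + 0) + ?Q y (- 1 + 0)) / 2) * ?\<Gamma> y"
        by (intro tendsto_mult tendsto_diff tendsto_divide tendsto_add tendsto_const Ql z) auto
      also have "(?Q y 0 - (?Q y (1 + 0) + ?Q y (- 1 + 0)) / 2) * ?\<Gamma> y = ?R y 1 * ?\<Gamma> y"
        by (simp add: slice_def)
      finally show ?case .
    qed
    show "AE y in lborel. norm ((?Q y (\<sigma> k * y $ k0) - (?Q y (1 + \<sigma> k * y $ k0) + ?Q y (- 1 + \<sigma> k * y $ k0)) / 2) * ?\<Gamma> y)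
        \<le> 2 * (?a y powr (- ?r) * ?\<Gamma> y)" for k
      using apos
    proof eventually_elim
      case (elim y)
      have "\<bar>?Q y (\<sigma> k * y $ k0) - (?Q y (1 + \<sigma> k * y $ k0) + ?Q y (- 1 + \<sigma> k * y $ k0)) / 2\<bar> \<le> 2 * ?a y powr (- ?r)"
      proof -
        have "\<bar>u - (v + w) / 2\<bar> \<le> 2 * a" if "u \<le> a" "0 \<le> u" "v \<le> a" "0 \<le> v" "w \<le> a" "0 \<le> w" for u v w a :: real
          using that by (simp add: abs_le_iff field_simps)
        then show ?thesis by this (rule Q_le[OF elim])+
      qed
      from mult_right_mono[OF this less_imp_le[OF \<Gamma>[of y]]] show ?case
        by (simp only: real_norm_def abs_mult abs_of_pos[OF \<Gamma>] mult.assoc)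
    qed
    show "(\<lambda>y. (?Q y (\<sigma> k * y $ k0) - (?Q y (1 + \<sigma> k * y $ k0) + ?Q y (- 1 + \<sigma> k * y $ k0)) / 2) * ?\<Gamma> y) \<in> borel_measurable lborel" for k
      unfolding slice_def by measurable
  qed (unfold slice_def, measurable)
  let ?e = "\<lambda>k y. 4 ^ k * (?Q y (\<sigma> k * y $ k0) - (?Q y (\<sigma> k + \<sigma> k * y $ k0) + ?Q y (- \<sigma> k + \<sigma> k * y $ k0)) / 2) * ?\<Gamma> y"
  have lim2: "(\<lambda>k. LBINT y. ?e k y) \<longlonglongrightarrow> (\<integral>y. 0 \<partial>(lborel :: (real^'n) measure))"
  proof (rule integral_dominated_convergence[where w = "\<lambda>y. 2 * (1 + ?r) * (?a y powr (- ((p + 2) / q)) * ((1 + norm y) ^ 2 * ?\<Gamma> y))"])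
    show "integrable lborel (\<lambda>y. 2 * (1 + ?r) * (?a y powr (- ((p + 2) / q)) * ((1 + norm y) ^ 2 * ?\<Gamma> y)))"
      using p by (intro integrable_mult_right int) auto
    \<comment> \<open>In terms of the drops \<open>?R\<close> from the axis value the constants
      cancel, and each remaining term is small at small arguments.\<close>
    have eR: "?e k y = 4 ^ k * ((?R y (\<sigma> k * (1 + y $ k0)) + ?R y (\<sigma> k * (- 1 + y $ k0))) / 2 - ?R y (\<sigma> k * y $ k0)) * ?\<Gamma> y" for k y
      by (simp add: algebra_simps add_divide_distrib diff_divide_distrib)
    have R0: "0 \<le> ?R y v" if "0 < ?a y" for y v using Q_le(1)[OF that, of v] by simp
    show "AE y in lborel. (\<lambda>k. ?e k y) \<longlonglongrightarrow> 0"
      using apos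
    proof eventually_elim
      case (elim y)
      have Rl: "(\<lambda>k. 4 ^ k * ?R y (\<sigma> k * c)) \<longlonglongrightarrow> 0" for c
      proof -
        let ?K = "?a y powr (- ?r) * (?r * (\<bar>c\<bar> powr q / ?a y))"
        \<comment> \<open>The pointwise limit uses the linear bound in |v|^q: the factor 4^k 2^(-kq)
          = 2^(k (2 - q)) tends to 0 because q > 2. Its power of the section sum need not be
          integrable, so domination uses the quadratic bound instead.\<close>
        have le: "4 ^ k * ?R y (\<sigma> k * c) \<le> (2 powr (2 - q)) ^ k * ?K" for k
        proof -
          have s: "4 ^ k * (\<sigma> k) powr q = (2 powr (2 - q)) ^ k"
          proof -
            have "\<sigma> k = 2 powr (- real k)" by (simp add: \<sigma>_def powr_minus powr_realpow inverse_eq_divide)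
            moreover have "(4::real) ^ k = 2 powr (2 * real k)" by (simp add: powr_realpow[symmetric] power_mult flip: powr_powr)
            ultimately have "4 ^ k * (\<sigma> k) powr q = 2 powr (real k * (2 - q))"
              by (simp add: powr_powr algebra_simps flip: powr_add)
            then show ?thesis by (simp add: powr_powr mult.commute flip: powr_realpow)
          qed
          have "?R y (\<sigma> k * c) \<le> ?a y powr (- ?r) * (?r * (\<bar>\<sigma> k * c\<bar> powr q / ?a y))"
            using powr_neg_diff_bounds(2)[OF elim _ r, of "\<bar>\<sigma> k * c\<bar> powr q"] by (simp add: slice_def)
          also have "\<bar>\<sigma> k * c\<bar> powr q = (\<sigma> k) powr q * \<bar>c\<bar> powr q"
            using \<sigma>(1)[of k] by (simp add: abs_mult powr_mult)
          finally have "4 ^ k * ?R y (\<sigma> k * c) \<le> 4 ^ k * (?a y powr (- ?r) * (?r * ((\<sigma> k) powr q * \<bar>c\<bar> powr q / ?a y)))"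
            by (intro mult_left_mono) auto
          also have "\<dots> = (4 ^ k * (\<sigma> k) powr q) * ?K" by simp
          finally show ?thesis unfolding s .
        qed
        have "(2::real) powr (2 - q) < 1" using q powr_less_mono[of "2 - q" 0 2] by simp
        then have "(\<lambda>k. (2 powr (2 - q)) ^ k * ?K) \<longlonglongrightarrow> 0"
          by (intro tendsto_mult_left_zero LIMSEQ_realpow_zero) auto
        then show ?thesis
          by (rule tendsto_sandwich[OF _ _ tendsto_const, rotated 2])
             (use le R0[OF elim] in \<open>auto intro!: always_eventually mult_nonneg_nonneg\<close>)
      qed
      have "(\<lambda>k. ((4 ^ k * ?R y (\<sigma> k * (1 + y $ k0)) + 4 ^ k * ?R y (\<sigma> k * (- 1 + y $ k0))) / 2 - 4 ^ k * ?R y (\<sigma> k * y $ k0)) * ?\<Gamma> y)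
          \<longlonglongrightarrow> ((0 + 0) / 2 - 0) * ?\<Gamma> y"
        by (intro tendsto_mult tendsto_diff tendsto_divide tendsto_add tendsto_const Rl) auto
      moreover have "(\<lambda>k. ((4 ^ k * ?R y (\<sigma> k * (1 + y $ k0)) + 4 ^ k * ?R y (\<sigma> k * (- 1 + y $ k0))) / 2 - 4 ^ k * ?R y (\<sigma> k * y $ k0)) * ?\<Gamma> y) = (\<lambda>k. ?e k y)"
        unfolding eR by (rule ext) (simp only: distrib_left[symmetric] times_divide_eq_right[symmetric] right_diff_distrib[symmetric])
      ultimately show ?case by simp
    qed
    show "AE y in lborel. norm (?e k y) \<le> 2 * (1 + ?r) * (?a y powr (- ((p + 2) / q)) * ((1 + norm y) ^ 2 * ?\<Gamma> y))" for k
      using apos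
    proof eventually_elim
      case (elim y)
      let ?K = "(1 + ?r) * ?a y powr (- ((p + 2) / q))"
      have K0: "0 \<le> ?K" using r by simp
      have le: "?R y (\<sigma> k * c) \<le> ?K * (\<sigma> k)\<^sup>2 * c\<^sup>2" for c
        using slice_quadratic_bound[OF elim q p(1), of "\<sigma> k * c"] by (simp add: power_mult_distrib mult_ac)
      let ?E = "(?R y (\<sigma> k * (1 + y $ k0)) + ?R y (\<sigma> k * (- 1 + y $ k0))) / 2 - ?R y (\<sigma> k * y $ k0)"
      have "\<bar>?E\<bar> \<le> (?K * (\<sigma> k)\<^sup>2 * (1 + y $ k0)\<^sup>2 + ?K * (\<sigma> k)\<^sup>2 * (- 1 + y $ k0)\<^sup>2) / 2 + ?K * (\<sigma> k)\<^sup>2 * (y $ k0)\<^sup>2"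
      proof -
        have "\<bar>(u + v) / 2 - w\<bar> \<le> (a + b) / 2 + c" if "0 \<le> u" "u \<le> a" "0 \<le> v" "v \<le> b" "0 \<le> w" "w \<le> c" for u v w a b c :: real
          using that by (simp add: abs_le_iff field_simps)
        then show ?thesis by this (rule R0[OF elim] le)+
      qed
      also have "\<dots> = ?K * (\<sigma> k)\<^sup>2 * (1 + 2 * (y $ k0)\<^sup>2)"
      proof -
        have "(K * S * (1 + z)\<^sup>2 + K * S * (- 1 + z)\<^sup>2) / 2 + K * S * z\<^sup>2 = K * S * (1 + 2 * z\<^sup>2)" for K S z :: real
          by (simp add: power2_eq_square algebra_simps)
        then show ?thesis .
      qed
      also have "\<dots> \<le> ?K * (\<sigma> k)\<^sup>2 * (2 * (1 + norm y) ^ 2)"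
      proof (intro mult_left_mono)
        have "(y $ k0)\<^sup>2 \<le> (norm y)\<^sup>2" by (simp add: component_le_norm_cart flip: abs_le_square_iff)
        moreover have "2 * (1 + norm y) ^ 2 = 2 + 4 * norm y + 2 * (norm y)\<^sup>2" by (simp add: power2_sum)
        ultimately show "1 + 2 * (y $ k0)\<^sup>2 \<le> 2 * (1 + norm y) ^ 2" using norm_ge_zero[of y] by linarith
      qed (use K0 in auto)
      finally have "4 ^ k * \<bar>?E\<bar> \<le> 4 ^ k * (?K * (\<sigma> k)\<^sup>2 * (2 * (1 + norm y) ^ 2))" by (intro mult_left_mono) auto
      also have "\<dots> = (4 ^ k * (\<sigma> k)\<^sup>2) * (2 * ?K * (1 + norm y) ^ 2)" by (simp only: mult_ac)
      finally have "4 ^ k * \<bar>?E\<bar> \<le> 2 * ?K * (1 + norm y) ^ 2" unfolding \<sigma>(2) by simp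
      from mult_right_mono[OF this less_imp_le[OF \<Gamma>[of y]]]
      have "4 ^ k * \<bar>?E\<bar> * ?\<Gamma> y \<le> 2 * ?K * (1 + norm y) ^ 2 * ?\<Gamma> y" .
      moreover have "norm (?e k y) = 4 ^ k * \<bar>?E\<bar> * ?\<Gamma> y"
        unfolding eR real_norm_def abs_mult abs_of_pos[OF \<Gamma>] by simp
      ultimately show ?case by (simp only: mult_ac)
    qed
    show "?e k \<in> borel_measurable lborel" for k
      unfolding slice_def by measurable
  qed simp
  have Ri: "integrable lborel (\<lambda>y. ?R y 1 * ?\<Gamma> y)"
    using Bochner_Integration.integrable_diff[OF int0 intQ[of 1 0]] by (simp add: left_diff_distrib)
  have Rp: "AE y in lborel. 0 < ?R y 1 * ?\<Gamma> y"
    using apos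
  proof eventually_elim
    case (elim y)
    have "(?a y + 1) powr (- ?r) < ?a y powr (- ?r)" using elim r by (intro powr_less_mono2_neg) auto
    then show ?case using \<Gamma>[of y] by (simp add: slice_def)
  qed
  \<comment> \<open>Each slice strictly decreases from 0 to 1, so the limit of the left sides of
    \<open>iter\<close> is positive, while the right sides tend to 0.\<close>
  have "0 < (LBINT y. ?R y 1 * ?\<Gamma> y)"
    by (rule integral_pos_AE[OF Ri Rp]) simp
  moreover have "(LBINT y. ?R y 1 * ?\<Gamma> y) \<le> 0"
  proof (rule LIMSEQ_le[OF lim1])
    show "(\<lambda>k. LBINT y. ?e k y) \<longlonglongrightarrow> 0" using lim2 by simp
    have "D (\<sigma> k) 1 \<le> (LBINT y. ?e k y)" for k
    proof -
      have "(LBINT y. ?e k y) = 4 ^ k * D (\<sigma> k) (\<sigma> k)"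
        unfolding D_eq by (simp only: mult.assoc integral_mult_right_zero)
      with iter[OF \<sigma>(1)[of k], of k] show ?thesis by (simp add: \<sigma>_def)
    qed
    then show "\<exists>N. \<forall>k\<ge>N. D (\<sigma> k) 1 \<le> (LBINT y. ?e k y)" by blast
  qed
  ultimately show False by simp
qed

theorem theorem4:
  fixes p q :: real
  assumes "CARD('n::finite) \<ge> 3"
    and "0 < p" and "p < real CARD('n)"
    and "2 < q"
  shows "tempered_distribution (function_distribution (\<lambda>x :: real ^ 'n. lq_norm q x powr (- p))) \<and>
    (p \<in> {real CARD('n) - 3..<real CARD('n)} \<longrightarrow>
      positive_definite (function_distribution (\<lambda>x :: real ^ 'n. lq_norm q x powr (- p)))) \<and>
    (p \<in> {0<..<real CARD('n) - 3} \<longrightarrow>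
      \<not> positive_definite (function_distribution (\<lambda>x :: real ^ 'n. lq_norm q x powr (- p)))) \<and>
    (embeds_in_L_neg p (lq_norm q :: real ^ 'n \<Rightarrow> real) \<longleftrightarrow>
      p \<in> {real CARD('n) - 3..<real CARD('n)})"
proof -
  let ?T = "function_distribution (\<lambda>x :: real ^ 'n. lq_norm q x powr (- p))"
  have q0: "0 < q" using assms by simp
  \<comment> \<open>Stated for autocorrelations that are Schwartz, so that the hypothetical
    embedding may be applied to them directly.\<close>
  have neg: False
    if "p < real CARD('n) - 3"
      and pos: "\<And>\<phi> :: real ^ 'n \<Rightarrow> complex. \<phi> \<in> schwartz \<Longrightarrow> autocorrelation \<phi> \<in> schwartz \<Longrightarrow>
        (LBINT x. complex_of_real (lq_norm q x powr (- p)) * autocorrelation \<phi> x) \<in> \<real>\<^sub>\<ge>\<^sub>0"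
  proof (rule fourth_diff_condition_fails[OF assms(4,2) that(1)])
    fix w :: "'n \<Rightarrow> real" and v :: "real ^ 'n"
    assume "\<And>k. 0 < w k"
    then show "0 \<le> gauss_mean p q w (- v - v) - 4 * gauss_mean p q w (- v) + 6 * gauss_mean p q w 0
        - 4 * gauss_mean p q w v + gauss_mean p q w (v + v)"
      using assms by (intro fourth_diff_gauss_mean_nonneg[OF q0 _ _ pos]) auto
  qed
  have not_pd: "\<not> positive_definite ?T" if lt: "p < real CARD('n) - 3"
  proof
    assume "positive_definite ?T"
    then show False
      by (intro neg[OF lt])
        (simp add: positive_definite_def function_distribution_def autocorrelation_def)
  qed
  have not_embeds: "\<not> embeds_in_L_neg p (lq_norm q :: real ^ 'n \<Rightarrow> real)" if lt: "p < real CARD('n) - 3"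
  proof
    assume "embeds_in_L_neg p (lq_norm q :: real ^ 'n \<Rightarrow> real)"
    then obtain \<gamma> :: "(real ^ 'n) measure" where
      "\<forall>\<phi>\<in>schwartz. (LBINT x. complex_of_real (lq_norm q x powr (- p)) * \<phi> x) = (\<integral>\<xi>. radial_ft p \<phi> \<xi> \<partial>\<gamma>)"
      unfolding embeds_in_L_neg_def radial_ft_def by blast
    then show False
      by (intro neg[OF lt]) (simp add: integral_radial_ft_autocorrelation_nonneg)
  qed
  have "tempered_distribution ?T"
    using assms by (intro tempered_lq) auto
  moreover have "positive_definite ?T" "embeds_in_L_neg p (lq_norm q :: real ^ 'n \<Rightarrow> real)"
    if "p \<in> {real CARD('n) - 3..<real CARD('n)}"
    using positive_definite_lq[OF assms(4,2)] embeds_lq[OF assms(4,2)] that by auto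
  ultimately show ?thesis
    using not_pd not_embeds assms(3) by (auto simp: not_less[symmetric])
qed

end
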